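(* Let $f:\mathbb{R}^n\to\mathbb{R}^n$ have bounded second derivatives, let $\Gamma,\sigma\in\mathbb{R}^{n\times n}$ be constant matrices with $\sigma\sigma^T=2k_B\Theta\,\Gamma$, and let $z(t)=(x(t),v(t))$, $0\le t\le T$, be the solution of the Langevin equation $$dx=v\,dt,\qquad dv=f(x)\,dt-\Gamma v\,dt+\sigma\,dW_t .$$ At step $k$ let $$A=(\Delta t\,v-\sigma\Delta U_k)\cdot\nabla_x,\qquad B=\big(\Delta t(f(x)-\Gamma v)+\sigma\Delta W_k+\Gamma\sigma\Delta U_k\big)\cdot\nabla_v .$$ Then: (i) the non-symmetric splitting scheme $z_{k+1}=\exp(A)\exp(B)z_k$ yields an approximation with strong order $1$; (ii) the symmetric splitting scheme $z_{k+1}=\exp(\tfrac A2)\exp(B)\exp(\tfrac A2)z_k$ has strong order $2$; (iii) the other symmetric splitting scheme $z_{k+1}=\exp(\tfrac B2)\exp(A)\exp(\tfrac B2)z_k$ has the same order, strong order $2$.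
   Context: $W=(W^1,\dots,W^n)$ is a standard $n$-dimensional Brownian motion, $k_B$ is Boltzmann's constant and $\Theta$ is the temperature (a constant). The interval $[0,T]$ is discretized uniformly: $t_k=k\Delta t$, $k=0,\dots,n_T$, $n_T\Delta t=T$. The numerical solution $z_k=(x_k,v_k)$ starts from the same initial value as the exact solution and is driven by the same Brownian motion. Strong order: a discrete-time approximation $Y=Y^{\Delta t}$ of $X$ with uniform step size $\Delta t$ converges with (has) strong order $\gamma\in\{0.5,1,1.5,2,\dots\}$ at time $T>0$ if there are constants $C$ and $\Delta>0$ such that $$\mathbb{E}\Big(\sup_{0\le k\le n_T}|X(k\Delta t)-Y(k\Delta t)|\Big)\le C\,\Delta t^{\gamma}\quad\text{for all }0<\Delta t<\Delta .$$ Random variables at step $k$: $\Delta W_k=W_{t_{k+1}}-W_{t_k}\in\mathbb{R}^n$ and $\Delta U_k=(\Delta U_k^1,\dots,\Delta U_k^n)$ with $$\Delta U_k^j=\tfrac12\Big(\int_{t_k}^{t_{k+1}}(t-t_k)\,dW_t^j-\int_{t_k}^{t_{k+1}}(W_t^j-W_{t_k}^j)\,dt\Big).$$ For a first-order differential operator $D=p(x,v)\cdot\nabla_x+q(x,v)\cdot\nabla_v$ (with the random variables realized and fixed), $\exp(D)$ is the time-one solution map of the ODE system $x'=p(x,v),\ v'=q(x,v)$, and $\exp(D/2)$ is its time-$\tfrac12$ solution map. Products are compositions of maps, the rightmost factor being applied first.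
   Formalization: The first derivative of f is also assumed bounded (f globally Lipschitz): with only bounded second derivatives, e.g. f(x) = -x|x| for |x| ≥ 1, the scheme's expected error diverges. The initial value may be random with finite second moment. *)

theory Defs
  imports "HOL-Probability.Probability"
begin

section \<open>Brownian motion\<close>

text \<open>
  Standard \<open>n\<close>-dimensional Brownian motion with respect to a filtration \<open>F\<close>.  Only times
  \<open>t \<ge> 0\<close> matter; the index type of the filtration is \<open>real\<close> merely for convenience.
\<close>

definition brownian_motion ::
    "'w measure \<Rightarrow> (real \<Rightarrow> 'w measure) \<Rightarrow> (real \<Rightarrow> 'w \<Rightarrow> real ^ 'n) \<Rightarrow> bool" where
  "brownian_motion M F W \<longleftrightarrow>
     prob_space M \<and> filtration (space M) F \<and> (\<forall>t. subalgebra M (F t)) \<and>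
     (\<forall>t\<ge>0. W t \<in> borel_measurable (F t)) \<and>
     (AE \<omega> in M. W 0 \<omega> = 0) \<and>
     (AE \<omega> in M. continuous_on {0..} (\<lambda>t. W t \<omega>)) \<and>
     (\<forall>s t. 0 \<le> s \<and> s < t \<longrightarrow>
        prob_space.indep_set M (sets (F s))
          (sets (vimage_algebra (space M) (\<lambda>\<omega>. W t \<omega> - W s \<omega>) borel)) \<and>
        prob_space.indep_vars M (\<lambda>_. borel) (\<lambda>j \<omega>. W t \<omega> $ j - W s \<omega> $ j) UNIV \<and>
        (\<forall>j. distributed M lborel (\<lambda>\<omega>. W t \<omega> $ j - W s \<omega> $ j)
               (\<lambda>r. ennreal (normal_density 0 (sqrt (t - s)) r))))"

text \<open>
  The stochastic integral of a deterministic continuous integrand \<open>g\<close> over \<open>[a, b]\<close>: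
  the mean-square limit of the left-endpoint sums as the mesh of the partition tends to \<open>0\<close>.
  It is determined up to null sets; \<open>wiener_integral\<close> picks a version.
\<close>

definition has_wiener_integral ::
    "'w measure \<Rightarrow> (real \<Rightarrow> 'w \<Rightarrow> real) \<Rightarrow> (real \<Rightarrow> real) \<Rightarrow> real \<Rightarrow> real \<Rightarrow> ('w \<Rightarrow> real) \<Rightarrow> bool" where
  "has_wiener_integral M B g a b I \<longleftrightarrow>
     I \<in> borel_measurable M \<and>
     (\<forall>\<epsilon>>0. \<exists>\<delta>>0. \<forall>(m::nat) s.
        s 0 = a \<and> s m = b \<and> (\<forall>i<m. s i \<le> s (Suc i) \<and> s (Suc i) - s i < \<delta>) \<longrightarrow>
        (\<integral>\<^sup>+\<omega>. ennreal (((\<Sum>i<m. g (s i) * (B (s (Suc i)) \<omega> - B (s i) \<omega>)) - I \<omega>)\<^sup>2) \<partial>M)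
          < ennreal \<epsilon>)"

definition wiener_integral ::
    "'w measure \<Rightarrow> (real \<Rightarrow> 'w \<Rightarrow> real) \<Rightarrow> (real \<Rightarrow> real) \<Rightarrow> real \<Rightarrow> real \<Rightarrow> 'w \<Rightarrow> real" where
  "wiener_integral M B g a b = (SOME I. has_wiener_integral M B g a b I)"

section \<open>The Langevin equation\<close>

text \<open>
  Strong solution on \<open>[0, T]\<close> of \<open>dx = v dt\<close>, \<open>dv = f(x) dt - \<Gamma> v dt + \<sigma> dW\<close> in integral form.
  Since \<open>\<sigma>\<close> is constant, the stochastic integral of \<open>\<sigma>\<close> over \<open>[0, t]\<close> is \<open>\<sigma> (W t - W 0)\<close>.
  The initial value is the possibly random, \<open>F 0\<close>-measurable \<open>(x 0, v 0)\<close>.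
\<close>

definition langevin_solution ::
    "'w measure \<Rightarrow> (real \<Rightarrow> 'w measure) \<Rightarrow> (real \<Rightarrow> 'w \<Rightarrow> real ^ 'n) \<Rightarrow> real \<Rightarrow>
     (real ^ 'n \<Rightarrow> real ^ 'n) \<Rightarrow> real ^ 'n ^ 'n \<Rightarrow> real ^ 'n ^ 'n \<Rightarrow>
     (real \<Rightarrow> 'w \<Rightarrow> real ^ 'n) \<Rightarrow> (real \<Rightarrow> 'w \<Rightarrow> real ^ 'n) \<Rightarrow> bool" where
  "langevin_solution M F W T f \<Gamma> \<sigma> x v \<longleftrightarrow>
     (\<forall>t\<in>{0..T}. x t \<in> borel_measurable (F t) \<and> v t \<in> borel_measurable (F t)) \<and>
     (AE \<omega> in M.
        continuous_on {0..T} (\<lambda>t. x t \<omega>) \<and> continuous_on {0..T} (\<lambda>t. v t \<omega>) \<and>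
        (\<forall>t\<in>{0..T}.
           x t \<omega> = x 0 \<omega> + integral {0..t} (\<lambda>s. v s \<omega>) \<and>
           v t \<omega> = v 0 \<omega> + integral {0..t} (\<lambda>s. f (x s \<omega>) - \<Gamma> *v v s \<omega>)
                    + \<sigma> *v (W t \<omega> - W 0 \<omega>)))"

section \<open>The splitting schemes\<close>

definition delta_W :: "(real \<Rightarrow> 'w \<Rightarrow> real ^ 'n) \<Rightarrow> real \<Rightarrow> nat \<Rightarrow> 'w \<Rightarrow> real ^ 'n" where
  "delta_W W h k \<omega> = W (real (Suc k) * h) \<omega> - W (real k * h) \<omega>"

definition delta_U :: "'w measure \<Rightarrow> (real \<Rightarrow> 'w \<Rightarrow> real ^ 'n) \<Rightarrow> real \<Rightarrow> nat \<Rightarrow> 'w \<Rightarrow> real ^ 'n" where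
  "delta_U M W h k \<omega> = (\<chi> j. 1/2 *
     (wiener_integral M (\<lambda>t \<omega>. W t \<omega> $ j) (\<lambda>t. t - real k * h)
        (real k * h) (real (Suc k) * h) \<omega>
      - integral {real k * h .. real (Suc k) * h} (\<lambda>t. W t \<omega> $ j - W (real k * h) \<omega> $ j)))"

text \<open>
  A first-order differential operator \<open>p \<cdot> \<nabla>\<^sub>x + q \<cdot> \<nabla>\<^sub>v\<close> is represented by its vector field
  \<open>D (x, v) = (p (x, v), q (x, v))\<close>.  \<open>flow_map \<tau> D\<close> is the time-\<open>\<tau>\<close> solution map of the
  autonomous system \<open>z' = D z\<close>, so that \<open>exp(D) = flow_map 1 D\<close> and
  \<open>exp(D/2) = flow_map (1/2) D\<close>.
\<close>

definition flow_map :: "real \<Rightarrow> ('z::real_normed_vector \<Rightarrow> 'z) \<Rightarrow> 'z \<Rightarrow> 'z" where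
  "flow_map \<tau> D z = (THE y. \<exists>\<gamma>. \<gamma> 0 = z \<and> \<gamma> \<tau> = y \<and>
     (\<forall>s\<in>{0..\<tau>}. (\<gamma> has_vector_derivative D (\<gamma> s)) (at s within {0..\<tau>})))"

text \<open>The fields of \<open>A\<close> and \<open>B\<close> for step size \<open>h\<close> and realized increments \<open>w\<close> (of \<open>W\<close>) and
  \<open>u\<close> (of \<open>U\<close>).\<close>

definition field_A ::
    "real ^ 'n ^ 'n \<Rightarrow> real \<Rightarrow> real ^ 'n \<Rightarrow> (real ^ 'n) \<times> (real ^ 'n) \<Rightarrow> (real ^ 'n) \<times> (real ^ 'n)" where
  "field_A \<sigma> h u = (\<lambda>(x, v). (h *\<^sub>R v - \<sigma> *v u, 0))"

definition field_B ::
    "(real ^ 'n \<Rightarrow> real ^ 'n) \<Rightarrow> real ^ 'n ^ 'n \<Rightarrow> real ^ 'n ^ 'n \<Rightarrow> real \<Rightarrow> real ^ 'n \<Rightarrow> real ^ 'n \<Rightarrow>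
     (real ^ 'n) \<times> (real ^ 'n) \<Rightarrow> (real ^ 'n) \<times> (real ^ 'n)" where
  "field_B f \<Gamma> \<sigma> h w u =
     (\<lambda>(x, v). (0, h *\<^sub>R (f x - \<Gamma> *v v) + \<sigma> *v w + \<Gamma> *v (\<sigma> *v u)))"

primrec iterate_steps :: "(nat \<Rightarrow> 'z \<Rightarrow> 'z) \<Rightarrow> 'z \<Rightarrow> nat \<Rightarrow> 'z" where
  "iterate_steps \<Phi> z 0 = z"
| "iterate_steps \<Phi> z (Suc k) = \<Phi> k (iterate_steps \<Phi> z k)"

section \<open>Strong order of convergence\<close>

text \<open>
  \<open>Y h k\<close> is the approximation of \<open>X (k h)\<close> with step size \<open>h\<close>; the step sizes are those that
  divide \<open>T\<close>.  The expectation is a nonnegative Lebesgue integral, so the bound includes its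
  finiteness.
\<close>

definition strong_order ::
    "'w measure \<Rightarrow> real \<Rightarrow> real \<Rightarrow> (real \<Rightarrow> 'w \<Rightarrow> 'z::real_normed_vector) \<Rightarrow>
     (real \<Rightarrow> nat \<Rightarrow> 'w \<Rightarrow> 'z) \<Rightarrow> bool" where
  "strong_order M T p X Y \<longleftrightarrow>
     (\<exists>C \<Delta>. \<Delta> > 0 \<and> (\<forall>h N. 0 < h \<and> h < \<Delta> \<and> real N * h = T \<longrightarrow>
        (\<integral>\<^sup>+\<omega>. (SUP k\<in>{..N}. ennreal (norm (X (real k * h) \<omega> - Y h k \<omega>))) \<partial>M)
          \<le> ennreal (C * h powr p)))"

end

theory Submission
  imports Defs
begin

text \<open>
  Write \<open>b = f(x) - \<Gamma> v\<close>, and over a step of length \<open>h\<close> starting at \<open>t\<^sub>k\<close> let \<open>w\<close> be the increment of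
  \<open>W\<close>, \<open>I\<close> the integral of \<open>W - W(t\<^sub>k)\<close> and \<open>J\<close> the iterated integral of \<open>W - W(t\<^sub>k)\<close>.  Integration
  by parts turns the stochastic integral in \<open>\<Delta>U\<close> into \<open>h w - I\<close>, so that \<open>\<Delta>U = h w / 2 - I\<close>
  (\<open>delta_U_eq\<close>).  Expanding the equation along a path gives

    \<open>x(t\<^sub>k + h) = x + h v + \<sigma> I + h\<^sup>2/2 b - \<Gamma> \<sigma> J + O(h\<^sup>3)\<close>,
    \<open>v(t\<^sub>k + h) = v + h b + \<sigma> w - \<Gamma> \<sigma> I + h\<^sup>2/2 (f'(x) v - \<Gamma> b) + (f'(x) \<sigma> + \<Gamma>\<^sup>2 \<sigma>) J + O(h\<^sup>3)\<close>.

  The shifts by \<open>\<Delta>U\<close> in the fields of \<open>A\<close> and \<open>B\<close> are chosen such that both symmetric compositions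
  reproduce all terms except multiples of \<open>J\<close>, \<open>h I\<close> and \<open>h\<^sup>2 w\<close>; the composition \<open>exp(A) exp(B)\<close>
  moreover misses \<open>h \<sigma> w / 2\<close> in the position.  A step taken from the exact solution therefore has a
  defect \<open>m + r\<close>.  The part \<open>m\<close> is the image of \<open>w\<close>, \<open>I\<close>, \<open>J\<close> under linear maps known at time \<open>t\<^sub>k\<close>, hence
  has conditional mean zero, and its variance is of order \<open>h\<^sup>3\<close> in the first case and \<open>h\<^sup>5\<close> in the
  other two.  The part \<open>r\<close> is bounded by a constant times \<open>h\<^sup>2 S\<^sup>2\<close> and \<open>h\<^sup>3 S\<^sup>2\<close>, respectively, where \<open>S\<close>
  is a square-integrable bound for the initial value and for the path of \<open>W\<close> on \<open>[0, T]\<close>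
  (\<open>local_defects\<close>, \<open>noise_order_ABA\<close>, \<open>noise_order_BAB\<close>).

  For order \<open>p\<close>, adding up the remainders over \<open>T / h\<close> steps leaves \<open>O(h\<^sup>p)\<close> in mean.  Adding up
  the sizes of the \<open>m\<close> would lose half an order, but their partial sums form a martingale, whose running
  maximum has second moment at most four times the sum of \<open>T / h\<close> variances \<open>O(h\<^bsup>2p + 1\<^esup>)\<close>
  (\<open>maximal_inequality\<close>).  Finally the noise enters a step additively, so that a step changes the
  difference of two starting points only by \<open>O(h)\<close> times itself, with a non-random constant, and a
  discrete Gronwall argument along each path carries the local defects over to the global error
  (\<open>strong_order_if_defects_small\<close>).
\<close>

section \<open>Linear flows\<close>

text \<open>
  \<open>linear_flow P s a\<close> is the time-\<open>s\<close> solution of \<open>y' = a + P y\<close>, \<open>y(0) = 0\<close>, that is, the entire function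
  \<open>(exp(s P) - 1) / P\<close> applied to \<open>a\<close>.  It gives the velocity increment under the flow of \<open>B\<close>, whose
  field is affine in \<open>v\<close> for frozen \<open>x\<close>; its linearity in \<open>a\<close> is what makes the noise enter additively.
\<close>

definition linear_flow :: "('a::banach \<Rightarrow>\<^sub>L 'a) \<Rightarrow> real \<Rightarrow> 'a \<Rightarrow> 'a" where
  "linear_flow P s a = (\<Sum>k. (s ^ Suc k / fact (Suc k)) *\<^sub>R (blinfun_apply P ^^ k) a)"

lemma norm_blinfun_funpow_le:
  fixes P :: "'a::real_normed_vector \<Rightarrow>\<^sub>L 'a"
  shows "norm ((blinfun_apply P ^^ k) a) \<le> norm P ^ k * norm a"
proof (induction k)
  case (Suc k)
  have "norm ((blinfun_apply P ^^ Suc k) a) \<le> norm P * norm ((blinfun_apply P ^^ k) a)"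
    by (simp add: norm_blinfun)
  also have "\<dots> \<le> norm P * (norm P ^ k * norm a)"
    using Suc by (rule mult_left_mono) simp
  finally show ?case by (simp add: mult.assoc)
qed simp

lemma fact_shift_le: "1 / fact (k + m) \<le> (1 / fact k :: real)"
  by (simp add: frac_le fact_mono)

text \<open>
  The offsets \<open>j\<close> and \<open>m\<close> cover the series itself (\<open>j = 1\<close>, \<open>m = 0\<close>), its derivative (\<open>j = m = 0\<close>) and its
  tail after three terms (\<open>j = 4\<close>, \<open>m = 3\<close>).
\<close>

lemma norm_linear_flow_term_le:
  fixes P :: "'a::banach \<Rightarrow>\<^sub>L 'a"
  assumes "0 \<le> s" "s \<le> 1" "norm P \<le> 1"
  shows "norm ((s ^ (k + j) / fact (k + j)) *\<^sub>R (blinfun_apply P ^^ (k + m)) a)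
    \<le> (norm P ^ m * norm a) * (1 / fact k)"
proof -
  have "norm ((s ^ (k + j) / fact (k + j)) *\<^sub>R (blinfun_apply P ^^ (k + m)) a)
      = s ^ (k + j) * (1 / fact (k + j)) * norm ((blinfun_apply P ^^ (k + m)) a)"
    using assms by simp
  also have "\<dots> \<le> 1 * (1 / fact k) * (norm P ^ (k + m) * norm a)"
    by (intro mult_mono norm_blinfun_funpow_le fact_shift_le power_le_one assms) (use assms in auto)
  also have "\<dots> \<le> 1 * (1 / fact k) * (norm P ^ m * norm a)"
    by (intro mult_left_mono mult_right_mono power_decreasing assms) auto
  finally show ?thesis by (simp add: mult.commute)
qed

lemma summable_inverse_fact: "summable (\<lambda>k. 1 / fact k :: real)"
  using summable_exp[of "1::real"] by (simp add: field_simps)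

lemma suminf_inverse_fact: "(\<Sum>k. 1 / fact k :: real) = exp 1"
  by (simp add: exp_def field_simps)

lemma summable_linear_flow:
  fixes P :: "'a::banach \<Rightarrow>\<^sub>L 'a"
  assumes "0 \<le> s" "s \<le> 1" "norm P \<le> 1"
  shows "summable (\<lambda>k. (s ^ (k + j) / fact (k + j)) *\<^sub>R (blinfun_apply P ^^ (k + m)) a)"
  by (rule summable_comparison_test'[OF summable_mult[OF summable_inverse_fact]])
     (rule norm_linear_flow_term_le[OF assms])

lemma norm_linear_flow_le:
  fixes P :: "'a::banach \<Rightarrow>\<^sub>L 'a"
  assumes "0 \<le> s" "s \<le> 1" "norm P \<le> 1"
  shows "norm (linear_flow P s a) \<le> exp 1 * norm a"
proof -
  have "norm (linear_flow P s a) \<le> (\<Sum>k. norm a * (1 / fact k))"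
    unfolding linear_flow_def
    using norm_linear_flow_term_le[OF assms, where j=1 and m=0]
    by (intro norm_suminf_le summable_mult summable_inverse_fact) simp_all
  also have "\<dots> = norm a * exp 1"
    by (subst suminf_mult[OF summable_inverse_fact]) (simp add: suminf_inverse_fact)
  finally show ?thesis by (simp add: mult.commute)
qed

lemma linear_flow_diff:
  fixes P :: "'a::banach \<Rightarrow>\<^sub>L 'a"
  assumes "0 \<le> s" "s \<le> 1" "norm P \<le> 1"
  shows "linear_flow P s (a - b) = linear_flow P s a - linear_flow P s b"
proof -
  have *: "(blinfun_apply P ^^ k) (a - b) = (blinfun_apply P ^^ k) a - (blinfun_apply P ^^ k) b" for k
    by (induction k) (simp_all add: blinfun.diff_right)
  show ?thesis
    unfolding linear_flow_def
    using summable_linear_flow[OF assms, where j=1 and m=0]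
    by (subst suminf_diff) (auto simp: * scaleR_diff_right)
qed

text \<open>
  Three terms are needed for second order: applied to the noise, which is \<open>O(1)\<close> for a fixed path, a generator
  \<open>P = O(h)\<close> leaves a pathwise remainder of order \<open>h\<^sup>3\<close> only from the fourth term on.
\<close>

lemma linear_flow_expansion:
  fixes P :: "'a::banach \<Rightarrow>\<^sub>L 'a"
  assumes "0 \<le> s" "s \<le> 1" "norm P \<le> 1"
  shows "norm (linear_flow P s a - (s *\<^sub>R a + (s\<^sup>2 / 2) *\<^sub>R P a + (s ^ 3 / 6) *\<^sub>R P (P a)))
    \<le> exp 1 * norm P ^ 3 * norm a"
proof -
  let ?t = "\<lambda>k. (s ^ Suc k / fact (Suc k)) *\<^sub>R (blinfun_apply P ^^ k) a"
  have "summable ?t"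
    using summable_linear_flow[OF assms, where j=1 and m=0] by simp
  from suminf_split_initial_segment[OF this, of 3]
  have "linear_flow P s a = (\<Sum>k. ?t (k + 3)) + (\<Sum>k<3. ?t k)"
    unfolding linear_flow_def .
  also have "(\<Sum>k<3. ?t k) = s *\<^sub>R a + (s\<^sup>2 / 2) *\<^sub>R P a + (s ^ 3 / 6) *\<^sub>R P (P a)"
    by (simp add: eval_nat_numeral fact_numeral)
  finally have "norm (linear_flow P s a - (s *\<^sub>R a + (s\<^sup>2 / 2) *\<^sub>R P a + (s ^ 3 / 6) *\<^sub>R P (P a)))
      = norm (\<Sum>k. ?t (k + 3))" by simp
  also have "\<dots> \<le> (\<Sum>k. (norm P ^ 3 * norm a) * (1 / fact k))"
    using norm_linear_flow_term_le[OF assms, where j=4 and m=3]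
    by (intro norm_suminf_le summable_mult summable_inverse_fact) (simp_all add: numeral_eq_Suc)
  also have "\<dots> = norm P ^ 3 * norm a * exp 1"
    by (subst suminf_mult[OF summable_inverse_fact]) (simp add: suminf_inverse_fact)
  finally show ?thesis by (simp add: mult_ac)
qed

lemma linear_flow_has_vector_derivative:
  fixes P :: "'a::banach \<Rightarrow>\<^sub>L 'a"
  assumes P: "norm P \<le> 1" and s: "s \<in> {0..1}"
  shows "((\<lambda>s. linear_flow P s a) has_vector_derivative a + P (linear_flow P s a)) (at s within {0..1})"
proof -
  let ?t = "\<lambda>k s. (s ^ Suc k / fact (Suc k)) *\<^sub>R (blinfun_apply P ^^ k) a"
  let ?d = "\<lambda>k s. (s ^ k / fact k) *\<^sub>R (blinfun_apply P ^^ k) a"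
  have unif: "uniform_limit {0..1} (\<lambda>n s. \<Sum>k<n. ?d k s) (\<lambda>s. suminf (\<lambda>k. ?d k s)) sequentially"
    using norm_linear_flow_term_le[OF _ _ P, where j=0 and m=0]
    by (intro Weierstrass_m_test[OF _ summable_mult[OF summable_inverse_fact]]) auto
  have "\<exists>g. \<forall>s\<in>{0..1}. (\<lambda>k. ?t k s) sums g s \<and>
      (g has_derivative (\<lambda>y. y *\<^sub>R suminf (\<lambda>k. ?d k s))) (at s within {0..1})"
  proof (rule has_derivative_series)
    show "convex {0..1::real}" by simp
  next
    fix n and s :: real
    have *: "((\<lambda>s. s ^ Suc n / fact (Suc n)) has_real_derivative s ^ n / fact n) (at s within {0..1})"
      by (rule derivative_eq_intros refl | simp del: power_Suc of_nat_Suc)+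
    show "(?t n has_derivative (\<lambda>y. y *\<^sub>R ?d n s)) (at s within {0..1})"
      using has_vector_derivative_scaleR[OF * has_vector_derivative_const]
      by (simp add: has_vector_derivative_def)
  next
    fix e :: real assume "e > 0"
    from uniform_limitD[OF unif this]
    show "\<forall>\<^sub>F n in sequentially. \<forall>s\<in>{0..1}. \<forall>y. norm ((\<Sum>k<n. y *\<^sub>R ?d k s) - y *\<^sub>R suminf (\<lambda>k. ?d k s)) \<le> e * norm y"
    proof eventually_elim
      case (elim n)
      show ?case
      proof (intro ballI allI)
        fix s y :: real assume "s \<in> {0..1}"
        with elim have "norm ((\<Sum>k<n. ?d k s) - suminf (\<lambda>k. ?d k s)) \<le> e"
          by (auto simp: dist_norm intro: less_imp_le)
        then have "\<bar>y\<bar> * norm ((\<Sum>k<n. ?d k s) - suminf (\<lambda>k. ?d k s)) \<le> \<bar>y\<bar> * e"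
          by (rule mult_left_mono) simp
        then show "norm ((\<Sum>k<n. y *\<^sub>R ?d k s) - y *\<^sub>R suminf (\<lambda>k. ?d k s)) \<le> e * norm y"
          unfolding scaleR_sum_right[symmetric] scaleR_diff_right[symmetric]
          by (simp add: mult.commute)
      qed
    qed
  next
    show "(0::real) \<in> {0..1}" by simp
    show "(\<lambda>n. ?t n 0) sums 0" by (simp add: sums_zero)
  qed
  then obtain g where g: "\<And>s. s \<in> {0..1} \<Longrightarrow> (\<lambda>k. ?t k s) sums g s"
    "\<And>s. s \<in> {0..1} \<Longrightarrow> (g has_derivative (\<lambda>y. y *\<^sub>R suminf (\<lambda>k. ?d k s))) (at s within {0..1})"
    by blast
  have geq: "g s = linear_flow P s a" if "s \<in> {0..1}" for s
    using sums_unique[OF g(1)[OF that]] unfolding linear_flow_def .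
  have sd: "summable (\<lambda>k. ?d k s)" "summable (\<lambda>k. ?t k s)"
    using s summable_linear_flow[OF _ _ P, of s 0 0] summable_linear_flow[OF _ _ P, of s 1 0] by auto
  have "suminf (\<lambda>k. ?d k s) = a + (\<Sum>k. ?d (Suc k) s)"
    using suminf_split_head[OF sd(1)] by simp
  also have "(\<Sum>k. ?d (Suc k) s) = (\<Sum>k. P (?t k s))"
    by (simp add: blinfun.scaleR_right)
  also have "\<dots> = P (linear_flow P s a)"
    unfolding linear_flow_def by (rule bounded_linear.suminf[OF blinfun.bounded_linear_right sd(2), symmetric])
  finally have "suminf (\<lambda>k. ?d k s) = a + P (linear_flow P s a)" .
  with g(2)[OF s] have "(g has_vector_derivative a + P (linear_flow P s a)) (at s within {0..1})"
    by (simp add: has_vector_derivative_def)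
  then show ?thesis
    by (rule has_vector_derivative_transform[OF s geq[symmetric], rotated])
qed

lemma linear_flow_0: "linear_flow P 0 a = 0"
  unfolding linear_flow_def by simp

section \<open>Flow maps\<close>

text \<open>
  For \<open>K \<tau> \<le> 1/2\<close> the mean value inequality bounds the maximal distance of two solutions with the same
  initial value by half of itself, hence the flow is unique.
\<close>

lemma flow_map_eqI:
  fixes D :: "'z::real_normed_vector \<Rightarrow> 'z"
  assumes lip: "\<And>y z. norm (D y - D z) \<le> K * norm (y - z)" and K: "K * \<tau> \<le> 1/2" and \<tau>: "0 \<le> \<tau>" "0 \<le> K"
    and \<gamma>: "\<gamma> 0 = z" "\<And>s. s \<in> {0..\<tau>} \<Longrightarrow> (\<gamma> has_vector_derivative D (\<gamma> s)) (at s within {0..\<tau>})"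
  shows "flow_map \<tau> D z = \<gamma> \<tau>"
  unfolding flow_map_def
proof (rule the_equality)
  show "\<exists>\<gamma>'. \<gamma>' 0 = z \<and> \<gamma>' \<tau> = \<gamma> \<tau> \<and>
      (\<forall>s\<in>{0..\<tau>}. (\<gamma>' has_vector_derivative D (\<gamma>' s)) (at s within {0..\<tau>}))"
    using \<gamma> by blast
next
  fix y assume "\<exists>\<gamma>'. \<gamma>' 0 = z \<and> \<gamma>' \<tau> = y \<and>
      (\<forall>s\<in>{0..\<tau>}. (\<gamma>' has_vector_derivative D (\<gamma>' s)) (at s within {0..\<tau>}))"
  then obtain \<gamma>' where \<gamma>': "\<gamma>' 0 = z" "\<gamma>' \<tau> = y"
    "\<And>s. s \<in> {0..\<tau>} \<Longrightarrow> (\<gamma>' has_vector_derivative D (\<gamma>' s)) (at s within {0..\<tau>})" by blast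
  define d where "d s = \<gamma>' s - \<gamma> s" for s
  have der: "(d has_vector_derivative D (\<gamma>' s) - D (\<gamma> s)) (at s within {0..\<tau>})" if "s \<in> {0..\<tau>}" for s
    unfolding d_def by (rule has_vector_derivative_diff[OF \<gamma>'(3)[OF that] \<gamma>(2)[OF that]])
  have "continuous_on {0..\<tau>} d"
    by (rule continuous_on_vector_derivative[OF der])
  then have "continuous_on {0..\<tau>} (\<lambda>s. norm (d s))" by (rule continuous_on_norm)
  then obtain s0 where s0: "s0 \<in> {0..\<tau>}" "\<And>s. s \<in> {0..\<tau>} \<Longrightarrow> norm (d s) \<le> norm (d s0)"
    using continuous_attains_sup[of "{0..\<tau>}" "\<lambda>s. norm (d s)"] \<tau> by auto
  have bd: "norm (d s) \<le> K * norm (d s0) * norm (s - 0)" if s: "s \<in> {0..\<tau>}" for s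
  proof -
    have "norm (d s - d 0) \<le> (K * norm (d s0)) * norm (s - 0)"
    proof (rule differentiable_bound[where S="{0..\<tau>}" and f'="\<lambda>s y. y *\<^sub>R (D (\<gamma>' s) - D (\<gamma> s))"])
      fix r assume r: "r \<in> {0..\<tau>}"
      show "(d has_derivative (\<lambda>y. y *\<^sub>R (D (\<gamma>' r) - D (\<gamma> r)))) (at r within {0..\<tau>})"
        using der[OF r] by (simp add: has_vector_derivative_def)
      have "norm (D (\<gamma>' r) - D (\<gamma> r)) \<le> K * norm (d r)"
        using lip unfolding d_def .
      also have "\<dots> \<le> K * norm (d s0)" using s0(2)[OF r] \<tau> by (intro mult_left_mono)
      finally show "onorm (\<lambda>y. y *\<^sub>R (D (\<gamma>' r) - D (\<gamma> r))) \<le> K * norm (d s0)"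
        by (intro onorm_le) (simp add: mult.commute mult_left_mono)
    qed (use s \<tau> in auto)
    then show ?thesis by (simp add: d_def \<gamma>(1) \<gamma>'(1))
  qed
  have "norm (d s0) \<le> K * norm (d s0) * s0"
    using bd[OF s0(1)] s0(1) by simp
  also have "\<dots> \<le> K * norm (d s0) * \<tau>"
    using s0(1) \<tau> by (intro mult_left_mono mult_nonneg_nonneg) auto
  also have "\<dots> = (K * \<tau>) * norm (d s0)" by simp
  also have "\<dots> \<le> 1/2 * norm (d s0)" using K by (intro mult_right_mono) auto
  finally have "norm (d s0) \<le> 0" by simp
  with s0(2)[of \<tau>] \<tau> have "d \<tau> = 0" by simp
  then show "y = \<gamma> \<tau>" by (simp add: d_def \<gamma>'(2))
qed

section \<open>Uniform order bounds\<close>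

text \<open>
  The local expansions hold with constants that do not depend on the step size \<open>h\<close>, the step or the path.
  To keep these constants out of sight, every quantity is regarded as a function on the set \<open>P\<close> of all
  admissible triples of step size, step number and path, and is compared with the weight
  \<open>h\<^sup>i S\<^sup>j\<close>, where \<open>S\<close> bounds the path.
\<close>

definition bigo_on ::
  "'p set \<Rightarrow> ('p \<Rightarrow> real) \<Rightarrow> ('p \<Rightarrow> real) \<Rightarrow> nat \<Rightarrow> nat \<Rightarrow> ('p \<Rightarrow> 'a::real_normed_vector) \<Rightarrow> bool" where
  "bigo_on P h S i j X \<longleftrightarrow> (\<exists>C. \<forall>p\<in>P. norm (X p) \<le> C * (h p ^ i * S p ^ j))"

locale step_scale =
  fixes P :: "'p set" and h S :: "'p \<Rightarrow> real"
  assumes h_pos: "p \<in> P \<Longrightarrow> 0 < h p" and h_le_1: "p \<in> P \<Longrightarrow> h p \<le> 1"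
    and S_ge_1: "p \<in> P \<Longrightarrow> 1 \<le> S p"
begin

abbreviation Ord where "Ord \<equiv> bigo_on P h S"

lemma weight_nonneg: "p \<in> P \<Longrightarrow> 0 \<le> h p ^ i * S p ^ j"
  using h_pos[of p] S_ge_1[of p] by simp

lemma OrdI: "(\<And>p. p \<in> P \<Longrightarrow> norm (X p) \<le> C * (h p ^ i * S p ^ j)) \<Longrightarrow> Ord i j X"
  unfolding bigo_on_def by blast

lemma OrdE:
  assumes "Ord i j X"
  obtains C where "0 \<le> C" "\<And>p. p \<in> P \<Longrightarrow> norm (X p) \<le> C * (h p ^ i * S p ^ j)"
proof -
  from assms obtain C where C: "\<And>p. p \<in> P \<Longrightarrow> norm (X p) \<le> C * (h p ^ i * S p ^ j)"
    unfolding bigo_on_def by blast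
  show thesis
  proof (rule that[of "\<bar>C\<bar>"])
    fix p assume p: "p \<in> P"
    show "norm (X p) \<le> \<bar>C\<bar> * (h p ^ i * S p ^ j)"
      using C[OF p] mult_right_mono[OF abs_ge_self[of C] weight_nonneg[OF p]] by (rule order_trans)
  qed simp
qed

lemma Ord_cong: "(\<And>p. p \<in> P \<Longrightarrow> X p = Y p) \<Longrightarrow> Ord i j Y \<Longrightarrow> Ord i j X"
  unfolding bigo_on_def by auto

lemma Ord_add: assumes "Ord i j X" "Ord i j Y" shows "Ord i j (\<lambda>p. X p + Y p)"
proof -
  from assms(1) obtain C where C: "\<And>p. p \<in> P \<Longrightarrow> norm (X p) \<le> C * (h p ^ i * S p ^ j)"
    unfolding bigo_on_def by blast
  from assms(2) obtain D where D: "\<And>p. p \<in> P \<Longrightarrow> norm (Y p) \<le> D * (h p ^ i * S p ^ j)"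
    unfolding bigo_on_def by blast
  show ?thesis
    by (rule OrdI[where C="C + D"]) (use C D norm_triangle_mono in \<open>fastforce simp: distrib_right\<close>)
qed

lemma Ord_minus: "Ord i j X \<Longrightarrow> Ord i j (\<lambda>p. - X p)"
  unfolding bigo_on_def by simp

lemma Ord_diff: assumes "Ord i j X" "Ord i j Y" shows "Ord i j (\<lambda>p. X p - Y p)"
  using Ord_add[OF assms(1) Ord_minus[OF assms(2)]] by simp

text \<open>
  Since \<open>h \<le> 1 \<le> S\<close>, exponents of \<open>h\<close> may be lowered and those of \<open>S\<close> raised; the rules for scaling and
  for linear maps are instances.
\<close>

lemma Ord_dominate:
  assumes "Ord i j X" and le: "\<And>p. p \<in> P \<Longrightarrow> norm (Y p) \<le> K * h p ^ a * norm (X p)" and i: "i' \<le> i + a" and j: "j \<le> j'"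
  shows "Ord i' j' Y"
proof -
  from OrdE[OF assms(1)] obtain C where C: "0 \<le> C" "\<And>p. p \<in> P \<Longrightarrow> norm (X p) \<le> C * (h p ^ i * S p ^ j)"
    by blast
  show ?thesis
  proof (rule OrdI[where C="\<bar>K\<bar> * C"])
    fix p assume p: "p \<in> P"
    note hS = h_pos[OF p] h_le_1[OF p] S_ge_1[OF p]
    have "norm (Y p) \<le> K * h p ^ a * norm (X p)" by (rule le[OF p])
    also have "\<dots> \<le> \<bar>K\<bar> * h p ^ a * norm (X p)" using hS by (intro mult_right_mono) auto
    also have "\<dots> \<le> \<bar>K\<bar> * h p ^ a * (C * (h p ^ i * S p ^ j))"
      using hS by (intro mult_left_mono C(2) p) auto
    also have "\<dots> = (\<bar>K\<bar> * C) * (h p ^ (i + a) * S p ^ j)" by (simp add: power_add mult_ac)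
    also have "\<dots> \<le> (\<bar>K\<bar> * C) * (h p ^ i' * S p ^ j')"
      using hS C(1) i j by (intro mult_left_mono mult_mono power_decreasing power_increasing) auto
    finally show "norm (Y p) \<le> \<bar>K\<bar> * C * (h p ^ i' * S p ^ j')" .
  qed
qed

lemma Ord_mono: "Ord i j X \<Longrightarrow> i' \<le> i \<Longrightarrow> j \<le> j' \<Longrightarrow> Ord i' j' X"
  by (rule Ord_dominate[where K=1 and a=0]) auto

lemma Ord_scale:
  assumes "Ord i j X" "i' \<le> i + a" "j \<le> j'"
  shows "Ord i' j' (\<lambda>p. (c * h p ^ a) *\<^sub>R X p)"
  by (rule Ord_dominate[OF assms(1) _ assms(2,3), where K="\<bar>c\<bar>"]) (auto simp: abs_mult h_pos less_imp_le)

lemma Ord_blinfun: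
  assumes "Ord i j X" shows "Ord i j (\<lambda>p. blinfun_apply L (X p))"
  by (rule Ord_dominate[OF assms, where K="norm L" and a=0]) (auto simp: norm_blinfun)

lemma Ord_blinfun_family:
  assumes "Ord i j X" "\<And>p. p \<in> P \<Longrightarrow> norm (L p) \<le> K" shows "Ord i j (\<lambda>p. blinfun_apply (L p) (X p))"
  by (rule Ord_dominate[OF assms(1), where K=K and a=0])
     (auto intro!: order_trans[OF norm_blinfun] mult_right_mono assms(2))

lemma Ord_linear_flow:
  assumes X: "Ord i j X" and "0 \<le> s" "s \<le> 1" and G: "\<And>p. p \<in> P \<Longrightarrow> h p * norm G \<le> 1"
  shows "Ord i j (\<lambda>p. linear_flow (- h p *\<^sub>R G) s (X p))"
    and "Ord (i + 3) j (\<lambda>p. linear_flow (- h p *\<^sub>R G) s (X p)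
      - (s *\<^sub>R X p - (s\<^sup>2 / 2 * h p) *\<^sub>R G (X p) + (s ^ 3 / 6 * (h p)\<^sup>2) *\<^sub>R G (G (X p))))"
proof -
  have P: "norm (- h p *\<^sub>R G) \<le> 1" "norm (- h p *\<^sub>R G) = h p * norm G" if "p \<in> P" for p
    using G[OF that] h_pos[OF that] by auto
  show "Ord i j (\<lambda>p. linear_flow (- h p *\<^sub>R G) s (X p))"
    by (rule Ord_dominate[OF X, where K="exp 1" and a=0])
       (use norm_linear_flow_le[OF assms(2,3) P(1)] in simp_all)
  show "Ord (i + 3) j (\<lambda>p. linear_flow (- h p *\<^sub>R G) s (X p)
      - (s *\<^sub>R X p - (s\<^sup>2 / 2 * h p) *\<^sub>R G (X p) + (s ^ 3 / 6 * (h p)\<^sup>2) *\<^sub>R G (G (X p))))"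
  proof (rule Ord_dominate[OF X, where K="exp 1 * norm G ^ 3" and a=3])
    fix p assume p: "p \<in> P"
    from linear_flow_expansion[OF assms(2,3) P(1)[OF p], of "X p"]
    show "norm (linear_flow (- h p *\<^sub>R G) s (X p)
      - (s *\<^sub>R X p - (s\<^sup>2 / 2 * h p) *\<^sub>R G (X p) + (s ^ 3 / 6 * (h p)\<^sup>2) *\<^sub>R G (G (X p))))
      \<le> exp 1 * norm G ^ 3 * h p ^ 3 * norm (X p)"
      unfolding P(2)[OF p]
      by (simp add: blinfun.bilinear_simps power_mult_distrib power2_eq_square mult_ac)
  qed auto
qed

end

text \<open>
  Integration over part of a step gains one power of \<open>h\<close>.  The statement also covers integrands that are not
  integrable, for which the integral is \<open>0\<close>, so that no regularity has to be carried along.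
\<close>

lemma Ord_integral:
  fixes X :: "'p \<times> real \<Rightarrow> 'a::euclidean_space"
  assumes "step_scale P h S"
    and X: "bigo_on {(p, s). p \<in> P \<and> s \<in> {t p..t p + h p}} (h \<circ> fst) (S \<circ> fst) i j X"
  shows "bigo_on {(p, s). p \<in> P \<and> s \<in> {t p..t p + h p}} (h \<circ> fst) (S \<circ> fst) (Suc i) j
    (\<lambda>q. integral {t (fst q)..snd q} (\<lambda>r. X (fst q, r)))"
proof -
  interpret step_scale P h S by fact
  from X obtain C where C: "\<And>p s. p \<in> P \<Longrightarrow> s \<in> {t p..t p + h p} \<Longrightarrow> norm (X (p, s)) \<le> C * (h p ^ i * S p ^ j)"
    unfolding bigo_on_def by auto
  have "norm (integral {t p..s} (\<lambda>r. X (p, r))) \<le> \<bar>C\<bar> * (h p ^ Suc i * S p ^ j)"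
    if p: "p \<in> P" and s: "s \<in> {t p..t p + h p}" for p s
  proof -
    have 0: "norm (X (p, r)) \<le> \<bar>C\<bar> * (h p ^ i * S p ^ j)" if "r \<in> {t p..s}" for r
    proof -
      have "norm (X (p, r)) \<le> C * (h p ^ i * S p ^ j)" using that s by (intro C[OF p]) auto
      also have "\<dots> \<le> \<bar>C\<bar> * (h p ^ i * S p ^ j)" by (intro mult_right_mono weight_nonneg p) simp
      finally show ?thesis .
    qed
    have nn: "0 \<le> \<bar>C\<bar> * (h p ^ i * S p ^ j)" by (intro mult_nonneg_nonneg weight_nonneg p) simp
    have "norm (integral {t p..s} (\<lambda>r. X (p, r))) \<le> \<bar>C\<bar> * (h p ^ i * S p ^ j) * (s - t p)"
    proof (cases "(\<lambda>r. X (p, r)) integrable_on {t p..s}")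
      case True
      then have "((\<lambda>r. X (p, r)) has_integral integral {t p..s} (\<lambda>r. X (p, r))) (cbox (t p) s)"
        by (simp add: has_integral_integral)
      from has_integral_bound[OF nn this] 0 s show ?thesis by (auto simp: content_real)
    next
      case False
      with nn s show ?thesis by (simp add: not_integrable_integral)
    qed
    also have "\<dots> \<le> \<bar>C\<bar> * (h p ^ i * S p ^ j) * h p" using s by (intro mult_left_mono nn) auto
    finally show ?thesis by (simp add: mult_ac)
  qed
  then show ?thesis unfolding bigo_on_def by (intro exI[of _ "\<bar>C\<bar>"]) auto
qed

section \<open>Local expansions\<close>

lemma has_integral_blinfun:
  fixes L :: "'a::euclidean_space \<Rightarrow>\<^sub>L 'b::euclidean_space"
  assumes "(g has_integral y) A"
  shows "((\<lambda>r. L (g r)) has_integral L y) A"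
  using has_integral_linear[OF assms blinfun.bounded_linear_right] by (simp add: o_def)

lemma has_integral_offset:
  fixes a s :: real
  assumes "a \<le> s"
  shows "((\<lambda>r. r - a) has_integral (s - a)\<^sup>2 / 2) {a..s}"
proof -
  have "((\<lambda>r. r - a) has_integral ((s - a)\<^sup>2 / 2 - (a - a)\<^sup>2 / 2)) {a..s}"
    by (rule fundamental_theorem_of_calculus[OF assms])
       (auto intro!: derivative_eq_intros simp flip: has_real_derivative_iff_has_vector_derivative)
  then show ?thesis by simp
qed

locale langevin_coefficients =
  fixes f :: "'a::euclidean_space \<Rightarrow> 'a" and f' :: "'a \<Rightarrow> 'a \<Rightarrow>\<^sub>L 'a"
    and G \<sigma> :: "'a \<Rightarrow>\<^sub>L 'a" and L1 L2 :: real
  assumes f_deriv: "(f has_derivative blinfun_apply (f' y)) (at y)"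
    and norm_f'_le: "norm (f' y) \<le> L1"
    and f'_lipschitz: "norm (f' y - f' z) \<le> L2 * norm (y - z)"
begin

lemma L1_nonneg: "0 \<le> L1"
  using norm_f'_le[of 0] norm_ge_zero order_trans by blast

lemma L2_norm_nonneg: "0 \<le> L2 * norm (y - z :: 'a)"
  using f'_lipschitz[of y z] norm_ge_zero order_trans by blast

lemma f_lipschitz: "norm (f y - f z) \<le> L1 * norm (y - z)"
  using f_deriv norm_f'_le
  by (intro differentiable_bound[where S=UNIV and f'="\<lambda>y. blinfun_apply (f' y)"])
     (auto simp: norm_blinfun.rep_eq[symmetric])

lemma f_growth: "norm (f y) \<le> norm (f 0) + L1 * norm y"
  using f_lipschitz[of y 0] norm_triangle_ineq2[of "f y" "f 0"] by simp

lemma continuous_on_f: "continuous_on A f"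
  using f_deriv has_derivative_continuous continuous_at_imp_continuous_on by blast

lemma f_taylor: "norm (f y - f z - f' z (y - z)) \<le> L2 * (norm (y - z))\<^sup>2"
proof -
  have "norm (f y - f z - f' z (y - z)) \<le> norm (y - z) * (L2 * norm (y - z))"
  proof (rule differentiable_bound_linearization[where S="closed_segment z y"
        and f'="\<lambda>x. blinfun_apply (f' x)" and ?x0.0=z])
    fix a :: real assume "a \<in> {0..1}"
    then show "z + a *\<^sub>R (y - z) \<in> closed_segment z y"
      unfolding in_segment by (intro conjI exI[of _ a]) (auto simp: algebra_simps)
  next
    fix x assume x: "x \<in> closed_segment z y"
    show "(f has_derivative blinfun_apply (f' x)) (at x within closed_segment z y)"
      by (rule has_derivative_at_withinI[OF f_deriv])
    have "norm (x - z) \<le> norm (y - z)"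
      using segment_bound(1)[OF x] by simp
    have "onorm (blinfun_apply (f' x) - blinfun_apply (f' z)) = norm (f' x - f' z)"
      by (simp add: norm_blinfun.rep_eq minus_blinfun.rep_eq fun_diff_def)
    also have "\<dots> \<le> L2 * norm (x - z)" by (rule f'_lipschitz)
    also have "\<dots> \<le> L2 * norm (y - z)"
    proof (cases "x = z")
      case False
      then have "0 \<le> L2" using L2_norm_nonneg[of x z] by (simp add: zero_le_mult_iff)
      then show ?thesis using \<open>norm (x - z) \<le> norm (y - z)\<close> by (rule mult_left_mono[rotated])
    qed (use L2_norm_nonneg[of y z] in simp)
    finally show "onorm (blinfun_apply (f' x) - blinfun_apply (f' z)) \<le> L2 * norm (y - z)" .
  qed (use L2_norm_nonneg in auto)
  then show ?thesis by (simp add: power2_eq_square mult_ac)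
qed

end

text \<open>
  A parameter \<open>p \<in> P\<close> stands for one time step on one path: the step is \<open>[t p, t p + h p]\<close>, the exact solution
  on it is \<open>(xs p, vs p)\<close>, and \<open>ws p\<close> is the increment of \<open>W\<close> since the beginning of the step.
\<close>

locale langevin_steps = langevin_coefficients f f' G \<sigma> L1 L2 + step_scale P h S
  for f :: "'a::euclidean_space \<Rightarrow> 'a" and f' G \<sigma> L1 L2
    and P :: "'p set" and h S +
  fixes t :: "'p \<Rightarrow> real" and xs vs ws :: "'p \<Rightarrow> real \<Rightarrow> 'a" and K :: real
  assumes continuous_x: "p \<in> P \<Longrightarrow> continuous_on {t p..t p + h p} (xs p)"
    and continuous_v: "p \<in> P \<Longrightarrow> continuous_on {t p..t p + h p} (vs p)"
    and continuous_w: "p \<in> P \<Longrightarrow> continuous_on {t p..t p + h p} (ws p)"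
    and x_eq: "p \<in> P \<Longrightarrow> s \<in> {t p..t p + h p} \<Longrightarrow>
      xs p s = xs p (t p) + integral {t p..s} (vs p)"
    and v_eq: "p \<in> P \<Longrightarrow> s \<in> {t p..t p + h p} \<Longrightarrow>
      vs p s = vs p (t p) + integral {t p..s} (\<lambda>r. f (xs p r) - G (vs p r)) + \<sigma> (ws p s)"
    and norm_x: "p \<in> P \<Longrightarrow> s \<in> {t p..t p + h p} \<Longrightarrow> norm (xs p s) \<le> K * S p"
    and norm_v: "p \<in> P \<Longrightarrow> s \<in> {t p..t p + h p} \<Longrightarrow> norm (vs p s) \<le> K * S p"
    and norm_w: "p \<in> P \<Longrightarrow> s \<in> {t p..t p + h p} \<Longrightarrow> norm (ws p s) \<le> K * S p"
    and h_G: "p \<in> P \<Longrightarrow> h p * norm G \<le> 1"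
begin

text \<open>
  \<open>u\<close> is the pathwise form of \<open>\<Delta>U\<close>, \<open>b\<close> the drift at the beginning of the step, and \<open>c\<close> the derivative
  of the drift along the noise-free equation.
\<close>

definition "x p = xs p (t p)"
definition "v p = vs p (t p)"
definition "w p = ws p (t p + h p)"
definition "A p s = integral {t p..s} (ws p)"
definition "I p = A p (t p + h p)"
definition "J p = integral {t p..t p + h p} (A p)"
definition "u p = (h p / 2) *\<^sub>R w p - I p"
definition "b p = f (x p) - G (v p)"
definition "c p = f' (x p) (v p) - G (b p)"

abbreviation "Q \<equiv> {(p, s). p \<in> P \<and> s \<in> {t p..t p + h p}}"
abbreviation "QOrd \<equiv> bigo_on Q (h \<circ> fst) (S \<circ> fst)"

lemma step_scale_Q: "step_scale Q (h \<circ> fst) (S \<circ> fst)"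
  by unfold_locales (auto simp: h_pos h_le_1 S_ge_1)

sublocale Q: step_scale Q "h \<circ> fst" "S \<circ> fst"
  by (rule step_scale_Q)

lemma QOrd_integral:
  "QOrd i j (X :: _ \<Rightarrow> 'a) \<Longrightarrow> QOrd (Suc i) j (\<lambda>q. integral {t (fst q)..snd q} (\<lambda>r. X (fst q, r)))"
  by (rule Ord_integral) unfold_locales

lemma QOrd_has_integral:
  fixes X :: "'p \<Rightarrow> real \<Rightarrow> 'a"
  assumes X: "QOrd i j (\<lambda>(p, s). X p s)" and i': "i' = Suc i"
    and Y: "\<And>p s. p \<in> P \<Longrightarrow> s \<in> {t p..t p + h p} \<Longrightarrow> (X p has_integral Y p s) {t p..s}"
  shows "QOrd i' j (\<lambda>(p, s). Y p s)"
  unfolding i'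
  by (rule Q.Ord_cong[OF _ QOrd_integral[OF X]]) (use integral_unique[OF Y] in auto)

lemma QOrd_end:
  assumes "QOrd i j X" shows "Ord i j (\<lambda>p. X (p, t p + h p))"
proof -
  from Q.OrdE[OF assms] obtain C where "0 \<le> C"
    "\<And>q. q \<in> Q \<Longrightarrow> norm (X q) \<le> C * ((h \<circ> fst) q ^ i * (S \<circ> fst) q ^ j)" by blast
  then show ?thesis using h_pos by (intro OrdI[where C=C]) (force simp: less_imp_le)
qed

lemma Ord_v: "Ord 0 1 v" and Ord_x: "Ord 0 1 x" and Ord_w: "Ord 0 1 w"
  using norm_x norm_v norm_w h_pos
  by (auto intro!: OrdI[where C=K] simp: v_def x_def w_def less_imp_le)

lemma QOrd_v: "QOrd 0 1 (\<lambda>q. vs (fst q) (snd q))" and QOrd_w: "QOrd 0 1 (\<lambda>q. ws (fst q) (snd q))"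
  using norm_v norm_w by - (rule Q.OrdI[where C=K], force)+

lemma Ord_f: assumes "Ord 0 1 y" shows "Ord 0 1 (\<lambda>p. f (y p))"
proof -
  from OrdE[OF assms] obtain C where C: "0 \<le> C" "\<And>p. p \<in> P \<Longrightarrow> norm (y p) \<le> C * (h p ^ 0 * S p ^ 1)" by blast
  show ?thesis
  proof (rule OrdI[where C="norm (f 0) + L1 * C"])
    fix p assume p: "p \<in> P"
    have "norm (f (y p)) \<le> norm (f 0) + L1 * norm (y p)" by (rule f_growth)
    also have "\<dots> \<le> norm (f 0) * S p + L1 * (C * S p)"
      using C(2)[OF p] S_ge_1[OF p] L1_nonneg by (intro add_mono mult_left_mono) (auto simp: mult_le_cancel_left1)
    finally show "norm (f (y p)) \<le> (norm (f 0) + L1 * C) * (h p ^ 0 * S p ^ 1)"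
      by (simp add: algebra_simps)
  qed
qed

lemma Ord_f_taylor:
  assumes d: "Ord 1 1 d" shows "Ord 2 2 (\<lambda>p. f (y p + d p) - f (y p) - f' (y p) (d p))"
proof -
  from OrdE[OF d] obtain C where C: "0 \<le> C" "\<And>p. p \<in> P \<Longrightarrow> norm (d p) \<le> C * (h p ^ 1 * S p ^ 1)" by blast
  show ?thesis
  proof (rule OrdI[where C="\<bar>L2\<bar> * C\<^sup>2"])
    fix p assume p: "p \<in> P"
    have "norm (f (y p + d p) - f (y p) - f' (y p) (d p)) \<le> L2 * (norm (d p))\<^sup>2"
      using f_taylor[of "y p + d p" "y p"] by simp
    also have "\<dots> \<le> \<bar>L2\<bar> * (C * (h p * S p))\<^sup>2"
      using C(2)[OF p] by (intro mult_mono power_mono) auto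
    finally show "norm (f (y p + d p) - f (y p) - f' (y p) (d p)) \<le> \<bar>L2\<bar> * C\<^sup>2 * (h p ^ 2 * S p ^ 2)"
      by (simp add: power_mult_distrib mult_ac)
  qed
qed

lemma Ord_f_increment:
  assumes d: "Ord i j d" shows "Ord i j (\<lambda>p. f (y p + d p) - f (y p))"
  by (rule Ord_dominate[OF d, where K=L1 and a=0]) (auto intro: order_trans[OF f_lipschitz])

lemma Ord_f': "Ord i j X \<Longrightarrow> Ord i j (\<lambda>p. f' (y p) (X p))"
  by (rule Ord_blinfun_family) (auto intro: norm_f'_le)

lemma Ord_b: "Ord 0 1 b"
  unfolding b_def by (intro Ord_diff Ord_f Ord_blinfun Ord_x Ord_v)

lemma integrable_path: "p \<in> P \<Longrightarrow> s \<in> {t p..t p + h p} \<Longrightarrow> continuous_on {t p..t p + h p} g \<Longrightarrow>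
  (g :: real \<Rightarrow> 'a) integrable_on {t p..s}"
  by (rule integrable_continuous_real) (auto elim: continuous_on_subset)

lemma continuous_A: "p \<in> P \<Longrightarrow> continuous_on {t p..t p + h p} (A p)"
  unfolding A_def using continuous_w h_pos
  by (intro indefinite_integral_continuous_1 integrable_continuous_real)

lemma has_integral_v:
  "p \<in> P \<Longrightarrow> s \<in> {t p..t p + h p} \<Longrightarrow> (vs p has_integral xs p s - x p) {t p..s}"
  using integrable_path[OF _ _ continuous_v] x_eq[of p s] unfolding x_def
  by (simp add: has_integral_integral)

lemma has_integral_w: "p \<in> P \<Longrightarrow> s \<in> {t p..t p + h p} \<Longrightarrow> (ws p has_integral A p s) {t p..s}"
  using integrable_path[OF _ _ continuous_w] unfolding A_def by (simp add: has_integral_integral)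

lemma has_integral_A: "p \<in> P \<Longrightarrow> (A p has_integral J p) {t p..t p + h p}"
  unfolding J_def using continuous_A[of p] by (simp add: integrable_continuous_real integrable_integral)

lemma has_integral_drift:
  assumes "p \<in> P" "s \<in> {t p..t p + h p}"
  shows "((\<lambda>r. f (xs p r) - G (vs p r)) has_integral vs p s - v p - \<sigma> (ws p s)) {t p..s}"
proof -
  have "continuous_on {t p..t p + h p} (\<lambda>r. f (xs p r) - G (vs p r))"
    using continuous_x continuous_v assms
    by (intro continuous_intros continuous_on_compose2[OF continuous_on_f]) auto
  from integrable_path[OF assms this] v_eq[OF assms] show ?thesis
    unfolding v_def by (simp add: has_integral_integral)
qed

lemma has_integral_start: "p \<in> P \<Longrightarrow> s \<in> {t p..t p + h p} \<Longrightarrow> ((\<lambda>r. c) has_integral (s - t p) *\<^sub>R c) {t p..s}"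
  for c :: 'a
  using has_integral_const_real[of c "t p" s] by simp

text \<open>
  The expansions alternate between the two equations: a bound on the integrand, integrated, improves the
  order of the other component by one.
\<close>

lemma expand_v_1: "QOrd 1 1 (\<lambda>(p, s). vs p s - v p - \<sigma> (ws p s))"
proof -
  have "QOrd 0 1 (\<lambda>q. f (xs (fst q) (snd q)) - G (vs (fst q) (snd q)))"
  proof (intro Q.Ord_diff Q.Ord_blinfun QOrd_v Q.OrdI[where C="norm (f 0) + L1 * \<bar>K\<bar>"])
    fix q assume q: "q \<in> Q"
    then obtain p s where [simp]: "q = (p, s)" and p: "p \<in> P" "s \<in> {t p..t p + h p}" by auto
    have "norm (f (xs p s)) \<le> norm (f 0) + L1 * norm (xs p s)" by (rule f_growth)
    also have "\<dots> \<le> norm (f 0) * S p + L1 * (\<bar>K\<bar> * S p)"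
      using norm_x[OF p] S_ge_1[OF p(1)] L1_nonneg abs_ge_self[of K]
      by (intro add_mono mult_left_mono order_trans[OF norm_x[OF p]] mult_right_mono)
         (auto simp: mult_le_cancel_left1)
    finally show "norm (f (xs (fst q) (snd q))) \<le> (norm (f 0) + L1 * \<bar>K\<bar>) * ((h \<circ> fst) q ^ 0 * (S \<circ> fst) q ^ 1)"
      by (simp add: algebra_simps)
  qed
  then have "QOrd 0 1 (\<lambda>(p, s). f (xs p s) - G (vs p s))" by (simp add: case_prod_beta')
  then show ?thesis by (rule QOrd_has_integral) (auto intro: has_integral_drift)
qed

lemma expand_x_1: "QOrd 1 1 (\<lambda>(p, s). xs p s - x p)"
proof -
  from QOrd_v have "QOrd 0 1 (\<lambda>(p, s). vs p s)" by (simp add: case_prod_beta')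
  then show ?thesis by (rule QOrd_has_integral) (auto intro: has_integral_v)
qed

lemma expand_x_2: "QOrd 2 1 (\<lambda>(p, s). xs p s - x p - (s - t p) *\<^sub>R v p - \<sigma> (A p s))"
  by (rule QOrd_has_integral[OF expand_v_1])
     (auto intro!: has_integral_v has_integral_diff has_integral_blinfun has_integral_w has_integral_start)

lemma expand_drift_1: "QOrd 1 1 (\<lambda>(p, s). f (xs p s) - G (vs p s) - b p + G (\<sigma> (ws p s)))"
proof -
  have "QOrd 1 1 (\<lambda>q. f (xs (fst q) (snd q)) - f (x (fst q)))"
    by (rule Q.Ord_dominate[OF expand_x_1, where K=L1 and a=0]) (use f_lipschitz in auto)
  from Q.Ord_diff[OF this Q.Ord_blinfun[OF expand_v_1, of G]] show ?thesis
    by (rule Q.Ord_cong[rotated]) (auto simp: b_def blinfun.bilinear_simps)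
qed

lemma expand_v_2: "QOrd 2 1 (\<lambda>(p, s). vs p s - v p - \<sigma> (ws p s) - (s - t p) *\<^sub>R b p + G (\<sigma> (A p s)))"
  by (rule QOrd_has_integral[OF expand_drift_1])
     (auto intro!: has_integral_add[OF has_integral_diff[OF has_integral_drift has_integral_start]
        has_integral_blinfun[OF has_integral_blinfun[OF has_integral_w]]])

text \<open>
  This is the only place where the second derivatives of \<open>f\<close> enter the exact solution, and the square of
  the displacement is the reason for the weight \<open>S\<^sup>2\<close>.
\<close>

lemma expand_drift_2:
  "QOrd 2 2 (\<lambda>(p, s). f (xs p s) - G (vs p s) - b p + G (\<sigma> (ws p s)) - (s - t p) *\<^sub>R c p
     - (f' (x p) (\<sigma> (A p s)) + G (G (\<sigma> (A p s)))))"
proof -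
  from Q.OrdE[OF expand_x_1] obtain C where C: "0 \<le> C"
    "\<And>q. q \<in> Q \<Longrightarrow> norm (case q of (p, s) \<Rightarrow> xs p s - x p) \<le> C * ((h \<circ> fst) q ^ 1 * (S \<circ> fst) q ^ 1)"
    by blast
  have 1: "QOrd 2 2 (\<lambda>(p, s). f (xs p s) - f (x p) - f' (x p) (xs p s - x p))"
  proof (rule Q.OrdI[where C="\<bar>L2\<bar> * C\<^sup>2"])
    fix q assume q: "q \<in> Q"
    then obtain p s where [simp]: "q = (p, s)" by force
    have "norm (f (xs p s) - f (x p) - f' (x p) (xs p s - x p)) \<le> L2 * (norm (xs p s - x p))\<^sup>2"
      by (rule f_taylor)
    also have "\<dots> \<le> \<bar>L2\<bar> * (C * (h p * S p))\<^sup>2"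
      using C(2)[OF q] by (intro mult_mono power_mono) auto
    finally show "norm (case q of (p, s) \<Rightarrow> f (xs p s) - f (x p) - f' (x p) (xs p s - x p))
        \<le> \<bar>L2\<bar> * C\<^sup>2 * ((h \<circ> fst) q ^ 2 * (S \<circ> fst) q ^ 2)"
      by (simp add: power_mult_distrib mult_ac)
  qed
  have 2: "QOrd 2 2 (\<lambda>q. f' (x (fst q)) (case q of (p, s) \<Rightarrow> xs p s - x p - (s - t p) *\<^sub>R v p - \<sigma> (A p s)))"
    by (intro Q.Ord_blinfun_family[where K=L1] norm_f'_le Q.Ord_mono[OF expand_x_2]) auto
  have 3: "QOrd 2 2 (\<lambda>q. G (case q of (p, s) \<Rightarrow> vs p s - v p - \<sigma> (ws p s) - (s - t p) *\<^sub>R b p + G (\<sigma> (A p s))))"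
    by (intro Q.Ord_blinfun Q.Ord_mono[OF expand_v_2]) auto
  show ?thesis
    by (rule Q.Ord_cong[OF _ Q.Ord_diff[OF Q.Ord_add[OF 1 2] 3]])
       (auto simp: b_def c_def blinfun.bilinear_simps algebra_simps)
qed

text \<open>
  Remainders of the exact solution after one step, integrated from \<open>expand_drift_2\<close> and \<open>expand_v_2\<close>.
\<close>

definition "rem_v p = vs p (t p + h p) - (v p + \<sigma> (w p) + h p *\<^sub>R b p - G (\<sigma> (I p))
    + ((h p)\<^sup>2 / 2) *\<^sub>R c p + f' (x p) (\<sigma> (J p)) + G (G (\<sigma> (J p))))"

definition "rem_x p = xs p (t p + h p) - (x p + h p *\<^sub>R v p + \<sigma> (I p)
    + ((h p)\<^sup>2 / 2) *\<^sub>R b p - G (\<sigma> (J p)))"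

lemma Ord_rem_v: "Ord 3 2 rem_v"
proof -
  have "Ord 3 2 (\<lambda>p. integral {t p..t p + h p} (\<lambda>s. f (xs p s) - G (vs p s) - b p + G (\<sigma> (ws p s))
      - (s - t p) *\<^sub>R c p - (f' (x p) (\<sigma> (A p s)) + G (G (\<sigma> (A p s))))))"
    using QOrd_end[OF QOrd_integral[OF expand_drift_2]] by (simp add: numeral_3_eq_3 numeral_2_eq_2)
  then show ?thesis
  proof (rule Ord_cong[rotated])
    fix p assume p: "p \<in> P"
    then have e: "t p + h p \<in> {t p..t p + h p}" using h_pos by (auto simp: less_imp_le)
    have "integral {t p..t p + h p} (\<lambda>s. f (xs p s) - G (vs p s) - b p + G (\<sigma> (ws p s))
      - (s - t p) *\<^sub>R c p - (f' (x p) (\<sigma> (A p s)) + G (G (\<sigma> (A p s)))))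
      = (vs p (t p + h p) - v p - \<sigma> (w p)) - (t p + h p - t p) *\<^sub>R b p + G (\<sigma> (I p))
        - ((t p + h p - t p)\<^sup>2 / 2) *\<^sub>R c p - (f' (x p) (\<sigma> (J p)) + G (G (\<sigma> (J p))))"
      unfolding w_def I_def using p e h_pos[OF p]
      by (intro integral_unique has_integral_drift has_integral_diff has_integral_add
        has_integral_blinfun has_integral_w has_integral_start has_integral_A
        has_integral_scaleR_left has_integral_offset) auto
    then show "rem_v p = integral {t p..t p + h p} (\<lambda>s. f (xs p s) - G (vs p s) - b p + G (\<sigma> (ws p s))
      - (s - t p) *\<^sub>R c p - (f' (x p) (\<sigma> (A p s)) + G (G (\<sigma> (A p s)))))"
      by (simp add: rem_v_def algebra_simps)
  qed
qed

lemma Ord_rem_x: "Ord 3 1 rem_x"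
proof -
  have "Ord 3 1 (\<lambda>p. integral {t p..t p + h p} (\<lambda>s. vs p s - v p - \<sigma> (ws p s) - (s - t p) *\<^sub>R b p + G (\<sigma> (A p s))))"
    using QOrd_end[OF QOrd_integral[OF expand_v_2]] by (simp add: numeral_3_eq_3 numeral_2_eq_2)
  then show ?thesis
  proof (rule Ord_cong[rotated])
    fix p assume p: "p \<in> P"
    then have e: "t p + h p \<in> {t p..t p + h p}" using h_pos by (auto simp: less_imp_le)
    have "integral {t p..t p + h p} (\<lambda>s. vs p s - v p - \<sigma> (ws p s) - (s - t p) *\<^sub>R b p + G (\<sigma> (A p s)))
      = (xs p (t p + h p) - x p) - (t p + h p - t p) *\<^sub>R v p - \<sigma> (I p)
        - ((t p + h p - t p)\<^sup>2 / 2) *\<^sub>R b p + G (\<sigma> (J p))"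
      unfolding I_def using p e h_pos[OF p]
      by (intro integral_unique has_integral_v has_integral_diff has_integral_add
        has_integral_blinfun has_integral_w has_integral_start has_integral_A
        has_integral_scaleR_left has_integral_offset) auto
    then show "rem_x p = integral {t p..t p + h p} (\<lambda>s. vs p s - v p - \<sigma> (ws p s) - (s - t p) *\<^sub>R b p + G (\<sigma> (A p s)))"
      by (simp add: rem_x_def algebra_simps)
  qed
qed

end

section \<open>The splitting steps\<close>

text \<open>
  The stability notion for one step.  Because the increments of \<open>W\<close> only shift both copies, the constant \<open>c\<close>
  of a splitting step is \<open>O(h)\<close> uniformly in the noise.
\<close>

definition near_translation :: "real \<Rightarrow> ('z::real_normed_vector \<Rightarrow> 'z) \<Rightarrow> bool" where
  "near_translation c \<Phi> \<longleftrightarrow> (\<forall>y z. norm (\<Phi> y - \<Phi> z - (y - z)) \<le> c * norm (y - z))"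

lemma norm_fst_le': "norm (fst z) \<le> norm z" and norm_snd_le': "norm (snd z) \<le> norm z"
  by (metis norm_fst_le prod.collapse, metis norm_snd_le prod.collapse)

lemma near_translation_comp:
  assumes "near_translation (C * h) \<Phi>" "near_translation (D * h) \<Psi>" "0 \<le> C" "0 \<le> D" "0 \<le> h" "h \<le> 1"
  shows "near_translation ((C + D + C * D) * h) (\<Phi> \<circ> \<Psi>)"
  unfolding near_translation_def
proof (intro allI)
  fix y z
  have *: "norm (\<Psi> y - \<Psi> z - (y - z)) \<le> D * h * norm (y - z)"
    using assms(2) by (simp add: near_translation_def)
  then have "norm (\<Psi> y - \<Psi> z) \<le> D * h * norm (y - z) + norm (y - z)"
    using norm_triangle_ineq2[of "\<Psi> y - \<Psi> z" "y - z"] by simp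
  then have "C * h * norm (\<Psi> y - \<Psi> z) \<le> C * h * (D * h * norm (y - z) + norm (y - z))"
    using assms(3-6) by (intro mult_left_mono) auto
  moreover have "norm (\<Phi> (\<Psi> y) - \<Phi> (\<Psi> z) - (\<Psi> y - \<Psi> z)) \<le> C * h * norm (\<Psi> y - \<Psi> z)"
    using assms(1) by (simp add: near_translation_def)
  moreover have "C * h * (D * h * norm (y - z)) \<le> C * h * (D * 1 * norm (y - z))"
    using assms(3-6) by (intro mult_left_mono mult_right_mono) auto
  ultimately have "norm ((\<Phi> (\<Psi> y) - \<Phi> (\<Psi> z) - (\<Psi> y - \<Psi> z)) + (\<Psi> y - \<Psi> z - (y - z)))
      \<le> (C + D + C * D) * h * norm (y - z)"
    using * by (intro norm_triangle_le) (simp add: algebra_simps)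
  then show "norm ((\<Phi> \<circ> \<Psi>) y - (\<Phi> \<circ> \<Psi>) z - (y - z)) \<le> (C + D + C * D) * h * norm (y - z)"
    by (simp add: algebra_simps)
qed

context langevin_coefficients
begin

lemma drift_lipschitz:
  "norm ((f (fst y) - f (fst z)) - G (snd (y - z))) \<le> (L1 + norm G) * norm (y - z)"
proof -
  have "norm (f (fst y) - f (fst z)) \<le> L1 * norm (fst (y - z))" using f_lipschitz by simp
  also have "\<dots> \<le> L1 * norm (y - z)" by (intro mult_left_mono norm_fst_le' L1_nonneg)
  finally have 1: "norm (f (fst y) - f (fst z)) \<le> L1 * norm (y - z)" .
  have "norm (G (snd (y - z))) \<le> norm G * norm (snd (y - z))" by (rule norm_blinfun)
  also have "\<dots> \<le> norm G * norm (y - z)" by (intro mult_left_mono norm_snd_le') auto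
  finally show ?thesis
    using 1 unfolding distrib_right by (intro order_trans[OF norm_triangle_ineq4 add_mono])
qed

text \<open>
  The closed forms of the flows of the fields of \<open>A\<close> and \<open>B\<close> for time \<open>\<tau>\<close>.
\<close>

definition step_A :: "real \<Rightarrow> 'a \<Rightarrow> real \<Rightarrow> 'a \<times> 'a \<Rightarrow> 'a \<times> 'a" where
  "step_A h u \<tau> z = (fst z + \<tau> *\<^sub>R (h *\<^sub>R snd z - \<sigma> u), snd z)"

definition step_B :: "real \<Rightarrow> 'a \<Rightarrow> 'a \<Rightarrow> real \<Rightarrow> 'a \<times> 'a \<Rightarrow> 'a \<times> 'a" where
  "step_B h w u \<tau> z = (fst z,
     snd z + linear_flow (- h *\<^sub>R G) \<tau> (h *\<^sub>R (f (fst z) - G (snd z)) + \<sigma> w + G (\<sigma> u)))"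

lemma near_translation_step_A:
  assumes "0 \<le> h" "0 \<le> \<tau>" "\<tau> \<le> 1"
  shows "near_translation (1 * h) (step_A h u \<tau>)"
  unfolding near_translation_def
proof (intro allI)
  fix y z :: "'a \<times> 'a"
  have "step_A h u \<tau> y - step_A h u \<tau> z - (y - z) = ((\<tau> * h) *\<^sub>R snd (y - z), 0)"
    by (simp add: step_A_def prod_eq_iff algebra_simps)
  then have "norm (step_A h u \<tau> y - step_A h u \<tau> z - (y - z)) = \<tau> * h * norm (snd (y - z))"
    using assms by (simp add: norm_Pair)
  also have "\<dots> \<le> 1 * h * norm (y - z)"
    using assms by (intro mult_mono norm_snd_le') auto
  finally show "norm (step_A h u \<tau> y - step_A h u \<tau> z - (y - z)) \<le> 1 * h * norm (y - z)" .
qed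

lemma near_translation_step_B:
  assumes "0 \<le> h" "h * norm G \<le> 1" "0 \<le> \<tau>" "\<tau> \<le> 1"
  shows "near_translation (exp 1 * (L1 + norm G) * h) (step_B h w u \<tau>)"
  unfolding near_translation_def
proof (intro allI)
  fix y z :: "'a \<times> 'a"
  let ?lf = "linear_flow (- h *\<^sub>R G) \<tau>"
  let ?a = "\<lambda>z. h *\<^sub>R (f (fst z) - G (snd z)) + \<sigma> w + G (\<sigma> u)"
  have P: "norm (- h *\<^sub>R G) \<le> 1" using assms by simp
  have "step_B h w u \<tau> y - step_B h w u \<tau> z - (y - z) = (0, ?lf (?a y - ?a z))"
    unfolding linear_flow_diff[OF assms(3,4) P] by (simp add: step_B_def prod_eq_iff)
  then have "norm (step_B h w u \<tau> y - step_B h w u \<tau> z - (y - z)) = norm (?lf (?a y - ?a z))"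
    by (simp add: norm_Pair)
  also have "\<dots> \<le> exp 1 * norm (?a y - ?a z)"
    by (rule norm_linear_flow_le[OF assms(3,4) P])
  also have "?a y - ?a z = h *\<^sub>R ((f (fst y) - f (fst z)) - G (snd (y - z)))"
    by (simp add: algebra_simps blinfun.bilinear_simps)
  also have "exp 1 * norm \<dots> \<le> exp 1 * (h * ((L1 + norm G) * norm (y - z)))"
    using assms(1) drift_lipschitz[of y z] by (simp add: mult_left_mono)
  finally show "norm (step_B h w u \<tau> y - step_B h w u \<tau> z - (y - z)) \<le> exp 1 * (L1 + norm G) * h * norm (y - z)"
    by (simp add: algebra_simps)
qed

lemma flow_map_step_A:
  assumes D: "\<And>x v. D (x, v) = (h *\<^sub>R v - \<sigma> u, 0)" and "0 \<le> h" "h \<le> 1/2" "0 \<le> \<tau>" "\<tau> \<le> 1"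
  shows "flow_map \<tau> D z = step_A h u \<tau> z"
proof -
  have D': "D z = (h *\<^sub>R snd z - \<sigma> u, 0)" for z by (cases z) (simp add: D)
  show ?thesis
  proof (rule flow_map_eqI[where K=h and \<gamma>="\<lambda>s. step_A h u s z"])
    fix y z :: "'a \<times> 'a"
    have "D y - D z = (h *\<^sub>R snd (y - z), 0)" by (simp add: D' algebra_simps)
    then have "norm (D y - D z) = h * norm (snd (y - z))" using assms by (simp add: norm_Pair)
    also have "\<dots> \<le> h * norm (y - z)" using assms by (intro mult_left_mono norm_snd_le')
    finally show "norm (D y - D z) \<le> h * norm (y - z)" .
  next
    show "h * \<tau> \<le> 1/2" using mult_mono[of h "1/2" \<tau> 1] assms by simp
  next
    fix s assume "s \<in> {0..\<tau>}"
    show "((\<lambda>s. step_A h u s z) has_vector_derivative D (step_A h u s z)) (at s within {0..\<tau>})"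
      unfolding step_A_def D'
      by (auto intro!: derivative_eq_intros has_vector_derivative_Pair)
  qed (use assms in \<open>auto simp: step_A_def\<close>)
qed

lemma flow_map_step_B:
  assumes D: "\<And>x v. D (x, v) = (0, h *\<^sub>R (f x - G v) + \<sigma> w + G (\<sigma> u))"
    and h: "0 \<le> h" "h * (L1 + norm G) \<le> 1/2" and \<tau>: "0 \<le> \<tau>" "\<tau> \<le> 1"
  shows "flow_map \<tau> D z = step_B h w u \<tau> z"
proof -
  have D': "D z = (0, h *\<^sub>R (f (fst z) - G (snd z)) + \<sigma> w + G (\<sigma> u))" for z by (cases z) (simp add: D)
  have "h * norm G \<le> h * (L1 + norm G)" using h(1) L1_nonneg by (intro mult_left_mono) auto
  then have P: "norm (- h *\<^sub>R G) \<le> 1" using h by simp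
  show ?thesis
  proof (rule flow_map_eqI[where K="h * (L1 + norm G)" and \<gamma>="\<lambda>s. step_B h w u s z"])
    fix y z :: "'a \<times> 'a"
    have "D y - D z = (0, h *\<^sub>R ((f (fst y) - f (fst z)) - G (snd (y - z))))"
      by (simp add: D' algebra_simps blinfun.bilinear_simps)
    then have "norm (D y - D z) = h * norm ((f (fst y) - f (fst z)) - G (snd (y - z)))"
      using h by (simp add: norm_Pair)
    also have "\<dots> \<le> h * ((L1 + norm G) * norm (y - z))"
      using h(1) drift_lipschitz[of y z] by (rule mult_left_mono[rotated])
    finally show "norm (D y - D z) \<le> h * (L1 + norm G) * norm (y - z)" by (simp add: algebra_simps)
  next
    show "h * (L1 + norm G) * \<tau> \<le> 1/2"
      using mult_mono[of "h * (L1 + norm G)" "1/2" \<tau> 1] h \<tau> L1_nonneg by simp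
    show "0 \<le> h * (L1 + norm G)" using h L1_nonneg by simp
  next
    fix s assume s: "s \<in> {0..\<tau>}"
    define a where "a = h *\<^sub>R (f (fst z) - G (snd z)) + \<sigma> w + G (\<sigma> u)"
    have "((\<lambda>s. linear_flow (- h *\<^sub>R G) s a) has_vector_derivative
        a + (- h *\<^sub>R G) (linear_flow (- h *\<^sub>R G) s a)) (at s within {0..\<tau>})"
      using s \<tau> by (intro has_vector_derivative_within_subset[OF linear_flow_has_vector_derivative[OF P]]) auto
    then have "((\<lambda>s. (fst z, snd z + linear_flow (- h *\<^sub>R G) s a)) has_vector_derivative
        (0, 0 + (a + (- h *\<^sub>R G) (linear_flow (- h *\<^sub>R G) s a)))) (at s within {0..\<tau>})"
      by (intro has_vector_derivative_Pair has_vector_derivative_const has_vector_derivative_add)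
    moreover have "D (fst z, snd z + linear_flow (- h *\<^sub>R G) s a)
        = (0, 0 + (a + (- h *\<^sub>R G) (linear_flow (- h *\<^sub>R G) s a)))"
      by (simp add: D' a_def blinfun.bilinear_simps algebra_simps)
    ultimately show "((\<lambda>s. step_B h w u s z) has_vector_derivative D (step_B h w u s z)) (at s within {0..\<tau>})"
      unfolding step_B_def a_def[symmetric] by simp
  qed (use \<tau> in \<open>auto simp: step_B_def linear_flow_0\<close>)
qed

end

context langevin_steps
begin

lemma Ord_I: "Ord 1 1 I"
proof -
  from Q.Ord_cong[OF _ QOrd_integral[OF QOrd_w], of "\<lambda>(p, s). A p s"]
  have "QOrd 1 1 (\<lambda>(p, s). A p s)" by (auto simp: A_def)
  from QOrd_end[OF this] show ?thesis unfolding I_def by simp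
qed

lemma Ord_u: "Ord 1 1 u"
proof -
  have "Ord 1 1 (\<lambda>p. (1/2 * h p ^ 1) *\<^sub>R w p - I p)"
    by (intro Ord_diff Ord_scale[OF Ord_w] Ord_I) auto
  then show ?thesis unfolding u_def[abs_def] by simp
qed

text \<open>
  \<open>kick\<close> is the field of \<open>B\<close> at the starting point and \<open>kick'\<close> its part of order \<open>h\<close>, without \<open>\<sigma> w\<close>.
\<close>

definition "lf p s a = linear_flow (- h p *\<^sub>R G) s a"
definition "kick p = h p *\<^sub>R b p + \<sigma> (w p) + G (\<sigma> (u p))"
definition "kick' p = h p *\<^sub>R b p + G (\<sigma> (u p))"

lemma Ord_hscale: "Ord i j X \<Longrightarrow> i' \<le> i + 1 \<Longrightarrow> j \<le> j' \<Longrightarrow> Ord i' j' (\<lambda>p. h p *\<^sub>R X p)"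
  using Ord_scale[of i j X i' 1 j' 1] by simp

lemma Ord_kick': "Ord 1 1 kick'"
  unfolding kick'_def[abs_def] by (intro Ord_add Ord_hscale[OF Ord_b] Ord_blinfun Ord_u) auto

lemma kick_eq: "kick p = kick' p + \<sigma> (w p)"
  by (simp add: kick_def kick'_def algebra_simps)

lemma Ord_kick: "Ord 0 1 kick"
  unfolding kick_eq[abs_def] by (intro Ord_add Ord_mono[OF Ord_kick'] Ord_blinfun Ord_w) auto

definition "lf_rest p s a = lf p s a
  - (s *\<^sub>R a - (s\<^sup>2 / 2 * h p) *\<^sub>R G a + (s ^ 3 / 6 * (h p)\<^sup>2) *\<^sub>R G (G a))"

lemma Ord_lf:
  assumes "Ord i j X" "0 \<le> s" "s \<le> 1"
  shows "Ord i j (\<lambda>p. lf p s (X p))"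
    and "Ord (i + 3) j (\<lambda>p. lf_rest p s (X p))"
  unfolding lf_rest_def lf_def using Ord_linear_flow[OF assms h_G] by auto

lemma Ord_lf_2:
  assumes "Ord i j X" "0 \<le> s" "s \<le> 1"
  shows "Ord (i + 2) j (\<lambda>p. lf p s (X p) - s *\<^sub>R X p + (s\<^sup>2 / 2 * h p) *\<^sub>R G (X p))"
proof -
  have "Ord (i + 2) j (\<lambda>p. lf_rest p s (X p) + (s ^ 3 / 6 * (h p)\<^sup>2) *\<^sub>R G (G (X p)))"
    by (intro Ord_add Ord_mono[OF Ord_lf(2)[OF assms]] Ord_scale[where a=2 and i=i and j=j] Ord_blinfun assms(1)) auto
  then show ?thesis by (rule Ord_cong[rotated]) (simp add: lf_rest_def)
qed

lemma Ord_lf_1: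
  assumes "Ord i j X" "0 \<le> s" "s \<le> 1"
  shows "Ord (i + 1) j (\<lambda>p. lf p s (X p) - s *\<^sub>R X p)"
proof -
  have "Ord (i + 1) j (\<lambda>p. (lf p s (X p) - s *\<^sub>R X p + (s\<^sup>2 / 2 * h p) *\<^sub>R G (X p))
      - (s\<^sup>2 / 2 * h p ^ 1) *\<^sub>R G (X p))"
    by (intro Ord_diff Ord_mono[OF Ord_lf_2[OF assms]] Ord_scale[where a=1 and i=i and j=j] Ord_blinfun assms(1)) auto
  then show ?thesis by (rule Ord_cong[rotated]) simp
qed

text \<open>
  The mean-zero parts of the defects of the two symmetric schemes.  They differ in the coefficient
  of \<open>h\<^sup>2 \<Gamma> \<sigma> w\<close> in the position and in the noise that enters through \<open>f'(x)\<close>, since \<open>f\<close> is evaluated at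
  different intermediate points.
\<close>

definition "pos_noise \<kappa> p =
  - G (\<sigma> (J p)) - (h p / 2) *\<^sub>R G (\<sigma> (u p)) + (\<kappa> * (h p)\<^sup>2) *\<^sub>R G (\<sigma> (w p))"

definition "vel_noise X p = f' (x p) (\<sigma> (X p)) + G (G (\<sigma> (J p + (h p / 2) *\<^sub>R u p)))
  - ((h p)\<^sup>2 / 6) *\<^sub>R G (G (\<sigma> (w p)))"

text \<open>
  Each defect is a sum of remainders of known order.  The identity behind this is linear in the vectors
  involved and is checked after taking inner products with an arbitrary vector, which turns it into an
  identity of real polynomials.
\<close>

lemmas identity_simps = blinfun.bilinear_simps inner_simps

subsection \<open>One step of exp(A) exp(B)\<close>

definition "AB p = (step_A (h p) (u p) 1 \<circ> step_B (h p) (w p) (u p) 1) (x p, v p)"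

text \<open>
  The term \<open>h \<sigma> w / 2\<close> has no counterpart in the exact position: \<open>exp(A)\<close> moves with the velocity at the end
  of the step, which contains the full increment \<open>w\<close>, whereas the exact position uses its average \<open>I / h\<close>.
\<close>

lemma defect_AB:
  "Ord 2 2 (\<lambda>p. xs p (t p + h p) - fst (AB p) + (h p / 2) *\<^sub>R \<sigma> (w p))"
  "Ord 2 2 (\<lambda>p. vs p (t p + h p) - snd (AB p))"
proof -
  have AB: "AB p = (x p + (h p *\<^sub>R (v p + lf p 1 (kick p)) - \<sigma> (u p)), v p + lf p 1 (kick p))" for p
    by (simp add: AB_def step_A_def step_B_def lf_def kick_def b_def)
  have ex: "Ord 2 1 (\<lambda>p. xs p (t p + h p) - x p - h p *\<^sub>R v p - \<sigma> (I p))"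
    using QOrd_end[OF expand_x_2] by (simp add: I_def)
  have ev: "Ord 2 1 (\<lambda>p. vs p (t p + h p) - v p - \<sigma> (w p) - h p *\<^sub>R b p + G (\<sigma> (I p)))"
    using QOrd_end[OF expand_v_2] by (simp add: I_def w_def)
  have "Ord 2 2 (\<lambda>p. (xs p (t p + h p) - x p - h p *\<^sub>R v p - \<sigma> (I p))
      - h p *\<^sub>R ((lf p 1 (kick p) - 1 *\<^sub>R kick p) + kick' p))"
    by (intro Ord_diff Ord_mono[OF ex] Ord_hscale[where i=1 and j=1] Ord_add
        Ord_mono[OF Ord_lf_1[OF Ord_kick]] Ord_kick') auto
  then show "Ord 2 2 (\<lambda>p. xs p (t p + h p) - fst (AB p) + (h p / 2) *\<^sub>R \<sigma> (w p))"
  proof (rule Ord_cong[rotated])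
    fix p assume "p \<in> P"
    show "xs p (t p + h p) - fst (AB p) + (h p / 2) *\<^sub>R \<sigma> (w p) =
      (xs p (t p + h p) - x p - h p *\<^sub>R v p - \<sigma> (I p))
      - h p *\<^sub>R ((lf p 1 (kick p) - 1 *\<^sub>R kick p) + kick' p)"
      apply (rule vector_eq_rdot[THEN iffD1], rule allI)
      apply (simp add: AB kick_eq u_def identity_simps)
      apply (simp add: field_simps)
      done
  qed
  have "Ord 2 2 (\<lambda>p. (vs p (t p + h p) - v p - \<sigma> (w p) - h p *\<^sub>R b p + G (\<sigma> (I p)))
      - (lf p 1 (kick p) - 1 *\<^sub>R kick p + (1\<^sup>2 / 2 * h p) *\<^sub>R G (kick p)) + (1/2 * h p ^ 1) *\<^sub>R G (kick' p))"
    by (intro Ord_diff Ord_add Ord_mono[OF ev] Ord_mono[OF Ord_lf_2[OF Ord_kick]]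
        Ord_scale[OF Ord_blinfun[OF Ord_kick']]) auto
  then show "Ord 2 2 (\<lambda>p. vs p (t p + h p) - snd (AB p))"
  proof (rule Ord_cong[rotated])
    fix p assume "p \<in> P"
    show "vs p (t p + h p) - snd (AB p) = (vs p (t p + h p) - v p - \<sigma> (w p) - h p *\<^sub>R b p + G (\<sigma> (I p)))
      - (lf p 1 (kick p) - 1 *\<^sub>R kick p + (1\<^sup>2 / 2 * h p) *\<^sub>R G (kick p)) + (1/2 * h p ^ 1) *\<^sub>R G (kick' p)"
      apply (rule vector_eq_rdot[THEN iffD1], rule allI)
      apply (simp add: AB kick_eq kick'_def u_def identity_simps)
      apply (simp add: field_simps)
      done
  qed
qed

subsection \<open>One step of exp(A/2) exp(B) exp(A/2)\<close>

definition "ABA p = (step_A (h p) (u p) (1/2) \<circ> step_B (h p) (w p) (u p) 1 \<circ> step_A (h p) (u p) (1/2)) (x p, v p)"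

lemma defect_ABA:
  "Ord 3 2 (\<lambda>p. xs p (t p + h p) - fst (ABA p) - pos_noise (1/4) p)"
  "Ord 3 2 (\<lambda>p. vs p (t p + h p) - snd (ABA p)
     - vel_noise (\<lambda>p. J p + (h p / 2) *\<^sub>R u p) p)"
proof -
  \<comment> \<open>The force is evaluated at \<open>x + n\<close>, and \<open>d\<close> is the resulting change of the kick.\<close>
  define n where "n p = (1/2) *\<^sub>R (h p *\<^sub>R v p - \<sigma> (u p))" for p
  define d where "d p = h p *\<^sub>R (f (x p + n p) - f (x p))" for p
  define r1 where "r1 p = f (x p + n p) - f (x p) - f' (x p) (n p)" for p
  define r2 where "r2 p = lf_rest p 1 (kick p + d p)" for p
  have n: "Ord 1 1 n"
    unfolding n_def[abs_def]
    using Ord_scale[of 1 1 "\<lambda>p. h p *\<^sub>R v p - \<sigma> (u p)" 1 0 1 "1/2"]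
    by (simp add: Ord_diff Ord_hscale[OF Ord_v] Ord_blinfun Ord_u flip: One_nat_def)
  have d: "Ord 2 1 d"
    unfolding d_def[abs_def] by (intro Ord_hscale[OF Ord_f_increment[OF n]]) auto
  have r1: "Ord 2 2 r1"
    unfolding r1_def[abs_def] by (rule Ord_f_taylor[OF n])
  have kd: "Ord 0 1 (\<lambda>p. kick p + d p)" by (intro Ord_add Ord_kick Ord_mono[OF d]) auto
  have r2: "Ord 3 1 r2"
    unfolding r2_def[abs_def] using Ord_lf(2)[OF kd, of 1] by simp
  have step: "ABA p = (x p + n p + (1/2) *\<^sub>R (h p *\<^sub>R (v p + lf p 1 (kick p + d p)) - \<sigma> (u p)), v p + lf p 1 (kick p + d p))" for p
  proof -
    have "h p *\<^sub>R (f (x p + n p) - G (v p)) + \<sigma> (w p) + G (\<sigma> (u p)) = kick p + d p"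
      by (simp add: kick_def d_def b_def algebra_simps)
    then show ?thesis by (simp add: ABA_def step_A_def step_B_def lf_def n_def)
  qed
  have lf_eq: "lf p 1 (kick p + d p) = kick p + d p - (h p / 2) *\<^sub>R G (kick p + d p)
      + ((h p)\<^sup>2 / 6) *\<^sub>R G (G (kick p + d p)) + r2 p" for p
    by (simp add: r2_def lf_rest_def)
  have d_eq: "d p = h p *\<^sub>R f' (x p) (n p) + h p *\<^sub>R r1 p" for p
    by (simp add: d_def r1_def algebra_simps)
  have "Ord 3 2 (\<lambda>p. rem_x p
      - (1/2 * h p ^ 1) *\<^sub>R d p + (1/4 * h p ^ 2) *\<^sub>R G (kick' p) + (1/4 * h p ^ 2) *\<^sub>R G (d p)
      - (1/12 * h p ^ 3) *\<^sub>R G (G (kick p + d p)) - (1/2 * h p ^ 1) *\<^sub>R r2 p)"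
    by (intro Ord_diff Ord_add Ord_mono[OF Ord_rem_x] Ord_scale[OF d] Ord_scale[OF Ord_blinfun[OF Ord_kick']]
        Ord_scale[OF Ord_blinfun[OF d]] Ord_scale[OF Ord_blinfun[OF Ord_blinfun[OF kd]]] Ord_scale[OF r2]) auto
  then show "Ord 3 2 (\<lambda>p. xs p (t p + h p) - fst (ABA p) - pos_noise (1/4) p)"
    apply (rule Ord_cong[rotated])
    apply (rule vector_eq_rdot[THEN iffD1], rule allI)
    apply (simp only: step lf_eq fst_conv)
    apply (simp add: rem_x_def pos_noise_def kick_eq kick'_def n_def u_def identity_simps)
    apply (simp add: field_simps power2_eq_square power3_eq_cube)
    done
  have "Ord 3 2 (\<lambda>p. rem_v p
      - h p *\<^sub>R r1 p + (1/2 * h p ^ 1) *\<^sub>R G (d p) - (1/6 * h p ^ 2) *\<^sub>R G (G (d p))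
      - (1/6 * h p ^ 2) *\<^sub>R G (G (kick' p)) - r2 p)"
    by (intro Ord_diff Ord_add Ord_rem_v Ord_hscale[OF r1] Ord_scale[OF Ord_blinfun[OF d]]
        Ord_scale[OF Ord_blinfun[OF Ord_blinfun[OF d]]] Ord_scale[OF Ord_blinfun[OF Ord_blinfun[OF Ord_kick']]]
        Ord_mono[OF r2]) auto
  then show "Ord 3 2 (\<lambda>p. vs p (t p + h p) - snd (ABA p)
     - vel_noise (\<lambda>p. J p + (h p / 2) *\<^sub>R u p) p)"
    apply (rule Ord_cong[rotated])
    apply (rule vector_eq_rdot[THEN iffD1], rule allI)
    apply (simp only: step lf_eq snd_conv)
    apply (simp add: rem_v_def vel_noise_def kick_eq kick'_def identity_simps)
    apply (simp add: d_eq c_def n_def u_def identity_simps)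
    apply (simp add: field_simps power2_eq_square power3_eq_cube)
    done
qed

subsection \<open>One step of exp(B/2) exp(A) exp(B/2)\<close>

definition "BAB p = (step_B (h p) (w p) (u p) (1/2) \<circ> step_A (h p) (u p) 1 \<circ> step_B (h p) (w p) (u p) (1/2)) (x p, v p)"

lemma defect_BAB:
  "Ord 3 2 (\<lambda>p. xs p (t p + h p) - fst (BAB p) - pos_noise (1/8) p)"
  "Ord 3 2 (\<lambda>p. vs p (t p + h p) - snd (BAB p)
     - vel_noise (\<lambda>p. J p - (h p / 2) *\<^sub>R ((h p / 2) *\<^sub>R w p - u p)) p)"
proof -
  \<comment> \<open>\<open>g\<close> and \<open>q\<close> are the remainders of orders 1 and 2 of the velocity increment in the first half step,
    \<open>n\<close> is the displacement under \<open>exp(A)\<close> with leading part \<open>n0\<close>, and \<open>e\<close> is the change of the kick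
    between the two half steps.\<close>
  define g where "g p = lf p (1/2) (kick p) - (1/2) *\<^sub>R \<sigma> (w p)" for p
  define q where "q p = lf p (1/2) (kick p) - (1/2) *\<^sub>R kick p + ((1/2)\<^sup>2 / 2 * h p) *\<^sub>R G (kick p)
      - ((1/8 * h p ^ 1) *\<^sub>R G (kick' p))" for p
  define n0 where "n0 p = h p *\<^sub>R v p + (1/2 * h p ^ 1) *\<^sub>R \<sigma> (w p) - \<sigma> (u p)" for p
  define n where "n p = n0 p + h p *\<^sub>R g p" for p
  define r1 where "r1 p = f (x p + n p) - f (x p) - f' (x p) (n p)" for p
  define d where "d p = h p *\<^sub>R (f (x p + n p) - f (x p))" for p
  define e2 where "e2 p = d p - h p *\<^sub>R G (g p)" for p
  define e where "e p = e2 p - (1/2 * h p ^ 1) *\<^sub>R G (\<sigma> (w p))" for p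
  define r0 where "r0 p = lf_rest p (1/2) (kick p)" for p
  define r2 where "r2 p = lf_rest p (1/2) (kick p + e p)" for p
  have g: "Ord 1 1 g"
  proof -
    have "Ord 1 1 (\<lambda>p. (lf p (1/2) (kick p) - (1/2) *\<^sub>R kick p) + (1/2 * h p ^ 0) *\<^sub>R kick' p)"
      by (intro Ord_add Ord_mono[OF Ord_lf_1[OF Ord_kick]] Ord_scale[OF Ord_kick']) auto
    then show ?thesis by (rule Ord_cong[rotated]) (simp add: g_def kick_eq algebra_simps)
  qed
  have q: "Ord 2 1 q"
    unfolding q_def[abs_def]
    by (intro Ord_diff Ord_mono[OF Ord_lf_2[OF Ord_kick]] Ord_scale[OF Ord_blinfun[OF Ord_kick']]) auto
  have n0: "Ord 1 1 n0"
    unfolding n0_def[abs_def]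
    by (intro Ord_diff Ord_add Ord_hscale[OF Ord_v] Ord_scale[OF Ord_blinfun[OF Ord_w]] Ord_blinfun Ord_u) auto
  have n: "Ord 1 1 n"
    unfolding n_def[abs_def] by (intro Ord_add n0 Ord_hscale[OF g]) auto
  have r1: "Ord 2 2 r1"
    unfolding r1_def[abs_def] by (rule Ord_f_taylor[OF n])
  have d: "Ord 2 1 d"
    unfolding d_def[abs_def] by (intro Ord_hscale[OF Ord_f_increment[OF n]]) auto
  have e2: "Ord 2 1 e2"
    unfolding e2_def[abs_def] by (intro Ord_diff d Ord_hscale[OF Ord_blinfun[OF g]]) auto
  have e: "Ord 1 1 e"
    unfolding e_def[abs_def]
    by (intro Ord_diff Ord_mono[OF e2] Ord_scale[OF Ord_blinfun[OF Ord_blinfun[OF Ord_w]]]) auto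
  have ke: "Ord 0 1 (\<lambda>p. kick p + e p)" by (intro Ord_add Ord_kick Ord_mono[OF e]) auto
  have r0: "Ord 3 1 r0"
    unfolding r0_def[abs_def] using Ord_lf(2)[OF Ord_kick, of "1/2"] by simp
  have r2: "Ord 3 1 r2"
    unfolding r2_def[abs_def] using Ord_lf(2)[OF ke, of "1/2"] by simp
  have step: "BAB p = (x p + n p, v p + lf p (1/2) (kick p) + lf p (1/2) (kick p + e p))" for p
  proof -
    have 1: "x p + (h p *\<^sub>R (v p + lf p (1/2) (kick p)) - \<sigma> (u p)) = x p + n p"
      by (simp add: n_def n0_def g_def algebra_simps)
    have 2: "h p *\<^sub>R (f (x p + n p) - G (v p + lf p (1/2) (kick p))) + \<sigma> (w p) + G (\<sigma> (u p)) = kick p + e p"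
      by (simp add: kick_def e_def e2_def d_def g_def b_def blinfun.bilinear_simps algebra_simps)
    have 3: "h p *\<^sub>R (f (x p) - G (v p)) + \<sigma> (w p) + G (\<sigma> (u p)) = kick p"
      by (simp add: kick_def b_def)
    show ?thesis
      unfolding BAB_def step_A_def step_B_def lf_def[symmetric] o_def fst_conv snd_conv 3 scaleR_one 1 2 ..
  qed
  have lf0: "lf p (1/2) (kick p) = (1/2) *\<^sub>R (kick p) - (h p / 8) *\<^sub>R G (kick p)
      + ((h p)\<^sup>2 / 48) *\<^sub>R G (G (kick p)) + r0 p" for p
    by (simp add: r0_def lf_rest_def power2_eq_square power3_eq_cube)
  have lf1: "lf p (1/2) (kick p + e p) = (1/2) *\<^sub>R (kick p + e p) - (h p / 8) *\<^sub>R G (kick p + e p)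
      + ((h p)\<^sup>2 / 48) *\<^sub>R G (G (kick p + e p)) + r2 p" for p
    by (simp add: r2_def lf_rest_def power2_eq_square power3_eq_cube)
  have g_eq: "g p = (1/2) *\<^sub>R kick' p - (h p / 8) *\<^sub>R G (\<sigma> (w p)) + q p" for p
    by (rule vector_eq_rdot[THEN iffD1])
       (simp add: g_def q_def kick_eq identity_simps field_simps power2_eq_square)
  have d_eq: "d p = h p *\<^sub>R f' (x p) (n0 p) + h p *\<^sub>R f' (x p) (h p *\<^sub>R g p) + h p *\<^sub>R r1 p" for p
    by (simp add: d_def r1_def n_def blinfun.bilinear_simps algebra_simps)
  have e_eq: "(1/2) *\<^sub>R e p = (1/2) *\<^sub>R (h p *\<^sub>R f' (x p) (n0 p) + h p *\<^sub>R f' (x p) (h p *\<^sub>R g p) + h p *\<^sub>R r1 p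
      - h p *\<^sub>R G ((1/2) *\<^sub>R kick' p - (h p / 8) *\<^sub>R G (\<sigma> (w p)) + q p) - (h p / 2) *\<^sub>R G (\<sigma> (w p)))" for p
    unfolding e_def e2_def d_eq[symmetric] g_eq[symmetric] by simp
  have "Ord 3 2 (\<lambda>p. rem_x p
      - h p *\<^sub>R q p)"
    by (intro Ord_diff Ord_mono[OF Ord_rem_x] Ord_hscale[OF q]) auto
  then show "Ord 3 2 (\<lambda>p. xs p (t p + h p) - fst (BAB p) - pos_noise (1/8) p)"
    apply (rule Ord_cong[rotated])
    apply (rule vector_eq_rdot[THEN iffD1], rule allI)
    apply (simp add: rem_x_def pos_noise_def step n_def n0_def g_eq kick'_def u_def identity_simps)
    apply (simp add: field_simps power2_eq_square power3_eq_cube)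
    done
  have "Ord 3 2 (\<lambda>p. rem_v p
      - r0 p - r2 p - (1/2 * h p ^ 0) *\<^sub>R (h p *\<^sub>R f' (x p) (h p *\<^sub>R g p) + h p *\<^sub>R r1 p - h p *\<^sub>R G (q p))
      + (1/8 * h p ^ 1) *\<^sub>R G (e2 p) - (1/48 * h p ^ 2) *\<^sub>R G (G (kick' p))
      - (1/48 * h p ^ 2) *\<^sub>R G (G (kick' p + e p)))"
    by (intro Ord_diff Ord_add Ord_rem_v Ord_mono[OF r0] Ord_mono[OF r2] Ord_hscale[OF r1]
        Ord_scale[where a=0 and i=3 and j=2] Ord_hscale[where i=2 and j=1] Ord_f' Ord_hscale[OF g] Ord_hscale[OF Ord_blinfun[OF q]]
        Ord_scale[OF Ord_blinfun[OF e2]] Ord_scale[OF Ord_blinfun[OF Ord_blinfun[OF Ord_kick']]]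
        Ord_scale[OF Ord_blinfun[OF Ord_blinfun[OF Ord_add[OF Ord_kick' e]]]]) auto
  then show "Ord 3 2 (\<lambda>p. vs p (t p + h p) - snd (BAB p)
     - vel_noise (\<lambda>p. J p - (h p / 2) *\<^sub>R ((h p / 2) *\<^sub>R w p - u p)) p)"
    apply (rule Ord_cong[rotated])
    apply (simp only: step lf0 lf1 scaleR_add_right[where a="1/2"] e_eq snd_conv)
    apply (rule vector_eq_rdot[THEN iffD1], rule allI)
    apply (simp add: rem_v_def vel_noise_def e_def kick_eq kick'_def n0_def c_def u_def identity_simps)
    apply (simp add: field_simps power2_eq_square power3_eq_cube)
    done
qed

end

section \<open>Square-integrable martingale increments\<close>

lemma integrable_inner_L2:
  fixes X Y :: "'w \<Rightarrow> 'b::euclidean_space"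
  assumes [measurable]: "X \<in> borel_measurable M" "Y \<in> borel_measurable M"
    and "integrable M (\<lambda>\<omega>. (norm (X \<omega>))\<^sup>2)" "integrable M (\<lambda>\<omega>. (norm (Y \<omega>))\<^sup>2)"
  shows "integrable M (\<lambda>\<omega>. X \<omega> \<bullet> Y \<omega>)"
proof (rule Bochner_Integration.integrable_bound)
  show "integrable M (\<lambda>\<omega>. (norm (X \<omega>))\<^sup>2 + (norm (Y \<omega>))\<^sup>2)" using assms by simp
  show "AE \<omega> in M. norm (X \<omega> \<bullet> Y \<omega>) \<le> norm ((norm (X \<omega>))\<^sup>2 + (norm (Y \<omega>))\<^sup>2)"
  proof (rule AE_I2)
    fix \<omega>
    have "2 * (norm (X \<omega>) * norm (Y \<omega>)) \<le> (norm (X \<omega>))\<^sup>2 + (norm (Y \<omega>))\<^sup>2"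
      using zero_le_power2[of "norm (X \<omega>) - norm (Y \<omega>)"] by (simp add: power2_diff)
    moreover have "0 \<le> norm (X \<omega>) * norm (Y \<omega>)" by simp
    ultimately show "norm (X \<omega> \<bullet> Y \<omega>) \<le> norm ((norm (X \<omega>))\<^sup>2 + (norm (Y \<omega>))\<^sup>2)"
      using Cauchy_Schwarz_ineq2[of "X \<omega>" "Y \<omega>"] by (simp del: mult_nonneg_nonneg)
  qed
qed simp

lemma norm_add_sq_le: "(norm (a + b))\<^sup>2 \<le> 2 * (norm a)\<^sup>2 + 2 * (norm (b::'a::real_normed_vector))\<^sup>2"
proof -
  have "(norm (a + b))\<^sup>2 \<le> (norm a + norm b)\<^sup>2" by (intro power_mono norm_triangle_ineq) simp
  also have "\<dots> \<le> 2 * (norm a)\<^sup>2 + 2 * (norm b)\<^sup>2"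
    using zero_le_power2[of "norm a - norm b"] by (simp add: power2_diff power2_sum)
  finally show ?thesis .
qed

lemma integrable_sq_add:
  fixes X Y :: "'w \<Rightarrow> 'b::euclidean_space"
  assumes [measurable]: "X \<in> borel_measurable M" "Y \<in> borel_measurable M"
    and "integrable M (\<lambda>\<omega>. (norm (X \<omega>))\<^sup>2)" "integrable M (\<lambda>\<omega>. (norm (Y \<omega>))\<^sup>2)"
  shows "integrable M (\<lambda>\<omega>. (norm (X \<omega> + Y \<omega>))\<^sup>2)"
  by (rule Bochner_Integration.integrable_bound[of M "\<lambda>\<omega>. 2 * (norm (X \<omega>))\<^sup>2 + 2 * (norm (Y \<omega>))\<^sup>2"])
     (use assms norm_add_sq_le in auto)

text \<open>
  Square-integrable vectors known at the later time with second moment at most \<open>K\<close> whose conditional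
  expectation given the earlier \<open>F\<close> vanishes, the latter expressed by orthogonality to the
  square-integrable vectors known at the earlier time.
\<close>

definition centered ::
  "'w measure \<Rightarrow> 'w measure \<Rightarrow> 'w measure \<Rightarrow> real \<Rightarrow> ('w \<Rightarrow> 'b::euclidean_space) \<Rightarrow> bool" where
  "centered M F F' K \<xi> \<longleftrightarrow>
     \<xi> \<in> borel_measurable F' \<and> integrable M (\<lambda>\<omega>. (norm (\<xi> \<omega>))\<^sup>2) \<and> (\<integral>\<omega>. (norm (\<xi> \<omega>))\<^sup>2 \<partial>M) \<le> K \<and>
     (\<forall>Y\<in>borel_measurable F. integrable M (\<lambda>\<omega>. (norm (Y \<omega>))\<^sup>2) \<longrightarrow> (\<integral>\<omega>. Y \<omega> \<bullet> \<xi> \<omega> \<partial>M) = 0)"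

lemma centered_orthogonal:
  "centered M F F' K \<xi> \<Longrightarrow> Y \<in> borel_measurable F \<Longrightarrow> integrable M (\<lambda>\<omega>. (norm (Y \<omega>))\<^sup>2) \<Longrightarrow>
    (\<integral>\<omega>. Y \<omega> \<bullet> \<xi> \<omega> \<partial>M) = 0"
  by (simp add: centered_def)

lemma centered_add:
  assumes sub: "subalgebra M F" "subalgebra M F'"
    and \<xi>: "centered M F F' K \<xi>" and \<eta>: "centered M F F' L \<eta>"
  shows "centered M F F' (2 * K + 2 * L) (\<lambda>\<omega>. \<xi> \<omega> + \<eta> \<omega>)"
proof -
  have meas: "\<xi> \<in> borel_measurable F'" "\<eta> \<in> borel_measurable F'"
    using \<xi> \<eta> by (auto simp: centered_def)
  note [measurable] = measurable_from_subalg[OF sub(2) meas(1)] measurable_from_subalg[OF sub(2) meas(2)]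
  have int: "integrable M (\<lambda>\<omega>. (norm (\<xi> \<omega>))\<^sup>2)" "integrable M (\<lambda>\<omega>. (norm (\<eta> \<omega>))\<^sup>2)"
    using \<xi> \<eta> by (auto simp: centered_def)
  note int_add = integrable_sq_add[OF _ _ int]
  have "(\<integral>\<omega>. (norm (\<xi> \<omega> + \<eta> \<omega>))\<^sup>2 \<partial>M) \<le> (\<integral>\<omega>. 2 * (norm (\<xi> \<omega>))\<^sup>2 + 2 * (norm (\<eta> \<omega>))\<^sup>2 \<partial>M)"
    by (rule integral_mono) (use int_add int norm_add_sq_le in auto)
  also have "\<dots> \<le> 2 * K + 2 * L"
    using \<xi> \<eta> int by (simp add: centered_def)
  finally have "(\<integral>\<omega>. (norm (\<xi> \<omega> + \<eta> \<omega>))\<^sup>2 \<partial>M) \<le> 2 * K + 2 * L" .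
  moreover have "(\<integral>\<omega>. Y \<omega> \<bullet> (\<xi> \<omega> + \<eta> \<omega>) \<partial>M) = 0"
    if Y: "Y \<in> borel_measurable F" "integrable M (\<lambda>\<omega>. (norm (Y \<omega>))\<^sup>2)" for Y
  proof -
    have [measurable]: "Y \<in> borel_measurable M" by (rule measurable_from_subalg[OF sub(1) Y(1)])
    have "integrable M (\<lambda>\<omega>. Y \<omega> \<bullet> \<xi> \<omega>)" "integrable M (\<lambda>\<omega>. Y \<omega> \<bullet> \<eta> \<omega>)"
      by (auto intro!: integrable_inner_L2 int Y)
    then show ?thesis using \<xi> \<eta> Y by (simp add: centered_def inner_add_right)
  qed
  ultimately show ?thesis
    using meas int_add by (auto simp: centered_def)
qed

lemma blinfun_euclidean_expansion:
  fixes L :: "'a::euclidean_space \<Rightarrow>\<^sub>L 'b::euclidean_space"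
  shows "L x = (\<Sum>i\<in>Basis. (x \<bullet> i) *\<^sub>R L i)"
proof -
  have "L x = L (\<Sum>i\<in>Basis. (x \<bullet> i) *\<^sub>R i)" by (simp add: euclidean_representation)
  then show ?thesis by (simp only: blinfun.sum_right blinfun.scaleR_right)
qed

text \<open>
  A random linear map that is known at the earlier time can be moved to the test vector by taking its
  adjoint \<open>Z\<close>, which stays measurable and square-integrable.
\<close>

lemma centered_blinfun_family:
  fixes L :: "'w \<Rightarrow> 'a::euclidean_space \<Rightarrow>\<^sub>L 'b::euclidean_space"
  assumes sub: "subalgebra M F" "subalgebra M F'" "subalgebra F' F"
    and \<xi>: "centered M F F' K \<xi>"
    and L: "\<And>i. i \<in> Basis \<Longrightarrow> (\<lambda>\<omega>. L \<omega> i) \<in> borel_measurable F" and C: "\<And>\<omega>. norm (L \<omega>) \<le> C"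
  shows "centered M F F' (C\<^sup>2 * K) (\<lambda>\<omega>. L \<omega> (\<xi> \<omega>))"
proof -
  have meas: "\<xi> \<in> borel_measurable F'" and int: "integrable M (\<lambda>\<omega>. (norm (\<xi> \<omega>))\<^sup>2)"
    using \<xi> by (auto simp: centered_def)
  note [measurable] = meas
  have LF'[measurable]: "i \<in> Basis \<Longrightarrow> (\<lambda>\<omega>. L \<omega> i) \<in> borel_measurable F'" for i
    using measurable_from_subalg[OF sub(3) L] .
  have "(\<lambda>\<omega>. \<Sum>i\<in>Basis. (\<xi> \<omega> \<bullet> i) *\<^sub>R L \<omega> i) \<in> borel_measurable F'" by measurable
  then have measL: "(\<lambda>\<omega>. L \<omega> (\<xi> \<omega>)) \<in> borel_measurable F'"
    by (simp flip: blinfun_euclidean_expansion)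
  note [measurable] = measurable_from_subalg[OF sub(2) measL]
  have C0: "0 \<le> C" using C norm_ge_zero order_trans by blast
  have le: "(norm (L \<omega> (\<xi> \<omega>)))\<^sup>2 \<le> C\<^sup>2 * (norm (\<xi> \<omega>))\<^sup>2" for \<omega>
    unfolding power_mult_distrib[symmetric]
    by (intro power_mono order_trans[OF norm_blinfun] mult_right_mono C) auto
  have intL: "integrable M (\<lambda>\<omega>. (norm (L \<omega> (\<xi> \<omega>)))\<^sup>2)"
    by (rule Bochner_Integration.integrable_bound[of M "\<lambda>\<omega>. C\<^sup>2 * (norm (\<xi> \<omega>))\<^sup>2"]) (use int le in auto)
  have "(\<integral>\<omega>. (norm (L \<omega> (\<xi> \<omega>)))\<^sup>2 \<partial>M) \<le> (\<integral>\<omega>. C\<^sup>2 * (norm (\<xi> \<omega>))\<^sup>2 \<partial>M)"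
    by (rule integral_mono) (use intL int le in auto)
  also have "\<dots> \<le> C\<^sup>2 * K" using \<xi> by (simp add: centered_def mult_left_mono)
  finally have 2: "(\<integral>\<omega>. (norm (L \<omega> (\<xi> \<omega>)))\<^sup>2 \<partial>M) \<le> C\<^sup>2 * K" .
  have "(\<integral>\<omega>. Y \<omega> \<bullet> L \<omega> (\<xi> \<omega>) \<partial>M) = 0"
    if Y: "Y \<in> borel_measurable F" "integrable M (\<lambda>\<omega>. (norm (Y \<omega>))\<^sup>2)" for Y
  proof -
    define Z where "Z \<omega> = (\<Sum>i\<in>Basis. (Y \<omega> \<bullet> L \<omega> i) *\<^sub>R i)" for \<omega>
    note [measurable] = Y(1) L
    have Z[measurable]: "Z \<in> borel_measurable F" unfolding Z_def by measurable
    have inner: "Y \<omega> \<bullet> L \<omega> x = Z \<omega> \<bullet> x" for \<omega> x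
      by (subst blinfun_euclidean_expansion) (simp add: Z_def inner_sum_left inner_sum_right mult.commute inner_commute)
    have "norm (Z \<omega>) \<le> C * norm (Y \<omega>)" for \<omega>
    proof -
      have "(norm (Z \<omega>))\<^sup>2 = Y \<omega> \<bullet> L \<omega> (Z \<omega>)" by (simp add: inner power2_norm_eq_inner)
      also have "\<dots> \<le> norm (Y \<omega>) * norm (L \<omega> (Z \<omega>))" by (rule norm_cauchy_schwarz)
      also have "\<dots> \<le> norm (Y \<omega>) * (C * norm (Z \<omega>))"
        by (intro mult_left_mono order_trans[OF norm_blinfun] mult_right_mono C) auto
      finally have "norm (Z \<omega>) * norm (Z \<omega>) \<le> (C * norm (Y \<omega>)) * norm (Z \<omega>)"
        by (simp add: power2_eq_square mult_ac)
      then show ?thesis using C0 by (cases "Z \<omega> = 0") (auto simp: mult_le_cancel_right)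
    qed
    then have Zle: "(norm (Z \<omega>))\<^sup>2 \<le> C\<^sup>2 * (norm (Y \<omega>))\<^sup>2" for \<omega>
      unfolding power_mult_distrib[symmetric] by (intro power_mono) auto
    have ZM[measurable]: "Z \<in> borel_measurable M" by (rule measurable_from_subalg[OF sub(1) Z])
    have "integrable M (\<lambda>\<omega>. (norm (Z \<omega>))\<^sup>2)"
    proof (rule Bochner_Integration.integrable_bound[of M "\<lambda>\<omega>. C\<^sup>2 * (norm (Y \<omega>))\<^sup>2"])
      show "integrable M (\<lambda>\<omega>. C\<^sup>2 * (norm (Y \<omega>))\<^sup>2)" using Y(2) by simp
      show "(\<lambda>\<omega>. (norm (Z \<omega>))\<^sup>2) \<in> borel_measurable M" using ZM by measurable
      show "AE \<omega> in M. norm ((norm (Z \<omega>))\<^sup>2) \<le> norm (C\<^sup>2 * (norm (Y \<omega>))\<^sup>2)"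
        by (rule AE_I2) (simp add: Zle)
    qed
    then have "(\<integral>\<omega>. Z \<omega> \<bullet> \<xi> \<omega> \<partial>M) = 0" using \<xi> Z by (auto simp: centered_def)
    then show ?thesis by (simp add: inner)
  qed
  with measL intL 2 show ?thesis by (auto simp: centered_def)
qed

text \<open>
  A deterministic inequality behind the \<open>L\<^sup>2\<close> maximal inequality: the sum on the left is a discrete
  stochastic integral, which for a submartingale \<open>s\<close> has nonnegative expectation, and
  \<open>2 R s \<le> R\<^sup>2 / 2 + 2 s\<^sup>2\<close> then removes the mixed term on the right.
\<close>

lemma maximal_inequality_pathwise:
  fixes s :: "nat \<Rightarrow> real"
  assumes "s 0 = 0"
  defines "R \<equiv> \<lambda>k. Max (s ` {..k})"
  shows "(R N)\<^sup>2 + 2 * (\<Sum>k<N. R k * (s (Suc k) - s k)) \<le> 2 * R N * s N"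
proof (induction N)
  case 0
  then show ?case using assms by simp
next
  case (Suc N)
  have "R (Suc N) = max (s (Suc N)) (R N)"
    unfolding R_def by (simp add: atMost_Suc)
  moreover have "(s (Suc N))\<^sup>2 - (R N)\<^sup>2 + 2 * R N * s (Suc N) \<le> 2 * s (Suc N) * s (Suc N)"
    using zero_le_power2[of "s (Suc N) - R N"] by (simp add: power2_eq_square algebra_simps)
  ultimately show ?case using Suc by (auto simp: max_def algebra_simps)
qed

locale centered_increments = prob_space M for M :: "'w measure" +
  fixes F :: "nat \<Rightarrow> 'w measure" and m :: "nat \<Rightarrow> 'w \<Rightarrow> 'b::euclidean_space" and N :: nat and K :: real
  assumes sub: "subalgebra M (F k)" and sub_Suc: "subalgebra (F (Suc k)) (F k)"
    and centered: "k < N \<Longrightarrow> centered M (F k) (F (Suc k)) K (m k)"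
begin

definition "partial k \<omega> = (\<Sum>j<k. m j \<omega>)"
definition "running_max k \<omega> = Max ((\<lambda>j. norm (partial j \<omega>)) ` {..k})"

lemma running_max_0: "running_max 0 \<omega> = 0"
  by (simp add: running_max_def partial_def)

lemma running_max_Suc: "running_max (Suc k) \<omega> = max (norm (partial (Suc k) \<omega>)) (running_max k \<omega>)"
  unfolding running_max_def by (simp add: atMost_Suc)

lemma running_max_nonneg: "0 \<le> running_max k \<omega>"
  by (induction k) (auto simp: running_max_0 running_max_Suc max_def)

lemma partial_props:
  "k \<le> N \<Longrightarrow> partial k \<in> borel_measurable (F k) \<and> integrable M (\<lambda>\<omega>. (norm (partial k \<omega>))\<^sup>2)
    \<and> (\<integral>\<omega>. (norm (partial k \<omega>))\<^sup>2 \<partial>M) \<le> real k * K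
    \<and> running_max k \<in> borel_measurable (F k) \<and> integrable M (\<lambda>\<omega>. (running_max k \<omega>)\<^sup>2)"
proof (induction k)
  case 0
  have "partial 0 = (\<lambda>_. 0)" "running_max 0 = (\<lambda>_. 0)"
    by (simp_all add: fun_eq_iff partial_def running_max_0)
  then show ?case by simp
next
  case (Suc k)
  then have IH: "partial k \<in> borel_measurable (F k)" "integrable M (\<lambda>\<omega>. (norm (partial k \<omega>))\<^sup>2)"
    "(\<integral>\<omega>. (norm (partial k \<omega>))\<^sup>2 \<partial>M) \<le> real k * K" "running_max k \<in> borel_measurable (F k)"
    "integrable M (\<lambda>\<omega>. (running_max k \<omega>)\<^sup>2)"
    and mk: "m k \<in> borel_measurable (F (Suc k))" "integrable M (\<lambda>\<omega>. (norm (m k \<omega>))\<^sup>2)"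
      "(\<integral>\<omega>. (norm (m k \<omega>))\<^sup>2 \<partial>M) \<le> K" "(\<integral>\<omega>. partial k \<omega> \<bullet> m k \<omega> \<partial>M) = 0"
    using centered[of k] by (auto simp: centered_def)
  note [measurable] = mk(1) measurable_from_subalg[OF sub_Suc IH(1)] measurable_from_subalg[OF sub_Suc IH(4)]
  have eq: "partial (Suc k) = (\<lambda>\<omega>. partial k \<omega> + m k \<omega>)" by (auto simp: partial_def)
  have meas: "partial (Suc k) \<in> borel_measurable (F (Suc k))" unfolding eq by measurable
  have measR: "running_max (Suc k) \<in> borel_measurable (F (Suc k))"
    unfolding running_max_Suc[abs_def] using meas by measurable
  note M = measurable_from_subalg[OF sub IH(1)] measurable_from_subalg[OF sub mk(1)]
  have int: "integrable M (\<lambda>\<omega>. (norm (partial (Suc k) \<omega>))\<^sup>2)"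
    unfolding eq by (rule integrable_sq_add[OF M IH(2) mk(2)])
  have "(\<integral>\<omega>. (norm (partial (Suc k) \<omega>))\<^sup>2 \<partial>M)
      = (\<integral>\<omega>. (norm (partial k \<omega>))\<^sup>2 + 2 * (partial k \<omega> \<bullet> m k \<omega>) + (norm (m k \<omega>))\<^sup>2 \<partial>M)"
    by (simp add: eq power2_norm_eq_inner inner_simps inner_commute algebra_simps)
  also have "\<dots> = (\<integral>\<omega>. (norm (partial k \<omega>))\<^sup>2 \<partial>M) + 2 * 0 + (\<integral>\<omega>. (norm (m k \<omega>))\<^sup>2 \<partial>M)"
    using integrable_inner_L2[OF M IH(2) mk(2)] IH(2) mk(2) mk(4) by simp
  also have "\<dots> \<le> real (Suc k) * K" using IH(3) mk(3) by (simp add: algebra_simps)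
  finally have var: "(\<integral>\<omega>. (norm (partial (Suc k) \<omega>))\<^sup>2 \<partial>M) \<le> real (Suc k) * K" .
  have "integrable M (\<lambda>\<omega>. (running_max (Suc k) \<omega>)\<^sup>2)"
  proof (rule Bochner_Integration.integrable_bound[of M "\<lambda>\<omega>. (norm (partial (Suc k) \<omega>))\<^sup>2 + (running_max k \<omega>)\<^sup>2"])
    show "(\<lambda>\<omega>. (running_max (Suc k) \<omega>)\<^sup>2) \<in> borel_measurable M"
      using measurable_from_subalg[OF sub measR] by measurable
  qed (use int IH(5) in \<open>auto simp: running_max_Suc max_def\<close>)
  with meas measR int var show ?case by blast
qed

text \<open>
  With \<open>s\<close> the norm of the partial sums, its increment is bounded below by the inner product of \<open>m k\<close> with the
  direction of the partial sum.  Multiplied by the running maximum, that direction is a test vector known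
  before \<open>m k\<close>, so the expectation of the product vanishes.
\<close>

theorem maximal_inequality:
  "integrable M (\<lambda>\<omega>. (running_max N \<omega>)\<^sup>2)"
  "(\<integral>\<omega>. (running_max N \<omega>)\<^sup>2 \<partial>M) \<le> 4 * (real N * K)"
proof -
  let ?s = "\<lambda>k \<omega>. norm (partial k \<omega>)"
  let ?Y = "\<lambda>k \<omega>. running_max k \<omega> *\<^sub>R sgn (partial k \<omega>)"
  note props = partial_props[THEN conjunct1] partial_props[THEN conjunct2, THEN conjunct1]
    partial_props[THEN conjunct2, THEN conjunct2, THEN conjunct1]
    partial_props[THEN conjunct2, THEN conjunct2, THEN conjunct2, THEN conjunct1]
    partial_props[THEN conjunct2, THEN conjunct2, THEN conjunct2, THEN conjunct2]
  show int: "integrable M (\<lambda>\<omega>. (running_max N \<omega>)\<^sup>2)" by (rule props(5)) simp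
  have Y: "(\<integral>\<omega>. ?Y k \<omega> \<bullet> m k \<omega> \<partial>M) = 0" "integrable M (\<lambda>\<omega>. ?Y k \<omega> \<bullet> m k \<omega>)" if k: "k < N" for k
  proof -
    have [measurable]: "partial k \<in> borel_measurable (F k)" "running_max k \<in> borel_measurable (F k)"
      using k by (auto intro: props)
    have meas: "?Y k \<in> borel_measurable (F k)" by measurable
    have L2: "integrable M (\<lambda>\<omega>. (norm (?Y k \<omega>))\<^sup>2)"
    proof (rule Bochner_Integration.integrable_bound[OF props(5)[of k]])
      show "(\<lambda>\<omega>. (norm (?Y k \<omega>))\<^sup>2) \<in> borel_measurable M"
        using measurable_from_subalg[OF sub meas] by measurable
    qed (use k in \<open>auto simp: norm_sgn\<close>)
    show "(\<integral>\<omega>. ?Y k \<omega> \<bullet> m k \<omega> \<partial>M) = 0"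
      by (rule centered_orthogonal[OF centered[OF k] meas L2])
    show "integrable M (\<lambda>\<omega>. ?Y k \<omega> \<bullet> m k \<omega>)"
      using centered[OF k] unfolding centered_def
      by (intro integrable_inner_L2 L2 measurable_from_subalg[OF sub meas]) (auto intro: measurable_from_subalg[OF sub])
  qed
  \<comment> \<open>The pathwise inequality, with the mixed term absorbed.\<close>
  have pw: "(running_max N \<omega>)\<^sup>2 + 4 * (\<Sum>k<N. ?Y k \<omega> \<bullet> m k \<omega>) \<le> 4 * (?s N \<omega>)\<^sup>2" for \<omega>
  proof -
    have "?Y k \<omega> \<bullet> m k \<omega> \<le> running_max k \<omega> * (?s (Suc k) \<omega> - ?s k \<omega>)" for k
    proof -
      have "sgn (partial k \<omega>) \<bullet> m k \<omega> = sgn (partial k \<omega>) \<bullet> partial (Suc k) \<omega> - ?s k \<omega>"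
      proof -
        have "sgn (partial k \<omega>) \<bullet> partial k \<omega> = ?s k \<omega>"
          by (cases "partial k \<omega> = 0")
             (simp_all add: sgn_div_norm power2_norm_eq_inner[symmetric] power2_eq_square)
        then show ?thesis by (simp add: partial_def inner_simps)
      qed
      also have "sgn (partial k \<omega>) \<bullet> partial (Suc k) \<omega> \<le> norm (sgn (partial k \<omega>)) * ?s (Suc k) \<omega>"
        by (rule norm_cauchy_schwarz)
      also have "\<dots> \<le> 1 * ?s (Suc k) \<omega>" by (intro mult_right_mono) (auto simp: norm_sgn)
      finally have "sgn (partial k \<omega>) \<bullet> m k \<omega> \<le> ?s (Suc k) \<omega> - ?s k \<omega>" by simp
      from mult_left_mono[OF this running_max_nonneg[of k \<omega>]] show ?thesis by simp
    qed
    then have "(\<Sum>k<N. ?Y k \<omega> \<bullet> m k \<omega>) \<le> (\<Sum>k<N. running_max k \<omega> * (?s (Suc k) \<omega> - ?s k \<omega>))"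
      by (intro sum_mono)
    with maximal_inequality_pathwise[of "\<lambda>k. ?s k \<omega>" N]
    have "(running_max N \<omega>)\<^sup>2 + 2 * (\<Sum>k<N. ?Y k \<omega> \<bullet> m k \<omega>) \<le> 2 * running_max N \<omega> * ?s N \<omega>"
      unfolding running_max_def by (simp add: partial_def)
    moreover have "4 * running_max N \<omega> * ?s N \<omega> \<le> (running_max N \<omega>)\<^sup>2 + 4 * (?s N \<omega>)\<^sup>2"
      using zero_le_power2[of "running_max N \<omega> - 2 * ?s N \<omega>"] by (simp add: power2_diff power_mult_distrib)
    ultimately show ?thesis by simp
  qed
  have sum_int: "integrable M (\<lambda>\<omega>. 4 * (\<Sum>k<N. ?Y k \<omega> \<bullet> m k \<omega>))"
    by (intro integrable_mult_right Bochner_Integration.integrable_sum Y(2)) simp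
  have "(\<integral>\<omega>. (\<Sum>k<N. ?Y k \<omega> \<bullet> m k \<omega>) \<partial>M) = 0"
    by (subst Bochner_Integration.integral_sum) (use Y in \<open>auto intro!: sum.neutral simp del: inner_scaleR_left\<close>)
  then have "(\<integral>\<omega>. (running_max N \<omega>)\<^sup>2 \<partial>M) = (\<integral>\<omega>. (running_max N \<omega>)\<^sup>2 + 4 * (\<Sum>k<N. ?Y k \<omega> \<bullet> m k \<omega>) \<partial>M)"
    by (subst Bochner_Integration.integral_add[OF int sum_int]) simp
  also have "\<dots> \<le> (\<integral>\<omega>. 4 * (?s N \<omega>)\<^sup>2 \<partial>M)"
    by (intro integral_mono Bochner_Integration.integrable_add int sum_int integrable_mult_right props(2) pw) simp
  also have "\<dots> \<le> 4 * (real N * K)" using props(3)[of N] by simp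
  finally show "(\<integral>\<omega>. (running_max N \<omega>)\<^sup>2 \<partial>M) \<le> 4 * (real N * K)" .
qed

end

text \<open>
  Integrating the squared distance of \<open>\<phi>\<close> from its mean value \<open>I / l\<close> gives a nonnegative number.
\<close>

lemma Cauchy_Schwarz_integral_interval:
  fixes \<phi> :: "real \<Rightarrow> 'b::euclidean_space"
  assumes "a \<le> b" and \<phi>: "continuous_on {a..b} \<phi>"
  shows "(norm (integral {a..b} \<phi>))\<^sup>2 \<le> (b - a) * integral {a..b} (\<lambda>r. (norm (\<phi> r))\<^sup>2)"
proof (cases "a = b")
  case False
  define l where "l = b - a"
  define I where "I = integral {a..b} \<phi>"
  have l: "0 < l" using False assms by (simp add: l_def)
  have i\<phi>: "(\<phi> has_integral I) {a..b}"
    unfolding I_def by (intro integrable_integral integrable_continuous_real \<phi>)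
  have i2: "((\<lambda>r. (norm (\<phi> r))\<^sup>2) has_integral integral {a..b} (\<lambda>r. (norm (\<phi> r))\<^sup>2)) {a..b}"
    by (intro integrable_integral integrable_continuous_real continuous_intros \<phi>)
  have "((\<lambda>r. (norm (\<phi> r))\<^sup>2 - (2 / l) * (\<phi> r \<bullet> I) + (norm I / l)\<^sup>2) has_integral
      (integral {a..b} (\<lambda>r. (norm (\<phi> r))\<^sup>2) - (2 / l) * (I \<bullet> I) + (b - a) *\<^sub>R (norm I / l)\<^sup>2)) {a..b}"
    using has_integral_linear[OF i\<phi> bounded_linear_inner_left[of I]] has_integral_const_real[of "(norm I / l)\<^sup>2" a b] assms(1)
    by (intro has_integral_add has_integral_diff i2 has_integral_mult_right) (auto simp: o_def)
  moreover have "0 \<le> (norm (\<phi> r))\<^sup>2 - (2 / l) * (\<phi> r \<bullet> I) + (norm I / l)\<^sup>2" for r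
  proof -
    have "0 \<le> (norm (\<phi> r - (1 / l) *\<^sub>R I))\<^sup>2" by simp
    also have "\<dots> = (norm (\<phi> r))\<^sup>2 - (2 / l) * (\<phi> r \<bullet> I) + (norm I / l)\<^sup>2"
      unfolding power2_norm_eq_inner power_divide by (simp add: inner_simps inner_commute power2_eq_square algebra_simps)
    finally show ?thesis .
  qed
  ultimately have "0 \<le> integral {a..b} (\<lambda>r. (norm (\<phi> r))\<^sup>2) - (2 / l) * (I \<bullet> I) + (b - a) *\<^sub>R (norm I / l)\<^sup>2"
    by (rule has_integral_nonneg)
  then have "0 \<le> integral {a..b} (\<lambda>r. (norm (\<phi> r))\<^sup>2) - (norm I)\<^sup>2 / l"
    using l by (simp add: l_def[symmetric] power2_norm_eq_inner[symmetric] power_divide power2_eq_square field_simps)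
  then show ?thesis using l by (simp add: I_def l_def field_simps)
qed simp

section \<open>Brownian motion\<close>

lemma borel_measurable_vec_nth[measurable (raw)]:
  fixes X :: "'w \<Rightarrow> real ^ 'n"
  assumes "X \<in> borel_measurable M" shows "(\<lambda>\<omega>. X \<omega> $ j) \<in> borel_measurable M"
  by (rule measurable_compose[OF assms]) (intro borel_measurable_continuous_onI continuous_intros)

locale brownian =
  fixes M :: "'w measure" and F :: "real \<Rightarrow> 'w measure" and W :: "real \<Rightarrow> 'w \<Rightarrow> real ^ 'n"
  assumes bm: "brownian_motion M F W"
begin

sublocale prob_space M
  using bm by (simp add: brownian_motion_def)

lemma subalgebra_F: "subalgebra M (F t)"
  using bm by (simp add: brownian_motion_def)

lemma subalgebra_F_mono: "s \<le> t \<Longrightarrow> subalgebra (F t) (F s)"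
  using bm by (auto simp: brownian_motion_def subalgebra_def filtration_def)

lemma W_measurable: "0 \<le> t \<Longrightarrow> t \<le> t' \<Longrightarrow> W t \<in> borel_measurable (F t')"
  using bm by (simp add: brownian_motion_def measurable_from_subalg[OF subalgebra_F_mono])

lemma W_measurable_M: "0 \<le> t \<Longrightarrow> W t \<in> borel_measurable M"
  by (rule measurable_from_subalg[OF subalgebra_F W_measurable]) auto

lemma AE_W_0: "AE \<omega> in M. W 0 \<omega> = 0"
  using bm by (simp add: brownian_motion_def)

lemma AE_continuous: "AE \<omega> in M. continuous_on {0..} (\<lambda>t. W t \<omega>)"
  using bm by (simp add: brownian_motion_def)

lemma increment_component_moments:
  assumes "0 \<le> s" "s < t"
  shows "integrable M (\<lambda>\<omega>. (W t \<omega> $ j - W s \<omega> $ j)\<^sup>2)"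
    "expectation (\<lambda>\<omega>. (W t \<omega> $ j - W s \<omega> $ j)\<^sup>2) = t - s"
    "integrable M (\<lambda>\<omega>. W t \<omega> $ j - W s \<omega> $ j)"
    "expectation (\<lambda>\<omega>. W t \<omega> $ j - W s \<omega> $ j) = 0"
proof -
  let ?X = "\<lambda>\<omega>. W t \<omega> $ j - W s \<omega> $ j"
  have D: "distributed M lborel ?X (normal_density 0 (sqrt (t - s)))"
    using bm assms by (simp add: brownian_motion_def)
  have pos: "0 < sqrt (t - s)" using assms by simp
  show E: "expectation ?X = 0" by (rule normal_distributed_expectation[OF pos D])
  have "expectation (\<lambda>\<omega>. (?X \<omega> - expectation ?X)\<^sup>2) = (sqrt (t - s))\<^sup>2"
    by (rule normal_distributed_variance[OF pos D])
  then show V: "expectation (\<lambda>\<omega>. (?X \<omega>)\<^sup>2) = t - s" unfolding E using assms by simp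
  show int: "integrable M (\<lambda>\<omega>. (?X \<omega>)\<^sup>2)"
    using V not_integrable_integral_eq[of M "\<lambda>\<omega>. (?X \<omega>)\<^sup>2"] assms by auto
  have "?X \<in> borel_measurable M"
  proof -
    have [measurable]: "W t \<in> borel_measurable M" "W s \<in> borel_measurable M"
      using assms by (auto intro!: W_measurable_M)
    show ?thesis by measurable
  qed
  then show "integrable M ?X" using int by (rule square_integrable_imp_integrable)
qed

text \<open>
  Independence of the increment from \<open>F s\<close> factorizes the expectation.
\<close>

lemma increment_orthogonal:
  assumes st: "0 \<le> s" "s < t" and Y: "Y \<in> borel_measurable (F s)" "integrable M (Y :: _ \<Rightarrow> real)"
  shows "expectation (\<lambda>\<omega>. Y \<omega> * (W t \<omega> $ j - W s \<omega> $ j)) = 0"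
proof -
  let ?X = "\<lambda>\<omega>. W t \<omega> $ j - W s \<omega> $ j"
  have ind: "indep_set (sets (F s)) (sets (vimage_algebra (space M) (\<lambda>\<omega>. W t \<omega> - W s \<omega>) borel))"
    using bm st by (simp add: brownian_motion_def)
  have [measurable]: "W t \<in> borel_measurable M" "W s \<in> borel_measurable M"
    using st by (auto intro: W_measurable_M)
  have YM: "Y \<in> borel_measurable M" by (rule measurable_from_subalg[OF subalgebra_F Y(1)])
  have spF: "space (F s) = space M" using subalgebra_F by (simp add: subalgebra_def)
  have "indep_var borel Y borel ?X"
    unfolding indep_var_eq
  proof (intro conjI)
    show "indep_set (sigma_sets (space M) {Y -` A \<inter> space M |A. A \<in> sets borel})
        (sigma_sets (space M) {?X -` A \<inter> space M |A. A \<in> sets borel})"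
      unfolding indep_set_def
    proof (rule indep_sets_mono_sets[OF ind[unfolded indep_set_def]])
      fix i :: bool
      have "sigma_sets (space M) {Y -` A \<inter> space M |A. A \<in> sets borel} \<subseteq> sets (F s)"
        unfolding spF[symmetric] using measurable_sets[OF Y(1)] by (intro sets.sigma_sets_subset) auto
      moreover have "sigma_sets (space M) {?X -` A \<inter> space M |A. A \<in> sets borel}
          \<subseteq> sets (vimage_algebra (space M) (\<lambda>\<omega>. W t \<omega> - W s \<omega>) borel)"
      proof -
        let ?V = "vimage_algebra (space M) (\<lambda>\<omega>. W t \<omega> - W s \<omega>) borel"
        have "(\<lambda>\<omega>. W t \<omega> - W s \<omega>) \<in> measurable ?V borel"
          by (rule measurable_vimage_algebra1) auto
        then have "(\<lambda>\<omega>. (W t \<omega> - W s \<omega>) $ j) \<in> measurable ?V borel" by measurable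
        then have "?X -` A \<inter> space M \<in> sets ?V" if "A \<in> sets borel" for A
          using measurable_sets[OF _ that, of _ ?V] by simp
        then have "sigma_sets (space ?V) {?X -` A \<inter> space M |A. A \<in> sets borel} \<subseteq> sets ?V"
          by (intro sets.sigma_sets_subset) auto
        then show ?thesis by simp
      qed
      ultimately show "(case i of True \<Rightarrow> sigma_sets (space M) {Y -` A \<inter> space M |A. A \<in> sets borel}
            | False \<Rightarrow> sigma_sets (space M) {?X -` A \<inter> space M |A. A \<in> sets borel})
          \<subseteq> (case i of True \<Rightarrow> sets (F s)
            | False \<Rightarrow> sets (vimage_algebra (space M) (\<lambda>\<omega>. W t \<omega> - W s \<omega>) borel))"
        by (auto split: bool.split)
    qed
  qed (use YM in auto)
  from indep_var_lebesgue_integral[OF this Y(2) increment_component_moments(3)[OF st]]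
  show ?thesis using increment_component_moments(4)[OF st] by simp
qed

lemma norm_sq_components: "(norm (y :: real ^ 'n))\<^sup>2 = (\<Sum>j\<in>UNIV. (y $ j)\<^sup>2)"
  unfolding power2_norm_eq_inner inner_vec_def by (simp add: power2_eq_square)

lemma increment_norm_moment:
  assumes "0 \<le> s" "0 \<le> t"
  shows "integrable M (\<lambda>\<omega>. (norm (W t \<omega> - W s \<omega>))\<^sup>2)"
    "expectation (\<lambda>\<omega>. (norm (W t \<omega> - W s \<omega>))\<^sup>2) = real CARD('n) * \<bar>t - s\<bar>"
proof -
  have *: "integrable M (\<lambda>\<omega>. (norm (W b \<omega> - W a \<omega>))\<^sup>2) \<and>
      expectation (\<lambda>\<omega>. (norm (W b \<omega> - W a \<omega>))\<^sup>2) = real CARD('n) * \<bar>b - a\<bar>" if "0 \<le> a" "a < b" for a b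
    unfolding norm_sq_components using increment_component_moments[OF that] that by simp
  consider "s < t" | "t < s" | "s = t" by linarith
  then have "integrable M (\<lambda>\<omega>. (norm (W t \<omega> - W s \<omega>))\<^sup>2) \<and>
      expectation (\<lambda>\<omega>. (norm (W t \<omega> - W s \<omega>))\<^sup>2) = real CARD('n) * \<bar>t - s\<bar>"
  proof cases
    case 1 then show ?thesis using * assms by blast
  next
    case 2 then show ?thesis using *[of t s] assms by (simp add: norm_minus_commute abs_minus_commute)
  qed simp
  then show "integrable M (\<lambda>\<omega>. (norm (W t \<omega> - W s \<omega>))\<^sup>2)"
    "expectation (\<lambda>\<omega>. (norm (W t \<omega> - W s \<omega>))\<^sup>2) = real CARD('n) * \<bar>t - s\<bar>" by auto
qed

lemma increment_orthogonal_vec: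
  assumes st: "0 \<le> s" "s \<le> t" and Y: "Y \<in> borel_measurable (F s)" "integrable M (\<lambda>\<omega>. (norm (Y \<omega> :: real ^ 'n))\<^sup>2)"
  shows "expectation (\<lambda>\<omega>. Y \<omega> \<bullet> (W t \<omega> - W s \<omega>)) = 0"
proof (cases "s = t")
  case False
  with st have st': "s < t" by simp
  have YM[measurable]: "Y \<in> borel_measurable M" by (rule measurable_from_subalg[OF subalgebra_F Y(1)])
  have [measurable]: "W t \<in> borel_measurable M" "W s \<in> borel_measurable M"
    using st by (auto intro: W_measurable_M)
  have Y2: "integrable M (\<lambda>\<omega>. (Y \<omega> $ j)\<^sup>2)" for j
  proof (rule Bochner_Integration.integrable_bound[OF Y(2)])
    show "AE \<omega> in M. norm ((Y \<omega> $ j)\<^sup>2) \<le> norm ((norm (Y \<omega>))\<^sup>2)"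
      by (rule AE_I2) (simp add: component_le_norm_cart abs_le_square_iff[symmetric])
  qed simp
  have Y1: "integrable M (\<lambda>\<omega>. Y \<omega> $ j)" for j
    by (rule square_integrable_imp_integrable[OF _ Y2]) simp
  have YF: "(\<lambda>\<omega>. Y \<omega> $ j) \<in> borel_measurable (F s)" for j using Y(1) by measurable
  have "integrable M (\<lambda>\<omega>. Y \<omega> $ j * (W t \<omega> $ j - W s \<omega> $ j))" for j
    using integrable_inner_L2[of "\<lambda>\<omega>. Y \<omega> $ j" M "\<lambda>\<omega>. W t \<omega> $ j - W s \<omega> $ j"]
      Y2 increment_component_moments(1)[OF st(1) st'] by simp
  then show ?thesis
    using increment_orthogonal[OF st(1) st' YF Y1] by (simp add: inner_vec_def)
qed simp

lemma centered_increment: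
  assumes "0 \<le> s" "s \<le> t"
  shows "centered M (F s) (F t) (real CARD('n) * (t - s)) (\<lambda>\<omega>. W t \<omega> - W s \<omega>)"
proof -
  have [measurable]: "W t \<in> borel_measurable (F t)" "W s \<in> borel_measurable (F t)"
    using assms by (auto intro: W_measurable)
  then have "(\<lambda>\<omega>. W t \<omega> - W s \<omega>) \<in> borel_measurable (F t)" by measurable
  then show ?thesis
    using increment_norm_moment[of s t] increment_orthogonal_vec[OF assms] assms unfolding centered_def by auto
qed

text \<open>
  Paths are continuous only almost surely, and the exceptional null set need not belong to \<open>F t\<close>.  The limit
  of the step functions of a path, with the default value of \<open>lim\<close> where it does not exist, is nevertheless
  jointly measurable with respect to \<open>F t\<close>, and time integrals of it are \<open>F t\<close>-measurable.
\<close>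

lemma measurable_version:
  assumes "0 \<le> t"
  obtains L where "L \<in> borel_measurable (F t \<Otimes>\<^sub>M borel)" "AE \<omega> in M. \<forall>r\<in>{0..t}. L (\<omega>, r) = W r \<omega>"
proof -
  define \<rho> where "\<rho> n r = max 0 (min t (real_of_int \<lfloor>r * real (Suc n)\<rfloor> / real (Suc n)))" for n r
  define L where "L q = lim (\<lambda>n. W (\<rho> n (snd q)) (fst q))" for q :: "'w \<times> real"
  have "(\<lambda>q. W (\<rho> n (snd q)) (fst q)) \<in> borel_measurable (F t \<Otimes>\<^sub>M borel)" for n
  proof -
    have "(\<lambda>q. W (max 0 (min t (real_of_int \<lfloor>snd q * real (Suc n)\<rfloor> / real (Suc n)))) (fst q))
      \<in> borel_measurable (F t \<Otimes>\<^sub>M (borel :: real measure))"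
    proof (rule measurable_compose_countable[where f="\<lambda>i q. W (max 0 (min t (real_of_int i / real (Suc n)))) (fst q)"
          and g="\<lambda>q. \<lfloor>snd q * real (Suc n)\<rfloor>"])
      fix i :: int
      have "W (max 0 (min t (real_of_int i / real (Suc n)))) \<in> borel_measurable (F t)"
        using assms by (intro W_measurable) auto
      then show "(\<lambda>q. W (max 0 (min t (real_of_int i / real (Suc n)))) (fst q)) \<in> borel_measurable (F t \<Otimes>\<^sub>M (borel :: real measure))"
        by measurable
    qed measurable
    then show ?thesis by (simp add: \<rho>_def)
  qed
  then have "L \<in> borel_measurable (F t \<Otimes>\<^sub>M borel)"
    unfolding L_def by (rule borel_measurable_lim_metric)
  moreover have "AE \<omega> in M. \<forall>r\<in>{0..t}. L (\<omega>, r) = W r \<omega>"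
    using AE_continuous
  proof eventually_elim
    case (elim \<omega>)
    show ?case
    proof
      fix r assume r: "r \<in> {0..t}"
      have "(\<lambda>n. real_of_int \<lfloor>r * real (Suc n)\<rfloor> / real (Suc n)) \<longlonglongrightarrow> r"
      proof (rule tendsto_sandwich)
        show "\<forall>\<^sub>F n in sequentially. r - 1 / real (Suc n) \<le> real_of_int \<lfloor>r * real (Suc n)\<rfloor> / real (Suc n)"
        proof (intro always_eventually allI)
          fix n
          have "r * real (Suc n) - 1 \<le> real_of_int \<lfloor>r * real (Suc n)\<rfloor>" by linarith
          then have "(r * real (Suc n) - 1) / real (Suc n) \<le> real_of_int \<lfloor>r * real (Suc n)\<rfloor> / real (Suc n)"
            by (rule divide_right_mono) simp
          then show "r - 1 / real (Suc n) \<le> real_of_int \<lfloor>r * real (Suc n)\<rfloor> / real (Suc n)"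
            by (simp add: diff_divide_distrib del: of_nat_Suc)
        qed
        show "\<forall>\<^sub>F n in sequentially. real_of_int \<lfloor>r * real (Suc n)\<rfloor> / real (Suc n) \<le> r"
          by (intro always_eventually allI) (simp add: field_simps del: of_nat_Suc)
        show "(\<lambda>n. r - 1 / real (Suc n)) \<longlonglongrightarrow> r"
          using tendsto_diff[OF tendsto_const[of r] LIMSEQ_inverse_real_of_nat] by (simp add: inverse_eq_divide)
      qed simp
      then have "(\<lambda>n. \<rho> n r) \<longlonglongrightarrow> max 0 (min t r)"
        unfolding \<rho>_def by (intro tendsto_intros)
      then have "(\<lambda>n. \<rho> n r) \<longlonglongrightarrow> r" using r by simp
      then have "(\<lambda>n. W (\<rho> n r) \<omega>) \<longlonglongrightarrow> W r \<omega>"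
        using r by (intro continuous_on_tendsto_compose[OF elim]) (auto simp: \<rho>_def)
      then show "L (\<omega>, r) = W r \<omega>" unfolding L_def by (simp add: limI)
    qed
  qed
  ultimately show thesis by (rule that)
qed

lemma continuous_increment:
  "continuous_on {0..} (\<lambda>t. W t \<omega>) \<Longrightarrow> 0 \<le> c \<Longrightarrow> continuous_on {c..d} (\<lambda>r. W r \<omega> - W e \<omega>)"
  by (intro continuous_intros) (auto elim: continuous_on_subset)

lemma lborel_integral_continuous:
  fixes \<phi> :: "real \<Rightarrow> 'b::euclidean_space"
  assumes "continuous_on {c..d} \<phi>"
  shows "integrable lborel (\<lambda>r. indicator {c..d} r *\<^sub>R \<phi> r)"
    "(\<integral>r. indicator {c..d} r *\<^sub>R \<phi> r \<partial>lborel) = integral {c..d} \<phi>"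
proof -
  show i: "integrable lborel (\<lambda>r. indicator {c..d} r *\<^sub>R \<phi> r)"
    using borel_integrable_atLeastAtMost'[OF assms] by (simp add: set_integrable_def)
  then show "(\<integral>r. indicator {c..d} r *\<^sub>R \<phi> r \<partial>lborel) = integral {c..d} \<phi>"
    using set_borel_integral_eq_integral(2)[of "{c..d}" \<phi>] by (simp add: set_integrable_def set_lebesgue_integral_def)
qed

lemma measurable_pair_subalgebra:
  fixes L :: "'w \<times> real \<Rightarrow> real ^ 'n"
  assumes "L \<in> borel_measurable (F t \<Otimes>\<^sub>M borel)"
  shows "L \<in> borel_measurable (M \<Otimes>\<^sub>M borel)"
proof -
  have "(\<lambda>x. x) \<in> measurable M (F t)"
    using measurable_from_subalg[OF subalgebra_F measurable_ident] by (simp add: id_def)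
  then have "(\<lambda>q. (fst q, snd q)) \<in> measurable (M \<Otimes>\<^sub>M borel) (F t \<Otimes>\<^sub>M (borel :: real measure))"
    by measurable
  from measurable_compose[OF this assms] show ?thesis by simp
qed

sublocale time: pair_sigma_finite M lborel ..

text \<open>
  The pathwise integral is measurable only up to a null set; \<open>D\<close> is a measurable version, as is needed for
  the additivity of the nonnegative integral.
\<close>

lemma path_increment_version:
  assumes cd: "0 \<le> c" "c \<le> d" "0 \<le> e" and \<rho>: "\<And>r. r \<in> {c..d} \<Longrightarrow> \<bar>r - e\<bar> \<le> \<rho>"
  obtains D where "D \<in> borel_measurable M"
    "AE \<omega> in M. D \<omega> = ennreal (integral {c..d} (\<lambda>r. (norm (W r \<omega> - W e \<omega>))\<^sup>2))"
    "(\<integral>\<^sup>+\<omega>. D \<omega> \<partial>M) \<le> ennreal (real CARD('n) * \<rho> * (d - c))"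
proof -
  obtain L where L: "L \<in> borel_measurable (F (max d e) \<Otimes>\<^sub>M borel)"
    "AE \<omega> in M. \<forall>r\<in>{0..max d e}. L (\<omega>, r) = W r \<omega>"
    by (rule measurable_version[of "max d e"]) (use cd in auto)
  have [measurable]: "L \<in> borel_measurable (M \<Otimes>\<^sub>M borel)" "W e \<in> borel_measurable M"
    using measurable_pair_subalgebra[OF L(1)] W_measurable_M cd by auto
  let ?H = "\<lambda>\<omega> r. indicator {c..d} r * ennreal ((norm (L (\<omega>, r) - W e \<omega>))\<^sup>2)"
  define D where "D \<omega> = (\<integral>\<^sup>+r. ?H \<omega> r \<partial>lborel)" for \<omega>
  have "D \<in> borel_measurable M" unfolding D_def by measurable
  moreover have "AE \<omega> in M. D \<omega> = ennreal (integral {c..d} (\<lambda>r. (norm (W r \<omega> - W e \<omega>))\<^sup>2))"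
    using AE_continuous L(2)
  proof eventually_elim
    case (elim \<omega>)
    let ?\<phi> = "\<lambda>r. (norm (W r \<omega> - W e \<omega>))\<^sup>2"
    have cont: "continuous_on {c..d} ?\<phi>"
      by (intro continuous_intros continuous_increment elim cd)
    have "D \<omega> = (\<integral>\<^sup>+r. ennreal (indicator {c..d} r *\<^sub>R ?\<phi> r) \<partial>lborel)"
      unfolding D_def using elim(2) cd by (intro nn_integral_cong) (auto simp: indicator_def)
    also have "\<dots> = ennreal (\<integral>r. indicator {c..d} r *\<^sub>R ?\<phi> r \<partial>lborel)"
      by (intro nn_integral_eq_integral lborel_integral_continuous cont) simp
    also have "\<dots> = ennreal (integral {c..d} ?\<phi>)"
      by (subst lborel_integral_continuous(2)[OF cont]) simp
    finally show ?case .
  qed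
  moreover have "(\<integral>\<^sup>+\<omega>. D \<omega> \<partial>M) \<le> ennreal (real CARD('n) * \<rho> * (d - c))"
  proof -
    have "(\<integral>\<^sup>+\<omega>. D \<omega> \<partial>M) = (\<integral>\<^sup>+r. \<integral>\<^sup>+\<omega>. ?H \<omega> r \<partial>M \<partial>lborel)"
      unfolding D_def by (rule time.Fubini'[symmetric]) measurable
    also have "\<dots> \<le> (\<integral>\<^sup>+r. indicator {c..d} r * ennreal (real CARD('n) * \<rho>) \<partial>lborel)"
    proof (rule nn_integral_mono)
      fix r :: real
      show "(\<integral>\<^sup>+\<omega>. ?H \<omega> r \<partial>M) \<le> indicator {c..d} r * ennreal (real CARD('n) * \<rho>)"
      proof (cases "r \<in> {c..d}")
        case True
        have "(\<integral>\<^sup>+\<omega>. ?H \<omega> r \<partial>M) = (\<integral>\<^sup>+\<omega>. ennreal ((norm (W r \<omega> - W e \<omega>))\<^sup>2) \<partial>M)"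
          by (rule nn_integral_cong_AE) (use L(2) True cd in \<open>auto elim!: eventually_mono\<close>)
        also have "\<dots> = ennreal (real CARD('n) * \<bar>r - e\<bar>)"
          using increment_norm_moment[of e r] True cd by (subst nn_integral_eq_integral) auto
        also have "\<dots> \<le> ennreal (real CARD('n) * \<rho>)"
          using \<rho>[OF True] by (intro ennreal_leI mult_left_mono) auto
        finally show ?thesis using True by simp
      qed simp
    qed
    also have "\<dots> = ennreal (real CARD('n) * \<rho>) * ennreal (d - c)"
      using cd by (simp add: mult.commute[of "indicator _ _"] nn_integral_cmult_indicator)
    also have "\<dots> = ennreal (real CARD('n) * \<rho> * (d - c))"
      using cd \<rho>[of c] by (intro ennreal_mult[symmetric]) auto
    finally show ?thesis .
  qed
  ultimately show thesis by (rule that)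
qed

lemma nn_integral_path_increment:
  assumes cd: "0 \<le> c" "c \<le> d" "0 \<le> e" and \<rho>: "\<And>r. r \<in> {c..d} \<Longrightarrow> \<bar>r - e\<bar> \<le> \<rho>" and K: "0 \<le> K"
  shows "(\<integral>\<^sup>+\<omega>. ennreal (K * integral {c..d} (\<lambda>r. (norm (W r \<omega> - W e \<omega>))\<^sup>2)) \<partial>M)
    \<le> ennreal (K * (real CARD('n) * \<rho> * (d - c)))"
proof -
  obtain D where D: "D \<in> borel_measurable M"
    "AE \<omega> in M. D \<omega> = ennreal (integral {c..d} (\<lambda>r. (norm (W r \<omega> - W e \<omega>))\<^sup>2))"
    "(\<integral>\<^sup>+\<omega>. D \<omega> \<partial>M) \<le> ennreal (real CARD('n) * \<rho> * (d - c))"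
    by (rule path_increment_version[OF cd \<rho>])
  have "(\<integral>\<^sup>+\<omega>. ennreal (K * integral {c..d} (\<lambda>r. (norm (W r \<omega> - W e \<omega>))\<^sup>2)) \<partial>M) = (\<integral>\<^sup>+\<omega>. ennreal K * D \<omega> \<partial>M)"
    by (rule nn_integral_cong_AE, use D(2) in eventually_elim) (simp add: ennreal_mult' K)
  also have "\<dots> = ennreal K * (\<integral>\<^sup>+\<omega>. D \<omega> \<partial>M)" by (rule nn_integral_cmult[OF D(1)])
  also have "\<dots> \<le> ennreal K * ennreal (real CARD('n) * \<rho> * (d - c))" by (intro mult_left_mono D(3)) simp
  also have "\<dots> = ennreal (K * (real CARD('n) * \<rho> * (d - c)))" using K by (simp add: ennreal_mult')
  finally show ?thesis .
qed

text \<open>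
  Both \<open>I\<close> (\<open>g = 1\<close>) and \<open>J\<close> (\<open>g\<close> the time left until the end of the step) have this form.
  By Fubini, orthogonality to the past passes from the single increments \<open>W r - W s\<close> to the integral; the
  second moment follows from the Cauchy-Schwarz inequality in time.
\<close>

lemma centered_weighted_integral:
  fixes g :: "real \<Rightarrow> real"
  assumes st: "0 \<le> s" "s \<le> t" and g: "continuous_on UNIV g" "\<And>r. r \<in> {s..t} \<Longrightarrow> \<bar>g r\<bar> \<le> C"
  obtains \<xi> where "centered M (F s) (F t) (real CARD('n) * C\<^sup>2 * (t - s) ^ 3) \<xi>"
    "AE \<omega> in M. \<xi> \<omega> = integral {s..t} (\<lambda>r. g r *\<^sub>R (W r \<omega> - W s \<omega>))"
proof -
  define q where "q \<omega> = integral {s..t} (\<lambda>r. (norm (W r \<omega> - W s \<omega>))\<^sup>2)" for \<omega>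
  obtain L where L: "L \<in> borel_measurable (F t \<Otimes>\<^sub>M borel)" "AE \<omega> in M. \<forall>r\<in>{0..t}. L (\<omega>, r) = W r \<omega>"
    by (rule measurable_version[of t]) (use st in auto)
  have Lm[measurable]: "L \<in> borel_measurable (M \<Otimes>\<^sub>M borel)" "W s \<in> borel_measurable M"
    using measurable_pair_subalgebra[OF L(1)] W_measurable_M st by auto
  have gm[measurable]: "g \<in> borel_measurable borel" by (rule borel_measurable_continuous_onI[OF g(1)])
  have C: "0 \<le> C" using g(2)[of s] st by (auto intro: order_trans[OF abs_ge_zero])
  define H where "H \<omega> r = indicator {s..t} r *\<^sub>R (g r *\<^sub>R (L (\<omega>, r) - W s \<omega>))" for \<omega> r
  define \<xi> where "\<xi> \<omega> = (\<integral>r. H \<omega> r \<partial>lborel)" for \<omega>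
  have HM[measurable]: "case_prod H \<in> borel_measurable (M \<Otimes>\<^sub>M lborel)"
    unfolding H_def by measurable
  have \<xi>F: "\<xi> \<in> borel_measurable (F t)"
  proof -
    have [measurable]: "L \<in> borel_measurable (F t \<Otimes>\<^sub>M borel)" "W s \<in> borel_measurable (F t)"
      using L(1) W_measurable st by auto
    have "case_prod H \<in> borel_measurable (F t \<Otimes>\<^sub>M lborel)"
      unfolding H_def by measurable
    then show ?thesis unfolding \<xi>_def by (intro lborel.borel_measurable_lebesgue_integral)
  qed
  have path: "AE \<omega> in M. integrable lborel (H \<omega>) \<and> \<xi> \<omega> = integral {s..t} (\<lambda>r. g r *\<^sub>R (W r \<omega> - W s \<omega>))
      \<and> (norm (\<xi> \<omega>))\<^sup>2 \<le> (t - s) * C\<^sup>2 * q \<omega>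
      \<and> (\<integral>\<^sup>+r. ennreal ((norm (H \<omega> r))\<^sup>2) \<partial>lborel) \<le> ennreal (C\<^sup>2 * q \<omega>)"
    using AE_continuous L(2)
  proof eventually_elim
    case (elim \<omega>)
    let ?\<phi> = "\<lambda>r. g r *\<^sub>R (W r \<omega> - W s \<omega>)"
    have cW: "continuous_on {s..t} (\<lambda>r. W r \<omega> - W s \<omega>)" by (intro continuous_increment elim st)
    have c\<phi>: "continuous_on {s..t} ?\<phi>"
      by (intro continuous_on_scaleR cW continuous_on_subset[OF g(1)]) auto
    have H: "H \<omega> = (\<lambda>r. indicator {s..t} r *\<^sub>R ?\<phi> r)"
      using elim(2) st by (auto simp: H_def indicator_def fun_eq_iff)
    have le: "integral {s..t} (\<lambda>r. (norm (?\<phi> r))\<^sup>2) \<le> C\<^sup>2 * q \<omega>"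
    proof -
      have "integral {s..t} (\<lambda>r. (norm (?\<phi> r))\<^sup>2) \<le> integral {s..t} (\<lambda>r. C\<^sup>2 * (norm (W r \<omega> - W s \<omega>))\<^sup>2)"
      proof (rule integral_le)
        show "(norm (?\<phi> r))\<^sup>2 \<le> C\<^sup>2 * (norm (W r \<omega> - W s \<omega>))\<^sup>2" if "r \<in> {s..t}" for r
          using g(2)[OF that] C unfolding norm_scaleR power_mult_distrib by (intro mult_right_mono power_mono) auto
      qed (intro integrable_continuous_real continuous_intros c\<phi> cW)+
      then show ?thesis by (simp add: q_def)
    qed
    have nonneg: "0 \<le> q \<omega>"
      unfolding q_def by (intro integral_nonneg integrable_continuous_real continuous_intros cW) auto
    have 1: "\<xi> \<omega> = integral {s..t} ?\<phi>"
      unfolding \<xi>_def H by (rule lborel_integral_continuous(2)[OF c\<phi>])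
    have "(norm (\<xi> \<omega>))\<^sup>2 \<le> (t - s) * integral {s..t} (\<lambda>r. (norm (?\<phi> r))\<^sup>2)"
      unfolding 1 by (rule Cauchy_Schwarz_integral_interval[OF st(2) c\<phi>])
    also have "\<dots> \<le> (t - s) * (C\<^sup>2 * q \<omega>)"
      using st by (intro mult_left_mono le) auto
    finally have 2: "(norm (\<xi> \<omega>))\<^sup>2 \<le> (t - s) * C\<^sup>2 * q \<omega>" by (simp add: mult.assoc)
    have cn: "continuous_on {s..t} (\<lambda>r. (norm (?\<phi> r))\<^sup>2)" by (intro continuous_intros c\<phi>)
    have "(\<integral>\<^sup>+r. ennreal ((norm (H \<omega> r))\<^sup>2) \<partial>lborel) = (\<integral>\<^sup>+r. ennreal (indicator {s..t} r *\<^sub>R (norm (?\<phi> r))\<^sup>2) \<partial>lborel)"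
      unfolding H by (intro nn_integral_cong) (auto simp: indicator_def)
    also have "\<dots> = ennreal (integral {s..t} (\<lambda>r. (norm (?\<phi> r))\<^sup>2))"
      using lborel_integral_continuous[OF cn] by (subst nn_integral_eq_integral) auto
    finally have 3: "(\<integral>\<^sup>+r. ennreal ((norm (H \<omega> r))\<^sup>2) \<partial>lborel) \<le> ennreal (C\<^sup>2 * q \<omega>)"
      using le by (simp add: ennreal_leI)
    show ?case using 1 2 3 lborel_integral_continuous(1)[OF c\<phi>] unfolding H by blast
  qed
  have moment: "(\<integral>\<^sup>+\<omega>. ennreal (K * q \<omega>) \<partial>M)
      \<le> ennreal (K * (real CARD('n) * (t - s) * (t - s)))" if K: "0 \<le> K" for K
    unfolding q_def using nn_integral_path_increment[of s t s "t - s" K] st K by auto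
  have \<xi>M[measurable]: "\<xi> \<in> borel_measurable M" by (rule measurable_from_subalg[OF subalgebra_F \<xi>F])
  have nn\<xi>: "(\<integral>\<^sup>+\<omega>. ennreal ((norm (\<xi> \<omega>))\<^sup>2) \<partial>M) \<le> ennreal (real CARD('n) * C\<^sup>2 * (t - s) ^ 3)"
  proof -
    have "(\<integral>\<^sup>+\<omega>. ennreal ((norm (\<xi> \<omega>))\<^sup>2) \<partial>M)
        \<le> (\<integral>\<^sup>+\<omega>. ennreal (((t - s) * C\<^sup>2) * q \<omega>) \<partial>M)"
      by (rule nn_integral_mono_AE, use path in eventually_elim) (elim conjE, rule ennreal_leI)
    also have "\<dots> \<le> ennreal (((t - s) * C\<^sup>2) * (real CARD('n) * (t - s) * (t - s)))"
      using st by (intro moment) auto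
    finally show ?thesis by (simp add: power3_eq_cube mult_ac)
  qed
  have \<xi>2: "integrable M (\<lambda>\<omega>. (norm (\<xi> \<omega>))\<^sup>2)"
    by (rule integrableI_bounded) (use nn\<xi> in \<open>auto intro: le_less_trans\<close>)
  have "ennreal (\<integral>\<omega>. (norm (\<xi> \<omega>))\<^sup>2 \<partial>M) \<le> ennreal (real CARD('n) * C\<^sup>2 * (t - s) ^ 3)"
    using nn\<xi> by (subst nn_integral_eq_integral[OF \<xi>2, symmetric]) auto
  then have \<xi>2': "(\<integral>\<omega>. (norm (\<xi> \<omega>))\<^sup>2 \<partial>M) \<le> real CARD('n) * C\<^sup>2 * (t - s) ^ 3"
    using st by (subst (asm) ennreal_le_iff) auto
  have H2: "integrable (M \<Otimes>\<^sub>M lborel) (\<lambda>q. (norm (case_prod H q))\<^sup>2)"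
  proof (rule integrableI_bounded)
    have "(\<integral>\<^sup>+q. ennreal (norm ((norm (case_prod H q))\<^sup>2)) \<partial>(M \<Otimes>\<^sub>M lborel))
        = (\<integral>\<^sup>+\<omega>. \<integral>\<^sup>+r. ennreal ((norm (H \<omega> r))\<^sup>2) \<partial>lborel \<partial>M)"
      by (subst lborel.nn_integral_fst[symmetric]) auto
    also have "\<dots> \<le> (\<integral>\<^sup>+\<omega>. ennreal (C\<^sup>2 * q \<omega>) \<partial>M)"
      by (rule nn_integral_mono_AE, use path in eventually_elim) simp
    also have "\<dots> \<le> ennreal (C\<^sup>2 * (real CARD('n) * (t - s) * (t - s)))" by (rule moment) simp
    also have "\<dots> < \<infinity>" by simp
    finally show "(\<integral>\<^sup>+q. ennreal (norm ((norm (case_prod H q))\<^sup>2)) \<partial>(M \<Otimes>\<^sub>M lborel)) < \<infinity>" .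
  qed measurable
  have "(\<integral>\<omega>. Y \<omega> \<bullet> \<xi> \<omega> \<partial>M) = 0"
    if Y: "Y \<in> borel_measurable (F s)" "integrable M (\<lambda>\<omega>. (norm (Y \<omega>))\<^sup>2)" for Y
  proof -
    have YM[measurable]: "Y \<in> borel_measurable M" by (rule measurable_from_subalg[OF subalgebra_F Y(1)])
    have Y2: "integrable (M \<Otimes>\<^sub>M lborel) (\<lambda>q. (norm (Y (fst q)))\<^sup>2 * indicator {s..t} (snd q))"
    proof (rule integrableI_bounded)
      have "(\<integral>\<^sup>+q. ennreal (norm ((norm (Y (fst q)))\<^sup>2 * indicator {s..t} (snd q))) \<partial>(M \<Otimes>\<^sub>M lborel))
        = (\<integral>\<^sup>+\<omega>. \<integral>\<^sup>+r. ennreal ((norm (Y \<omega>))\<^sup>2) * indicator {s..t} r \<partial>lborel \<partial>M)"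
        by (subst lborel.nn_integral_fst[symmetric]) (auto simp: indicator_def intro!: nn_integral_cong)
      also have "\<dots> = (\<integral>\<^sup>+\<omega>. ennreal ((norm (Y \<omega>))\<^sup>2) * ennreal (t - s) \<partial>M)"
        using st by (simp add: nn_integral_cmult_indicator)
      also have "\<dots> = ennreal (\<integral>\<omega>. (norm (Y \<omega>))\<^sup>2 \<partial>M) * ennreal (t - s)"
        by (subst nn_integral_multc) (auto simp: nn_integral_eq_integral[OF Y(2)])
      also have "\<dots> < \<infinity>" by (simp add: ennreal_mult_less_top)
      finally show "(\<integral>\<^sup>+q. ennreal (norm ((norm (Y (fst q)))\<^sup>2 * indicator {s..t} (snd q))) \<partial>(M \<Otimes>\<^sub>M lborel)) < \<infinity>" .
    qed measurable
    have YH: "integrable (M \<Otimes>\<^sub>M lborel) (\<lambda>(\<omega>, r). Y \<omega> \<bullet> H \<omega> r)"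
    proof (rule Bochner_Integration.integrable_bound)
      show "integrable (M \<Otimes>\<^sub>M lborel) (\<lambda>q. (norm (Y (fst q)))\<^sup>2 * indicator {s..t} (snd q) + (norm (case_prod H q))\<^sup>2)"
        by (intro Bochner_Integration.integrable_add Y2 H2)
      show "AE q in M \<Otimes>\<^sub>M lborel. norm (case q of (\<omega>, r) \<Rightarrow> Y \<omega> \<bullet> H \<omega> r)
          \<le> norm ((norm (Y (fst q)))\<^sup>2 * indicator {s..t} (snd q) + (norm (case_prod H q))\<^sup>2)"
      proof (rule AE_I2)
        fix q :: "'w \<times> real"
        obtain \<omega> r where q[simp]: "q = (\<omega>, r)" by force
        show "norm (case q of (\<omega>, r) \<Rightarrow> Y \<omega> \<bullet> H \<omega> r)
          \<le> norm ((norm (Y (fst q)))\<^sup>2 * indicator {s..t} (snd q) + (norm (case_prod H q))\<^sup>2)"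
        proof (cases "r \<in> {s..t}")
          case True
          have "\<bar>Y \<omega> \<bullet> H \<omega> r\<bar> \<le> norm (Y \<omega>) * norm (H \<omega> r)" by (rule Cauchy_Schwarz_ineq2)
          moreover have "2 * (norm (Y \<omega>) * norm (H \<omega> r)) \<le> (norm (Y \<omega>))\<^sup>2 + (norm (H \<omega> r))\<^sup>2"
            using zero_le_power2[of "norm (Y \<omega>) - norm (H \<omega> r)"] by (simp add: power2_diff)
          moreover have "0 \<le> norm (Y \<omega>) * norm (H \<omega> r)" by simp
          ultimately have "\<bar>Y \<omega> \<bullet> H \<omega> r\<bar> \<le> (norm (Y \<omega>))\<^sup>2 + (norm (H \<omega> r))\<^sup>2" by linarith
          then show ?thesis using True by simp
        qed (simp add: H_def)
      qed
    qed measurable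
    have inner0: "(\<integral>\<omega>. Y \<omega> \<bullet> H \<omega> r \<partial>M) = 0" for r
    proof (cases "r \<in> {s..t}")
      case True
      have "(\<integral>\<omega>. Y \<omega> \<bullet> H \<omega> r \<partial>M) = (\<integral>\<omega>. g r * (Y \<omega> \<bullet> (W r \<omega> - W s \<omega>)) \<partial>M)"
      proof (rule integral_cong_AE)
        have "W r \<in> borel_measurable M" using True st by (intro W_measurable_M) auto
        then show "(\<lambda>\<omega>. g r * (Y \<omega> \<bullet> (W r \<omega> - W s \<omega>))) \<in> borel_measurable M" by measurable
        show "AE \<omega> in M. Y \<omega> \<bullet> H \<omega> r = g r * (Y \<omega> \<bullet> (W r \<omega> - W s \<omega>))"
          using L(2) by eventually_elim (use True st in \<open>auto simp: H_def\<close>)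
      qed (unfold H_def, measurable)
      also have "\<dots> = 0"
        using increment_orthogonal_vec[of s r Y] True st Y by simp
      finally show ?thesis .
    qed (simp add: H_def)
    have "(\<integral>\<omega>. Y \<omega> \<bullet> \<xi> \<omega> \<partial>M) = (\<integral>\<omega>. \<integral>r. Y \<omega> \<bullet> H \<omega> r \<partial>lborel \<partial>M)"
    proof (rule integral_cong_AE)
      show "AE \<omega> in M. Y \<omega> \<bullet> \<xi> \<omega> = (\<integral>r. Y \<omega> \<bullet> H \<omega> r \<partial>lborel)"
        using path by eventually_elim (simp add: \<xi>_def)
    qed measurable
    also have "\<dots> = (\<integral>r. \<integral>\<omega>. Y \<omega> \<bullet> H \<omega> r \<partial>M \<partial>lborel)"
      by (rule time.Fubini_integral[symmetric, OF YH])
    also have "\<dots> = 0" by (simp add: inner0)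
    finally show ?thesis .
  qed
  then have "centered M (F s) (F t) (real CARD('n) * C\<^sup>2 * (t - s) ^ 3) \<xi>"
    using \<xi>F \<xi>2 \<xi>2' by (auto simp: centered_def)
  moreover have "AE \<omega> in M. \<xi> \<omega> = integral {s..t} (\<lambda>r. g r *\<^sub>R (W r \<omega> - W s \<omega>))"
    using path by eventually_elim auto
  ultimately show thesis by (rule that)
qed

end

context brownian
begin

text \<open>
  The maximal inequality bounds the maximum over a uniform grid with \<open>n + 1\<close> cells by a constant independent
  of \<open>n\<close>.  By Fatou's lemma the lower limit over \<open>n\<close> is integrable, and by continuity it dominates the path,
  as each time is a limit of grid points.
\<close>

lemma running_bound:
  assumes "0 < T"
  obtains S where "S \<in> borel_measurable M" "integrable M (\<lambda>\<omega>. (S \<omega>)\<^sup>2)"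
    "AE \<omega> in M. \<forall>t\<in>{0..T}. norm (W t \<omega>) \<le> S \<omega>"
proof -
  define \<delta> where "\<delta> n = T / real (Suc n)" for n
  have \<delta>: "0 < \<delta> n" "real (Suc n) * \<delta> n = T" for n using assms by (auto simp: \<delta>_def)
  define m where "m n k \<omega> = W (real (Suc k) * \<delta> n) \<omega> - W (real k * \<delta> n) \<omega>" for n k \<omega>
  have ci: "centered_increments M (\<lambda>k. F (real k * \<delta> n)) (m n) (Suc n) (real CARD('n) * \<delta> n)" for n
  proof
    fix k
    show "subalgebra M (F (real k * \<delta> n))" by (rule subalgebra_F)
    have le: "real k * \<delta> n \<le> real (Suc k) * \<delta> n" using \<delta>(1)[of n] by (simp add: algebra_simps)
    then show "subalgebra (F (real (Suc k) * \<delta> n)) (F (real k * \<delta> n))" by (rule subalgebra_F_mono)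
    have "real CARD('n) * (real (Suc k) * \<delta> n - real k * \<delta> n) = real CARD('n) * \<delta> n"
      by (simp add: algebra_simps)
    then show "centered M (F (real k * \<delta> n)) (F (real (Suc k) * \<delta> n)) (real CARD('n) * \<delta> n) (m n k)"
      using centered_increment[OF _ le] \<delta>(1)[of n] unfolding m_def by (simp del: of_nat_Suc)
  qed
  define g where "g n \<omega> = centered_increments.running_max (m n) (Suc n) \<omega>" for n \<omega>
  have g: "g n \<in> borel_measurable M" "(\<integral>\<^sup>+\<omega>. ennreal ((g n \<omega>)\<^sup>2) \<partial>M) \<le> ennreal (4 * real CARD('n) * T)" for n
  proof -
    interpret c: centered_increments M "\<lambda>k. F (real k * \<delta> n)" "m n" "Suc n" "real CARD('n) * \<delta> n" by (rule ci)
    have "c.running_max (Suc n) \<in> borel_measurable (F (real (Suc n) * \<delta> n))"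
      using c.partial_props[of "Suc n"] by simp
    then show "g n \<in> borel_measurable M"
      unfolding g_def by (rule measurable_from_subalg[OF subalgebra_F])
    have "(\<integral>\<^sup>+\<omega>. ennreal ((g n \<omega>)\<^sup>2) \<partial>M) = ennreal (\<integral>\<omega>. (g n \<omega>)\<^sup>2 \<partial>M)"
      unfolding g_def by (intro nn_integral_eq_integral c.maximal_inequality) simp
    also have "\<dots> \<le> ennreal (4 * (real (Suc n) * (real CARD('n) * \<delta> n)))"
      unfolding g_def by (intro ennreal_leI c.maximal_inequality)
    also have "4 * (real (Suc n) * (real CARD('n) * \<delta> n)) = 4 * real CARD('n) * T"
      using \<delta>(2)[of n] by (metis mult.assoc mult.left_commute)
    finally show "(\<integral>\<^sup>+\<omega>. ennreal ((g n \<omega>)\<^sup>2) \<partial>M) \<le> ennreal (4 * real CARD('n) * T)" .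
  qed
  note [measurable] = g(1)
  have grid: "norm (W (real k * \<delta> n) \<omega> - W 0 \<omega>) \<le> g n \<omega>" if "k \<le> Suc n" for k n \<omega>
  proof -
    interpret c: centered_increments M "\<lambda>k. F (real k * \<delta> n)" "m n" "Suc n" "real CARD('n) * \<delta> n" by (rule ci)
    have "c.partial k \<omega> = W (real k * \<delta> n) \<omega> - W 0 \<omega>"
      unfolding c.partial_def m_def by (subst sum_lessThan_telescope) simp
    moreover have "norm (c.partial k \<omega>) \<le> g n \<omega>"
      unfolding g_def c.running_max_def using that by (intro Max_ge) auto
    ultimately show ?thesis by simp
  qed
  define Z where "Z \<omega> = liminf (\<lambda>n. ennreal ((g n \<omega>)\<^sup>2))" for \<omega>
  have Z[measurable]: "Z \<in> borel_measurable M" unfolding Z_def by measurable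
  have "(\<integral>\<^sup>+\<omega>. Z \<omega> \<partial>M) \<le> liminf (\<lambda>n. \<integral>\<^sup>+\<omega>. ennreal ((g n \<omega>)\<^sup>2) \<partial>M)"
    unfolding Z_def by (rule nn_integral_liminf) measurable
  also have "\<dots> \<le> liminf (\<lambda>n::nat. ennreal (4 * real CARD('n) * T))"
    by (rule Liminf_mono) (simp add: g(2))
  also have "\<dots> = ennreal (4 * real CARD('n) * T)" by (simp add: Liminf_const)
  finally have Zint: "(\<integral>\<^sup>+\<omega>. Z \<omega> \<partial>M) < \<infinity>" using le_less_trans by fastforce
  then have Zfin: "AE \<omega> in M. Z \<omega> \<noteq> \<infinity>" by (intro nn_integral_PInf_AE) auto
  define S where "S \<omega> = sqrt (enn2real (Z \<omega>))" for \<omega>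
  have [measurable]: "S \<in> borel_measurable M" unfolding S_def by measurable
  have "integrable M (\<lambda>\<omega>. (S \<omega>)\<^sup>2)"
  proof (rule integrableI_bounded)
    have "(\<integral>\<^sup>+\<omega>. ennreal (norm ((S \<omega>)\<^sup>2)) \<partial>M) = (\<integral>\<^sup>+\<omega>. Z \<omega> \<partial>M)"
      by (rule nn_integral_cong_AE, use Zfin in eventually_elim) (simp add: S_def less_top)
    then show "(\<integral>\<^sup>+\<omega>. ennreal (norm ((S \<omega>)\<^sup>2)) \<partial>M) < \<infinity>" using Zint by simp
  qed measurable
  moreover have "AE \<omega> in M. \<forall>t\<in>{0..T}. norm (W t \<omega>) \<le> S \<omega>"
    using AE_continuous AE_W_0 Zfin
  proof eventually_elim
    case (elim \<omega>)
    show ?case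
    proof
      fix t assume t: "t \<in> {0..T}"
      define k where "k n = nat \<lfloor>t / \<delta> n\<rfloor>" for n
      have kreal: "real (k n) = real_of_int \<lfloor>t / \<delta> n\<rfloor>" for n
        using t \<delta>(1)[of n] by (simp add: k_def)
      have k1: "real (k n) * \<delta> n \<le> t" "t - \<delta> n \<le> real (k n) * \<delta> n" for n
      proof -
        have "real (k n) \<le> t / \<delta> n" "t / \<delta> n - 1 \<le> real (k n)" unfolding kreal by linarith+
        then show "real (k n) * \<delta> n \<le> t" "t - \<delta> n \<le> real (k n) * \<delta> n"
          using \<delta>(1)[of n] by (auto simp: field_simps)
      qed
      have k2: "k n \<le> Suc n" for n
      proof -
        have "real (k n) * \<delta> n \<le> real (Suc n) * \<delta> n" using k1(1)[of n] t \<delta>(2)[of n] by simp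
        then show ?thesis using \<delta>(1)[of n] by (simp del: of_nat_Suc)
      qed
      have "(\<lambda>n. T * inverse (real (Suc n))) \<longlonglongrightarrow> T * 0"
        by (intro tendsto_mult tendsto_const LIMSEQ_inverse_real_of_nat)
      then have "\<delta> \<longlonglongrightarrow> 0" by (simp add: \<delta>_def[abs_def] divide_inverse del: of_nat_Suc)
      then have "(\<lambda>n. t - \<delta> n) \<longlonglongrightarrow> t" using tendsto_diff[OF tendsto_const[of t]] by force
      then have "(\<lambda>n. real (k n) * \<delta> n) \<longlonglongrightarrow> t"
        by (rule tendsto_sandwich[OF _ _ _ tendsto_const[of t], rotated 2]) (auto simp: k1)
      then have "(\<lambda>n. W (real (k n) * \<delta> n) \<omega>) \<longlonglongrightarrow> W t \<omega>"
        using t \<delta>(1) by (intro continuous_on_tendsto_compose[OF elim(1)]) (auto simp: less_imp_le)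
      then have "(\<lambda>n. ennreal ((norm (W (real (k n) * \<delta> n) \<omega>))\<^sup>2)) \<longlonglongrightarrow> ennreal ((norm (W t \<omega>))\<^sup>2)"
        by (intro tendsto_ennrealI tendsto_intros)
      then have "ennreal ((norm (W t \<omega>))\<^sup>2) = liminf (\<lambda>n. ennreal ((norm (W (real (k n) * \<delta> n) \<omega>))\<^sup>2))"
        by (intro lim_imp_Liminf[symmetric]) auto
      also have "\<dots> \<le> Z \<omega>"
        unfolding Z_def using grid[OF k2, of _ \<omega>] elim(2)
        by (intro Liminf_mono always_eventually allI ennreal_leI power_mono) auto
      finally have "(norm (W t \<omega>))\<^sup>2 \<le> enn2real (Z \<omega>)"
        using elim(3) by (subst (asm) ennreal_enn2real[symmetric]) (auto simp: less_top)
      then show "norm (W t \<omega>) \<le> S \<omega>" unfolding S_def by (rule real_le_rsqrt)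
    qed
  qed
  ultimately show thesis using that \<open>S \<in> borel_measurable M\<close> by blast
qed

section \<open>The stochastic integral in \<open>\<Delta>U\<close>\<close>

text \<open>
  Summation by parts turns the left-endpoint sums into \<open>(b - a) (W b - W a)\<close> minus a right-endpoint Riemann
  sum of \<open>W - W a\<close>.  The error on a cell is the integral of \<open>W - W (s (Suc i))\<close>, which is controlled by the
  Cauchy-Schwarz inequality in time and over the cells, and whose second moment tends to zero with the mesh.
\<close>

lemma has_wiener_integral_offset:
  assumes ab: "0 \<le> a" "a \<le> b"
  obtains I where "has_wiener_integral M (\<lambda>t \<omega>. W t \<omega> $ j) (\<lambda>t. t - a) a b I"
    "AE \<omega> in M. I \<omega> = (b - a) * (W b \<omega> $ j - W a \<omega> $ j) - integral {a..b} (\<lambda>r. W r \<omega> $ j - W a \<omega> $ j)"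
proof -
  obtain \<xi> where \<xi>: "centered M (F a) (F b) (real CARD('n) * 1\<^sup>2 * (b - a) ^ 3) \<xi>"
    "AE \<omega> in M. \<xi> \<omega> = integral {a..b} (\<lambda>r. 1 *\<^sub>R (W r \<omega> - W a \<omega>))"
    by (rule centered_weighted_integral[OF ab, of "\<lambda>_. 1" 1]) auto
  define I where "I \<omega> = (b - a) * (W b \<omega> $ j - W a \<omega> $ j) - \<xi> \<omega> $ j" for \<omega>
  have [measurable]: "W b \<in> borel_measurable M" "W a \<in> borel_measurable M" "\<xi> \<in> borel_measurable M"
    using ab \<xi>(1) by (auto intro!: W_measurable_M simp: centered_def intro: measurable_from_subalg[OF subalgebra_F])
  have IM: "I \<in> borel_measurable M" unfolding I_def by measurable
  have I: "AE \<omega> in M. I \<omega> = (b - a) * (W b \<omega> $ j - W a \<omega> $ j) - integral {a..b} (\<lambda>r. W r \<omega> $ j - W a \<omega> $ j)"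
    using \<xi>(2) AE_continuous
  proof eventually_elim
    case (elim \<omega>)
    have "((\<lambda>r. W r \<omega> - W a \<omega>) has_integral \<xi> \<omega>) {a..b}"
      unfolding elim(1) scaleR_one using elim(2) ab
      by (intro integrable_integral integrable_continuous_real continuous_increment)
    from has_integral_linear[OF this bounded_linear_vec_nth[of j]]
    have "((\<lambda>r. W r \<omega> $ j - W a \<omega> $ j) has_integral \<xi> \<omega> $ j) {a..b}" by (simp add: o_def)
    then show ?case unfolding I_def by (simp add: integral_unique)
  qed
  have "has_wiener_integral M (\<lambda>t \<omega>. W t \<omega> $ j) (\<lambda>t. t - a) a b I"
    unfolding has_wiener_integral_def
  proof (intro conjI allI impI)
    show "I \<in> borel_measurable M" by (rule IM)
    fix \<epsilon> :: real assume \<epsilon>: "0 < \<epsilon>"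
    define \<kappa> where "\<kappa> = (b - a)\<^sup>2 * real CARD('n)"
    define \<delta> where "\<delta> = \<epsilon> / (\<kappa> + 1)"
    have \<kappa>: "0 \<le> \<kappa>" unfolding \<kappa>_def by simp
    have \<delta>: "0 < \<delta>" "\<kappa> * \<delta> < \<epsilon>"
      using \<epsilon> \<kappa> by (auto simp: \<delta>_def field_simps)
    show "\<exists>\<delta>>0. \<forall>(m::nat) s. s 0 = a \<and> s m = b \<and> (\<forall>i<m. s i \<le> s (Suc i) \<and> s (Suc i) - s i < \<delta>) \<longrightarrow>
        (\<integral>\<^sup>+\<omega>. ennreal (((\<Sum>i<m. (s i - a) * (W (s (Suc i)) \<omega> $ j - W (s i) \<omega> $ j)) - I \<omega>)\<^sup>2) \<partial>M) < ennreal \<epsilon>"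
    proof (intro exI[of _ \<delta>] conjI allI impI \<delta>(1))
      fix m :: nat and s :: "nat \<Rightarrow> real"
      assume "s 0 = a \<and> s m = b \<and> (\<forall>i<m. s i \<le> s (Suc i) \<and> s (Suc i) - s i < \<delta>)"
      then have s: "s 0 = a" "s m = b" "\<And>i. i < m \<Longrightarrow> s i \<le> s (Suc i)" "\<And>i. i < m \<Longrightarrow> s (Suc i) - s i < \<delta>" by auto
      have sa: "a \<le> s i" if "i \<le> m" for i
        using that by (induction i) (use s in \<open>auto intro: order_trans\<close>)
      define good where "good i D \<longleftrightarrow> D \<in> borel_measurable M \<and>
          (AE \<omega> in M. D \<omega> = ennreal (integral {s i..s (Suc i)} (\<lambda>r. (norm (W r \<omega> - W (s (Suc i)) \<omega>))\<^sup>2))) \<and>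
          (\<integral>\<^sup>+\<omega>. D \<omega> \<partial>M) \<le> ennreal (real CARD('n) * \<delta> * (s (Suc i) - s i))" for i D
      have "\<exists>D. i < m \<longrightarrow> good i D" for i
      proof (cases "i < m")
        case i: True
        have "0 \<le> s i" "s i \<le> s (Suc i)" "0 \<le> s (Suc i)" using sa[of i] sa[of "Suc i"] s(3)[OF i] ab i by auto
        then show ?thesis
          by (rule path_increment_version[of _ _ _ \<delta>]) (use s(4)[OF i] in \<open>auto simp: good_def\<close>)
      qed simp
      then have "\<exists>D. \<forall>i. i < m \<longrightarrow> good i (D i)" by (intro choice allI)
      then obtain D where D: "\<And>i. i < m \<Longrightarrow> D i \<in> borel_measurable M"
        "\<And>i. i < m \<Longrightarrow> AE \<omega> in M. D i \<omega> = ennreal (integral {s i..s (Suc i)} (\<lambda>r. (norm (W r \<omega> - W (s (Suc i)) \<omega>))\<^sup>2))"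
        "\<And>i. i < m \<Longrightarrow> (\<integral>\<^sup>+\<omega>. D i \<omega> \<partial>M) \<le> ennreal (real CARD('n) * \<delta> * (s (Suc i) - s i))"
        unfolding good_def by blast
      have D': "AE \<omega> in M. \<forall>i\<in>{..<m}. D i \<omega> = ennreal (integral {s i..s (Suc i)} (\<lambda>r. (norm (W r \<omega> - W (s (Suc i)) \<omega>))\<^sup>2))"
        by (intro AE_finite_allI D) auto
      have "AE \<omega> in M. ennreal (((\<Sum>i<m. (s i - a) * (W (s (Suc i)) \<omega> $ j - W (s i) \<omega> $ j)) - I \<omega>)\<^sup>2)
          \<le> ennreal (b - a) * (\<Sum>i<m. D i \<omega>)"
        using AE_continuous I D'
      proof eventually_elim
        case (elim \<omega>)
        let ?B = "\<lambda>r. W r \<omega> $ j"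
        let ?R = "\<lambda>i. integral {s i..s (Suc i)} (\<lambda>r. ?B r - ?B (s (Suc i)))"
        let ?d = "\<lambda>i. integral {s i..s (Suc i)} (\<lambda>r. (norm (W r \<omega> - W (s (Suc i)) \<omega>))\<^sup>2)"
        have cont: "continuous_on {c..d} ?B" if "0 \<le> c" for c d
          by (rule continuous_on_subset[where s="{0..}"]) (use that elim(1) in \<open>auto intro!: continuous_intros\<close>)
        have int: "(\<lambda>r. ?B r - e) integrable_on {c..d}" if "0 \<le> c" for c d e
          by (intro integrable_continuous_real continuous_intros cont that)
        have ident: "(\<Sum>i<k. (s i - a) * (?B (s (Suc i)) - ?B (s i)))
            = (s k - a) * (?B (s k) - ?B a) - integral {a..s k} (\<lambda>r. ?B r - ?B a) + (\<Sum>i<k. ?R i)" if "k \<le> m" for k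
          using that
        proof (induction k)
          case 0 then show ?case by (simp add: s(1))
        next
          case (Suc k)
          have k: "a \<le> s k" "s k \<le> s (Suc k)" "0 \<le> s k" using sa[of k] s(3)[of k] Suc.prems ab by auto
          have 1: "integral {a..s (Suc k)} (\<lambda>r. ?B r - ?B a)
              = integral {a..s k} (\<lambda>r. ?B r - ?B a) + integral {s k..s (Suc k)} (\<lambda>r. ?B r - ?B a)"
            by (rule Henstock_Kurzweil_Integration.integral_combine[symmetric, OF k(1,2) int[OF ab(1)]])
          have 2: "integral {s k..s (Suc k)} (\<lambda>r. ?B r - e) = integral {s k..s (Suc k)} ?B - (s (Suc k) - s k) * e" for e
            using k int[of "s k" 0] by (subst Henstock_Kurzweil_Integration.integral_diff) auto
          show ?case using Suc unfolding sum.lessThan_Suc 1 2 by (simp add: algebra_simps)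
        qed
        have Rd: "(?R i)\<^sup>2 \<le> (s (Suc i) - s i) * ?d i" if i: "i < m" for i
        proof -
          have i0: "0 \<le> s i" using sa[of i] i ab by simp
          have "(norm (?R i))\<^sup>2 \<le> (s (Suc i) - s i) * integral {s i..s (Suc i)} (\<lambda>r. (norm (?B r - ?B (s (Suc i))))\<^sup>2)"
            by (intro Cauchy_Schwarz_integral_interval s(3)[OF i] continuous_intros cont i0)
          also have "\<dots> \<le> (s (Suc i) - s i) * ?d i"
          proof (intro mult_left_mono integral_le)
            show "(\<lambda>r. (norm (?B r - ?B (s (Suc i))))\<^sup>2) integrable_on {s i..s (Suc i)}"
              by (intro integrable_continuous_real continuous_intros cont i0)
            show "(\<lambda>r. (norm (W r \<omega> - W (s (Suc i)) \<omega>))\<^sup>2) integrable_on {s i..s (Suc i)}"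
              by (intro integrable_continuous_real continuous_intros continuous_increment elim(1) i0)
            fix r show "(norm (?B r - ?B (s (Suc i))))\<^sup>2 \<le> (norm (W r \<omega> - W (s (Suc i)) \<omega>))\<^sup>2"
              using component_le_norm_cart[of "W r \<omega> - W (s (Suc i)) \<omega>" j] by (intro power_mono) auto
          qed (use s(3)[OF i] in simp)
          finally show ?thesis by simp
        qed
        have d0: "0 \<le> ?d i" if "i < m" for i
          using sa[of i] that ab
          by (intro integral_nonneg integrable_continuous_real continuous_intros continuous_increment elim(1)) auto
        have "(\<Sum>i<m. (s i - a) * (?B (s (Suc i)) - ?B (s i))) - I \<omega> = (\<Sum>i<m. ?R i)"
          using ident[of m] s(2) elim(2) by simp
        also have "(\<Sum>i<m. ?R i)\<^sup>2 \<le> (\<Sum>i<m. sqrt (s (Suc i) - s i) * sqrt (?d i))\<^sup>2"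
        proof -
          have "\<bar>\<Sum>i<m. ?R i\<bar> \<le> (\<Sum>i<m. \<bar>?R i\<bar>)" by (rule sum_abs)
          also have "\<dots> \<le> (\<Sum>i<m. sqrt (s (Suc i) - s i) * sqrt (?d i))"
          proof (rule sum_mono)
            fix i assume "i \<in> {..<m}"
            then have "(?R i)\<^sup>2 \<le> (s (Suc i) - s i) * ?d i" using Rd by simp
            then have "sqrt ((?R i)\<^sup>2) \<le> sqrt ((s (Suc i) - s i) * ?d i)" by (rule real_sqrt_le_mono)
            then show "\<bar>?R i\<bar> \<le> sqrt (s (Suc i) - s i) * sqrt (?d i)" by (simp add: real_sqrt_mult)
          qed
          finally show ?thesis by (simp add: abs_le_square_iff[symmetric])
        qed
        also have "\<dots> \<le> (\<Sum>i<m. (sqrt (s (Suc i) - s i))\<^sup>2) * (\<Sum>i<m. (sqrt (?d i))\<^sup>2)"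
          by (rule Cauchy_Schwarz_ineq_sum)
        also have "\<dots> = (\<Sum>i<m. s (Suc i) - s i) * (\<Sum>i<m. ?d i)"
          using s(3) d0 by (intro arg_cong2[of _ _ _ _ "(*)"] sum.cong) auto
        also have "(\<Sum>i<m. s (Suc i) - s i) = b - a" using s by (simp add: sum_lessThan_telescope)
        finally have "ennreal (((\<Sum>i<m. (s i - a) * (?B (s (Suc i)) - ?B (s i))) - I \<omega>)\<^sup>2) \<le> ennreal ((b - a) * (\<Sum>i<m. ?d i))"
          by (rule ennreal_leI)
        also have "\<dots> = ennreal (b - a) * (\<Sum>i<m. ennreal (?d i))"
        proof (subst sum_ennreal)
          show "ennreal ((b - a) * (\<Sum>i<m. ?d i)) = ennreal (b - a) * ennreal (\<Sum>i<m. ?d i)"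
            using ab d0 by (intro ennreal_mult sum_nonneg) auto
        qed (use d0 in auto)
        also have "(\<Sum>i<m. ennreal (?d i)) = (\<Sum>i<m. D i \<omega>)" using elim(3) by (intro sum.cong) auto
        finally show ?case .
      qed
      then have "(\<integral>\<^sup>+\<omega>. ennreal (((\<Sum>i<m. (s i - a) * (W (s (Suc i)) \<omega> $ j - W (s i) \<omega> $ j)) - I \<omega>)\<^sup>2) \<partial>M)
          \<le> (\<integral>\<^sup>+\<omega>. ennreal (b - a) * (\<Sum>i<m. D i \<omega>) \<partial>M)"
        by (rule nn_integral_mono_AE)
      also have "\<dots> = ennreal (b - a) * (\<Sum>i<m. \<integral>\<^sup>+\<omega>. D i \<omega> \<partial>M)"
      proof (subst nn_integral_cmult)
        show "(\<lambda>\<omega>. \<Sum>i<m. D i \<omega>) \<in> borel_measurable M" using D(1) by simp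
        show "ennreal (b - a) * (\<integral>\<^sup>+\<omega>. (\<Sum>i<m. D i \<omega>) \<partial>M) = ennreal (b - a) * (\<Sum>i<m. \<integral>\<^sup>+\<omega>. D i \<omega> \<partial>M)"
          using D(1) by (subst nn_integral_sum) auto
      qed
      also have "\<dots> \<le> ennreal (b - a) * (\<Sum>i<m. ennreal (real CARD('n) * \<delta> * (s (Suc i) - s i)))"
        by (intro mult_left_mono sum_mono D(3)) auto
      also have "\<dots> = ennreal (b - a) * ennreal (\<Sum>i<m. real CARD('n) * \<delta> * (s (Suc i) - s i))"
        using s(3) \<delta>(1) by (subst sum_ennreal) auto
      also have "(\<Sum>i<m. real CARD('n) * \<delta> * (s (Suc i) - s i)) = real CARD('n) * \<delta> * (b - a)"
        using s by (simp add: sum_distrib_left[symmetric] sum_lessThan_telescope)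
      also have "ennreal (b - a) * ennreal (real CARD('n) * \<delta> * (b - a)) = ennreal (\<kappa> * \<delta>)"
        using ab \<delta>(1) by (subst ennreal_mult[symmetric]) (auto simp: \<kappa>_def power2_eq_square mult_ac)
      also have "\<dots> < ennreal \<epsilon>" using \<delta>(2) \<epsilon> \<kappa> \<delta>(1) by (intro ennreal_lessI) auto
      finally show "(\<integral>\<^sup>+\<omega>. ennreal (((\<Sum>i<m. (s i - a) * (W (s (Suc i)) \<omega> $ j - W (s i) \<omega> $ j)) - I \<omega>)\<^sup>2) \<partial>M) < ennreal \<epsilon>" .
    qed
  qed
  then show thesis using I by (rule that)
qed

end

text \<open>
  \<open>wiener_integral\<close> is an arbitrary choice among the mean-square limits; two such limits are both close to the
  sums over a fine uniform partition.
\<close>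

lemma has_wiener_integral_unique:
  assumes I: "has_wiener_integral M B g a b I" and J: "has_wiener_integral M B g a b J" and ab: "a \<le> b"
    and B: "\<And>t. a \<le> t \<Longrightarrow> B t \<in> borel_measurable M"
  shows "AE \<omega> in M. I \<omega> = J \<omega>"
proof -
  have [measurable]: "I \<in> borel_measurable M" "J \<in> borel_measurable M"
    using I J by (auto simp: has_wiener_integral_def)
  have small: "(\<integral>\<^sup>+\<omega>. ennreal ((I \<omega> - J \<omega>)\<^sup>2) \<partial>M) \<le> ennreal (4 * \<epsilon>)" if \<epsilon>: "0 < \<epsilon>" for \<epsilon>
  proof -
    obtain \<delta>1 where \<delta>1: "0 < \<delta>1" "\<And>(m::nat) s. s 0 = a \<Longrightarrow> s m = b \<Longrightarrow> (\<And>i. i < m \<Longrightarrow> s i \<le> s (Suc i) \<and> s (Suc i) - s i < \<delta>1) \<Longrightarrow>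
        (\<integral>\<^sup>+\<omega>. ennreal (((\<Sum>i<m. g (s i) * (B (s (Suc i)) \<omega> - B (s i) \<omega>)) - I \<omega>)\<^sup>2) \<partial>M) < ennreal \<epsilon>"
      using I \<epsilon> unfolding has_wiener_integral_def by meson
    obtain \<delta>2 where \<delta>2: "0 < \<delta>2" "\<And>(m::nat) s. s 0 = a \<Longrightarrow> s m = b \<Longrightarrow> (\<And>i. i < m \<Longrightarrow> s i \<le> s (Suc i) \<and> s (Suc i) - s i < \<delta>2) \<Longrightarrow>
        (\<integral>\<^sup>+\<omega>. ennreal (((\<Sum>i<m. g (s i) * (B (s (Suc i)) \<omega> - B (s i) \<omega>)) - J \<omega>)\<^sup>2) \<partial>M) < ennreal \<epsilon>"
      using J \<epsilon> unfolding has_wiener_integral_def by meson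
    obtain m :: nat where m: "(b - a) / min \<delta>1 \<delta>2 < real m" using reals_Archimedean2 by blast
    have dpos: "0 < min \<delta>1 \<delta>2" using \<delta>1 \<delta>2 by simp
    have m0: "0 < m" using m ab dpos by (cases m) (auto simp: divide_less_0_iff not_less)
    define s where "s i = a + real i * ((b - a) / real m)" for i
    have s: "s 0 = a" "s m = b" "\<And>i. s i \<le> s (Suc i)" "\<And>i. s (Suc i) - s i = (b - a) / real m" "\<And>i. a \<le> s i"
    proof -
      have e: "0 \<le> (b - a) / real m" "real m * ((b - a) / real m) = b - a" using m0 ab by auto
      show "s 0 = a" "s m = b" unfolding s_def e(2) by simp_all
      show "s i \<le> s (Suc i)" "s (Suc i) - s i = (b - a) / real m" "a \<le> s i" for i
        using e(1) mult_nonneg_nonneg[OF of_nat_0_le_iff e(1), of i]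
        unfolding s_def of_nat_Suc distrib_right by linarith+
    qed
    have mesh: "(b - a) / real m < min \<delta>1 \<delta>2" using m m0 dpos
      by (simp only: pos_divide_less_eq of_nat_0_less_iff mult.commute)
    let ?\<Sigma> = "\<lambda>\<omega>. \<Sum>i<m. g (s i) * (B (s (Suc i)) \<omega> - B (s i) \<omega>)"
    have [measurable]: "?\<Sigma> \<in> borel_measurable M" using B s(5) by measurable
    have "(\<integral>\<^sup>+\<omega>. ennreal ((I \<omega> - J \<omega>)\<^sup>2) \<partial>M)
        \<le> (\<integral>\<^sup>+\<omega>. 2 * ennreal ((?\<Sigma> \<omega> - I \<omega>)\<^sup>2) + 2 * ennreal ((?\<Sigma> \<omega> - J \<omega>)\<^sup>2) \<partial>M)"
    proof (rule nn_integral_mono)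
      fix \<omega>
      have "(I \<omega> - J \<omega>)\<^sup>2 \<le> 2 * (?\<Sigma> \<omega> - I \<omega>)\<^sup>2 + 2 * (?\<Sigma> \<omega> - J \<omega>)\<^sup>2"
      proof -
        have "(i - j)\<^sup>2 \<le> 2 * (p - i)\<^sup>2 + 2 * (p - j)\<^sup>2" for i j p :: real
          using zero_le_power2[of "2 * p - i - j"] by (simp add: power2_eq_square algebra_simps)
        then show ?thesis .
      qed
      then have "ennreal ((I \<omega> - J \<omega>)\<^sup>2) \<le> ennreal (2 * (?\<Sigma> \<omega> - I \<omega>)\<^sup>2 + 2 * (?\<Sigma> \<omega> - J \<omega>)\<^sup>2)" by (rule ennreal_leI)
      then show "ennreal ((I \<omega> - J \<omega>)\<^sup>2) \<le> 2 * ennreal ((?\<Sigma> \<omega> - I \<omega>)\<^sup>2) + 2 * ennreal ((?\<Sigma> \<omega> - J \<omega>)\<^sup>2)"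
        by (simp add: ennreal_plus ennreal_mult del: ennreal_plus[symmetric])
    qed
    also have "\<dots> = 2 * (\<integral>\<^sup>+\<omega>. ennreal ((?\<Sigma> \<omega> - I \<omega>)\<^sup>2) \<partial>M) + 2 * (\<integral>\<^sup>+\<omega>. ennreal ((?\<Sigma> \<omega> - J \<omega>)\<^sup>2) \<partial>M)"
      by (simp add: nn_integral_add nn_integral_cmult)
    also have "\<dots> \<le> 2 * ennreal \<epsilon> + 2 * ennreal \<epsilon>"
      using \<delta>1(2)[OF s(1,2)] \<delta>2(2)[OF s(1,2)] s(3,4) mesh
      by (intro add_mono mult_left_mono) (auto simp: less_imp_le)
    also have "\<dots> = ennreal (4 * \<epsilon>)"
      using \<epsilon> by (simp add: ennreal_mult flip: distrib_right)
    finally show ?thesis .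
  qed
  have "(\<integral>\<^sup>+\<omega>. ennreal ((I \<omega> - J \<omega>)\<^sup>2) \<partial>M) \<le> 0"
  proof (rule ennreal_le_epsilon)
    fix e :: real assume "0 < e"
    with small[of "e / 4"] show "(\<integral>\<^sup>+\<omega>. ennreal ((I \<omega> - J \<omega>)\<^sup>2) \<partial>M) \<le> 0 + ennreal e" by simp
  qed
  then have "(\<integral>\<^sup>+\<omega>. ennreal ((I \<omega> - J \<omega>)\<^sup>2) \<partial>M) = 0" by simp
  then have "AE \<omega> in M. ennreal ((I \<omega> - J \<omega>)\<^sup>2) = 0" by (subst (asm) nn_integral_0_iff_AE) auto
  then show ?thesis by eventually_elim simp
qed

context brownian
begin

text \<open>
  Here the stochastic integral is eliminated, and everything else can be done path by path.
\<close>

lemma delta_U_eq: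
  assumes h: "0 < h"
  shows "AE \<omega> in M. delta_U M W h k \<omega> = (h / 2) *\<^sub>R (W (real (Suc k) * h) \<omega> - W (real k * h) \<omega>)
    - integral {real k * h..real (Suc k) * h} (\<lambda>r. W r \<omega> - W (real k * h) \<omega>)"
proof -
  let ?a = "real k * h" and ?b = "real (Suc k) * h"
  have ab: "0 \<le> ?a" "?a \<le> ?b" "?b - ?a = h" using h by (auto simp: algebra_simps)
  have "AE \<omega> in M. wiener_integral M (\<lambda>t \<omega>. W t \<omega> $ j) (\<lambda>t. t - ?a) ?a ?b \<omega>
      = h * (W ?b \<omega> $ j - W ?a \<omega> $ j) - integral {?a..?b} (\<lambda>r. W r \<omega> $ j - W ?a \<omega> $ j)" for j
  proof -
    obtain I where I: "has_wiener_integral M (\<lambda>t \<omega>. W t \<omega> $ j) (\<lambda>t. t - ?a) ?a ?b I"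
      "AE \<omega> in M. I \<omega> = (?b - ?a) * (W ?b \<omega> $ j - W ?a \<omega> $ j) - integral {?a..?b} (\<lambda>r. W r \<omega> $ j - W ?a \<omega> $ j)"
      by (rule has_wiener_integral_offset[OF ab(1,2)])
    have "has_wiener_integral M (\<lambda>t \<omega>. W t \<omega> $ j) (\<lambda>t. t - ?a) ?a ?b (wiener_integral M (\<lambda>t \<omega>. W t \<omega> $ j) (\<lambda>t. t - ?a) ?a ?b)"
      unfolding wiener_integral_def by (rule someI[of _ I]) (rule I(1))
    from has_wiener_integral_unique[OF this I(1) ab(2)]
    have "AE \<omega> in M. wiener_integral M (\<lambda>t \<omega>. W t \<omega> $ j) (\<lambda>t. t - ?a) ?a ?b \<omega> = I \<omega>"
      using ab(1) by (simp add: W_measurable_M borel_measurable_vec_nth)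
    with I(2) show ?thesis unfolding ab(3) by eventually_elim simp
  qed
  then have "AE \<omega> in M. \<forall>j\<in>UNIV. wiener_integral M (\<lambda>t \<omega>. W t \<omega> $ j) (\<lambda>t. t - ?a) ?a ?b \<omega>
      = h * (W ?b \<omega> $ j - W ?a \<omega> $ j) - integral {?a..?b} (\<lambda>r. W r \<omega> $ j - W ?a \<omega> $ j)"
    by (intro AE_finite_allI) auto
  with AE_continuous show ?thesis
  proof eventually_elim
    case (elim \<omega>)
    have "integral {?a..?b} (\<lambda>r. W r \<omega> - W ?a \<omega>) $ j = integral {?a..?b} (\<lambda>r. W r \<omega> $ j - W ?a \<omega> $ j)" for j
    proof -
      have "((\<lambda>r. W r \<omega> - W ?a \<omega>) has_integral integral {?a..?b} (\<lambda>r. W r \<omega> - W ?a \<omega>)) {?a..?b}"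
        using elim(1) ab(1) by (intro integrable_integral integrable_continuous_real continuous_increment)
      from has_integral_linear[OF this bounded_linear_vec_nth[of j]] show ?thesis
        by (simp add: o_def integral_unique)
    qed
    then show ?case
      unfolding delta_U_def using elim(2) by (simp add: vec_eq_iff algebra_simps del: of_nat_Suc)
  qed
qed

end

section \<open>From local defects to strong order\<close>

lemma discrete_gronwall:
  fixes e :: "nat \<Rightarrow> real"
  assumes "\<And>k. k \<le> N \<Longrightarrow> e k \<le> a + c * (\<Sum>j<k. e j)" "0 \<le> a" "0 \<le> c" "k \<le> N"
  shows "e k \<le> a * exp (c * real N)"
proof -
  have "a + c * (\<Sum>j<k. e j) \<le> a * (1 + c) ^ k" using assms(4)
  proof (induction k)
    case (Suc k)
    then have "c * e k \<le> c * (a + c * (\<Sum>j<k. e j))" using assms(1,3) by (intro mult_left_mono) auto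
    then have "a + c * (\<Sum>j<Suc k. e j) \<le> (1 + c) * (a + c * (\<Sum>j<k. e j))"
      by (simp add: algebra_simps)
    also have "\<dots> \<le> (1 + c) * (a * (1 + c) ^ k)"
      using Suc assms(3) by (intro mult_left_mono) auto
    finally show ?case by (simp add: mult_ac)
  qed simp
  also have "\<dots> \<le> a * exp c ^ k"
    using assms(2,3) by (intro mult_left_mono power_mono exp_ge_add_one_self) auto
  also have "exp c ^ k = exp (c * real k)" by (simp add: exp_of_nat_mult[symmetric] mult.commute)
  also have "a * \<dots> \<le> a * exp (c * real N)"
    using assms(2-4) by (intro mult_left_mono) (auto intro: mult_left_mono)
  finally show ?thesis using assms(1)[OF assms(4)] by linarith
qed

context brownian
begin

text \<open>
  The integrals \<open>I\<close> and \<open>J\<close> of a path need not be measurable on the null set of discontinuous paths, so only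
  an almost sure version is required to be centered.
\<close>

definition step_noise :: "real \<Rightarrow> nat \<Rightarrow> real \<Rightarrow> ('w \<Rightarrow> 'b::euclidean_space) \<Rightarrow> bool" where
  "step_noise h k K X \<longleftrightarrow> (\<exists>\<xi>. centered M (F (real k * h)) (F (real (Suc k) * h)) K \<xi> \<and>
     (AE \<omega> in M. \<xi> \<omega> = X \<omega>))"

text \<open>
  The defects are allowed to hold only up to null sets depending on \<open>h\<close>, since for fixed \<open>h\<close> just finitely many
  steps occur.  The expected running maximum \<open>R\<close> of the martingale is obtained from its second moment by
  \<open>R \<le> h\<^sup>p + R\<^sup>2 / h\<^sup>p\<close>, which is balanced because the second moment is \<open>O(h\<^bsup>2p\<^esup>)\<close>.
\<close>

lemma strong_order_if_defects_small:
  fixes z :: "real \<Rightarrow> 'w \<Rightarrow> 'b::euclidean_space" and \<Phi> :: "real \<Rightarrow> nat \<Rightarrow> 'w \<Rightarrow> 'b \<Rightarrow> 'b"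
    and m :: "real \<Rightarrow> nat \<Rightarrow> 'w \<Rightarrow> 'b"
  assumes T: "0 < T" and \<Delta>: "0 < \<Delta>"
    and S: "integrable M (\<lambda>\<omega>. (S \<omega>)\<^sup>2)"
    and near: "\<And>h k \<omega>. 0 < h \<Longrightarrow> h < \<Delta> \<Longrightarrow> near_translation (C1 * h) (\<Phi> h k \<omega>)" and C1: "0 \<le> C1"
    and defect: "\<And>h k. 0 < h \<Longrightarrow> h < \<Delta> \<Longrightarrow> real (Suc k) * h \<le> T \<Longrightarrow>
      AE \<omega> in M. norm (z (real (Suc k) * h) \<omega> - \<Phi> h k \<omega> (z (real k * h) \<omega>) - m h k \<omega>) \<le> C2 * (h ^ Suc p * (S \<omega>)\<^sup>2)"
    and centered: "\<And>h k. 0 < h \<Longrightarrow> h < \<Delta> \<Longrightarrow> real (Suc k) * h \<le> T \<Longrightarrow>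
      step_noise h k (C3 * h ^ (2 * p + 1)) (m h k)"
  shows "strong_order M T (real p) z (\<lambda>h k \<omega>. iterate_steps (\<lambda>k. \<Phi> h k \<omega>) (z 0 \<omega>) k)"
proof -
  define D where "D = exp (C1 * T) * (1 + 4 * C3 * T + \<bar>C2\<bar> * T * (\<integral>\<omega>. (S \<omega>)\<^sup>2 \<partial>M))"
  have "(\<integral>\<^sup>+\<omega>. (SUP k\<in>{..N}. ennreal (norm (z (real k * h) \<omega> - iterate_steps (\<lambda>k. \<Phi> h k \<omega>) (z 0 \<omega>) k))) \<partial>M)
      \<le> ennreal (D * h powr real p)" if h: "0 < h" "h < \<Delta>" and N: "real N * h = T" for h N
  proof -
    have kN: "real (Suc k) * h \<le> T" if "k < N" for k
      using that h(1) unfolding N[symmetric] by (intro mult_right_mono) auto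
    have "\<forall>k. \<exists>\<xi>. k < N \<longrightarrow> centered M (F (real k * h)) (F (real (Suc k) * h)) (C3 * h ^ (2 * p + 1)) \<xi> \<and> (AE \<omega> in M. \<xi> \<omega> = m h k \<omega>)"
      using centered[OF h kN] unfolding step_noise_def by blast
    from choice[OF this] obtain \<xi> where \<xi>: "\<And>k. k < N \<Longrightarrow> centered M (F (real k * h)) (F (real (Suc k) * h)) (C3 * h ^ (2 * p + 1)) (\<xi> k)"
      "\<And>k. k < N \<Longrightarrow> AE \<omega> in M. \<xi> k \<omega> = m h k \<omega>" by blast
    interpret c: centered_increments M "\<lambda>k. F (real k * h)" \<xi> N "C3 * h ^ (2 * p + 1)"
    proof
      show "subalgebra (F (real (Suc k) * h)) (F (real k * h))" for k
        using h(1) by (intro subalgebra_F_mono mult_right_mono) auto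
    qed (rule subalgebra_F, erule \<xi>(1))
    let ?R = "c.running_max N"
    let ?bound = "\<lambda>\<omega>. exp (C1 * T) * (h ^ p + (?R \<omega>)\<^sup>2 / h ^ p + \<bar>C2\<bar> * T * h ^ p * (S \<omega>)\<^sup>2)"
    have R2: "(\<integral>\<omega>. (?R \<omega>)\<^sup>2 \<partial>M) \<le> 4 * C3 * T * (h ^ p * h ^ p)"
    proof -
      have "4 * (real N * (C3 * h ^ (2 * p + 1))) = 4 * C3 * (real N * h) * (h ^ p * h ^ p)"
        by (simp add: power_add mult_2)
      from c.maximal_inequality(2)[unfolded this N] show ?thesis .
    qed
    have AEm: "AE \<omega> in M. \<forall>k\<in>{..<N}. \<xi> k \<omega> = m h k \<omega>"
      by (intro AE_finite_allI \<xi>(2)) auto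
    have AEd: "AE \<omega> in M. \<forall>k\<in>{..<N}. norm (z (real (Suc k) * h) \<omega> - \<Phi> h k \<omega> (z (real k * h) \<omega>) - m h k \<omega>) \<le> C2 * (h ^ Suc p * (S \<omega>)\<^sup>2)"
      by (intro AE_finite_allI defect h kN) auto
    have "AE \<omega> in M. (SUP k\<in>{..N}. ennreal (norm (z (real k * h) \<omega> - iterate_steps (\<lambda>k. \<Phi> h k \<omega>) (z 0 \<omega>) k))) \<le> ennreal (?bound \<omega>)"
      using AEm AEd
    proof eventually_elim
      case (elim \<omega>)
      let ?Y = "iterate_steps (\<lambda>k. \<Phi> h k \<omega>) (z 0 \<omega>)"
      let ?z = "\<lambda>k. z (real k * h) \<omega>"
      let ?\<rho> = "\<lambda>k. ?z (Suc k) - \<Phi> h k \<omega> (?z k) - m h k \<omega>"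
      let ?l = "\<lambda>k. \<Phi> h k \<omega> (?z k) - \<Phi> h k \<omega> (?Y k) - (?z k - ?Y k)"
      have ident: "?z k - ?Y k = (\<Sum>j<k. ?l j) + (\<Sum>j<k. m h j \<omega>) + (\<Sum>j<k. ?\<rho> j)" for k
        by (induction k) (simp_all add: algebra_simps del: of_nat_Suc)
      have e: "norm (?z k - ?Y k) \<le> (?R \<omega> + \<bar>C2\<bar> * T * h ^ p * (S \<omega>)\<^sup>2) + C1 * h * (\<Sum>j<k. norm (?z j - ?Y j))" if k: "k \<le> N" for k
      proof -
        have "norm (\<Sum>j<k. ?l j) \<le> (\<Sum>j<k. C1 * h * norm (?z j - ?Y j))"
          using near[OF h] by (intro sum_norm_le) (auto simp: near_translation_def)
        moreover have "norm (\<Sum>j<k. m h j \<omega>) \<le> ?R \<omega>"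
        proof -
          have "(\<Sum>j<k. m h j \<omega>) = c.partial k \<omega>" unfolding c.partial_def using elim(1) k by (intro sum.cong) auto
          then show ?thesis unfolding c.running_max_def using k by (auto intro!: Max_ge)
        qed
        moreover have "norm (\<Sum>j<k. ?\<rho> j) \<le> \<bar>C2\<bar> * T * h ^ p * (S \<omega>)\<^sup>2"
        proof -
          have "norm (\<Sum>j<k. ?\<rho> j) \<le> (\<Sum>j<k. \<bar>C2\<bar> * (h ^ Suc p * (S \<omega>)\<^sup>2))"
          proof (intro sum_norm_le)
            fix j assume "j \<in> {..<k}"
            then have "norm (?\<rho> j) \<le> C2 * (h ^ Suc p * (S \<omega>)\<^sup>2)" using elim(2) k by (simp del: power_Suc of_nat_Suc)
            also have "\<dots> \<le> \<bar>C2\<bar> * (h ^ Suc p * (S \<omega>)\<^sup>2)" using h(1) by (intro mult_right_mono) auto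
            finally show "norm (?\<rho> j) \<le> \<bar>C2\<bar> * (h ^ Suc p * (S \<omega>)\<^sup>2)" .
          qed
          also have "\<dots> = real k * (\<bar>C2\<bar> * (h ^ Suc p * (S \<omega>)\<^sup>2))" by simp
          also have "\<dots> \<le> real N * (\<bar>C2\<bar> * (h ^ Suc p * (S \<omega>)\<^sup>2))" using k h(1) by (intro mult_right_mono) auto
          also have "\<dots> = \<bar>C2\<bar> * (real N * h) * h ^ p * (S \<omega>)\<^sup>2" by simp
          finally show ?thesis unfolding N .
        qed
        ultimately show ?thesis
          unfolding ident[of k] sum_distrib_left by (intro norm_triangle_le) (smt (verit) norm_triangle_ineq)
      qed
      have R: "?R \<omega> \<le> h ^ p + (?R \<omega>)\<^sup>2 / h ^ p"
      proof (cases "?R \<omega> \<le> h ^ p")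
        case False
        have "0 < h ^ p" using h(1) by simp
        then have "?R \<omega> * h ^ p \<le> ?R \<omega> * ?R \<omega>"
          using False by (intro mult_left_mono c.running_max_nonneg) auto
        then have "?R \<omega> \<le> (?R \<omega>)\<^sup>2 / h ^ p" using \<open>0 < h ^ p\<close> by (simp add: field_simps power2_eq_square)
        then show ?thesis using \<open>0 < h ^ p\<close> by linarith
      qed (use h(1) in \<open>simp add: add_increasing2\<close>)
      show ?case
      proof (intro SUP_least ennreal_leI)
        fix k assume k: "k \<in> {..N}"
        have "norm (?z k - ?Y k) \<le> (?R \<omega> + \<bar>C2\<bar> * T * h ^ p * (S \<omega>)\<^sup>2) * exp (C1 * h * real N)"
        proof (rule discrete_gronwall[OF e])
          show "0 \<le> ?R \<omega> + \<bar>C2\<bar> * T * h ^ p * (S \<omega>)\<^sup>2"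
            using c.running_max_nonneg T h(1) by (intro add_nonneg_nonneg mult_nonneg_nonneg) auto
        qed (use k C1 h(1) in auto)
        also have "C1 * h * real N = C1 * T" using N by (simp add: mult_ac)
        also have "(?R \<omega> + \<bar>C2\<bar> * T * h ^ p * (S \<omega>)\<^sup>2) * exp (C1 * T) \<le> ?bound \<omega>"
          using R by (subst mult.commute) (intro mult_left_mono, auto)
        finally show "norm (?z k - ?Y k) \<le> ?bound \<omega>" .
      qed
    qed
    then have "(\<integral>\<^sup>+\<omega>. (SUP k\<in>{..N}. ennreal (norm (z (real k * h) \<omega> - iterate_steps (\<lambda>k. \<Phi> h k \<omega>) (z 0 \<omega>) k))) \<partial>M)
        \<le> (\<integral>\<^sup>+\<omega>. ennreal (?bound \<omega>) \<partial>M)" by (rule nn_integral_mono_AE)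
    also have "\<dots> = ennreal (\<integral>\<omega>. ?bound \<omega> \<partial>M)"
    proof (rule nn_integral_eq_integral)
      show "integrable M ?bound" using c.maximal_inequality(1) S by simp
      show "AE \<omega> in M. 0 \<le> ?bound \<omega>" using T h(1) by (intro AE_I2 mult_nonneg_nonneg add_nonneg_nonneg) auto
    qed
    also have "(\<integral>\<omega>. ?bound \<omega> \<partial>M) = exp (C1 * T) * (h ^ p + (\<integral>\<omega>. (?R \<omega>)\<^sup>2 \<partial>M) / h ^ p + \<bar>C2\<bar> * T * h ^ p * (\<integral>\<omega>. (S \<omega>)\<^sup>2 \<partial>M))"
      using c.maximal_inequality(1) S by (simp add: prob_space)
    also have "\<dots> \<le> exp (C1 * T) * (h ^ p + 4 * C3 * T * h ^ p + \<bar>C2\<bar> * T * h ^ p * (\<integral>\<omega>. (S \<omega>)\<^sup>2 \<partial>M))"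
    proof -
      have "(\<integral>\<omega>. (?R \<omega>)\<^sup>2 \<partial>M) / h ^ p \<le> 4 * C3 * T * h ^ p"
        using R2 h(1) by (simp add: field_simps)
      then show ?thesis by (intro mult_left_mono[of _ _ "exp (C1 * T)"] add_mono order_refl) auto
    qed
    also have "\<dots> = D * h ^ p" by (simp add: D_def algebra_simps)
    also have "h ^ p = h powr real p" using h(1) by (simp add: powr_realpow)
    finally show ?thesis by (simp add: ennreal_leI)
  qed
  with \<Delta> show ?thesis unfolding strong_order_def by blast
qed

section \<open>Noise terms\<close>

text \<open>
  The second moment is \<open>O(h\<^sup>q)\<close> uniformly in the step; a deterministic factor \<open>h\<^sup>a\<close> raises \<open>q\<close> by \<open>2 a\<close>.
\<close>

definition noise_order :: "real \<Rightarrow> nat \<Rightarrow> (real \<Rightarrow> nat \<Rightarrow> 'w \<Rightarrow> 'b::euclidean_space) \<Rightarrow> bool" where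
  "noise_order T q X \<longleftrightarrow> (\<exists>C. \<forall>h k. 0 < h \<and> h \<le> 1 \<and> real (Suc k) * h \<le> T \<longrightarrow>
     step_noise h k (C * h ^ q) (X h k))"

lemma step_noise_add:
  assumes "step_noise h k K X" "step_noise h k L Y"
  shows "step_noise h k (2 * K + 2 * L) (\<lambda>\<omega>. X \<omega> + Y \<omega>)"
proof -
  from assms obtain \<xi> \<eta> where \<xi>: "centered M (F (real k * h)) (F (real (Suc k) * h)) K \<xi>" "AE \<omega> in M. \<xi> \<omega> = X \<omega>"
    and \<eta>: "centered M (F (real k * h)) (F (real (Suc k) * h)) L \<eta>" "AE \<omega> in M. \<eta> \<omega> = Y \<omega>"
    unfolding step_noise_def by blast
  moreover have "AE \<omega> in M. \<xi> \<omega> + \<eta> \<omega> = X \<omega> + Y \<omega>" using \<xi>(2) \<eta>(2) by eventually_elim simp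
  ultimately show ?thesis
    unfolding step_noise_def using centered_add[OF subalgebra_F subalgebra_F] by blast
qed

lemma step_noise_family:
  fixes L :: "'w \<Rightarrow> 'a::euclidean_space \<Rightarrow>\<^sub>L 'b::euclidean_space"
  assumes "0 < h" "step_noise h k K X"
    and L: "\<And>i. i \<in> Basis \<Longrightarrow> (\<lambda>\<omega>. L \<omega> i) \<in> borel_measurable (F (real k * h))" "\<And>\<omega>. norm (L \<omega>) \<le> C"
  shows "step_noise h k (C\<^sup>2 * K) (\<lambda>\<omega>. L \<omega> (X \<omega>))"
proof -
  from assms(2) obtain \<xi> where \<xi>: "centered M (F (real k * h)) (F (real (Suc k) * h)) K \<xi>" "AE \<omega> in M. \<xi> \<omega> = X \<omega>"
    unfolding step_noise_def by blast
  have "subalgebra (F (real (Suc k) * h)) (F (real k * h))"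
    using assms(1) by (intro subalgebra_F_mono mult_right_mono) auto
  from centered_blinfun_family[OF subalgebra_F subalgebra_F this \<xi>(1) L]
  have "centered M (F (real k * h)) (F (real (Suc k) * h)) (C\<^sup>2 * K) (\<lambda>\<omega>. L \<omega> (\<xi> \<omega>))" .
  moreover have "AE \<omega> in M. L \<omega> (\<xi> \<omega>) = L \<omega> (X \<omega>)" using \<xi>(2) by eventually_elim simp
  ultimately show ?thesis unfolding step_noise_def by blast
qed

lemma noise_order_add:
  assumes "noise_order T q X" "noise_order T q Y"
  shows "noise_order T q (\<lambda>h k \<omega>. X h k \<omega> + Y h k \<omega>)"
proof -
  from assms obtain C D where *: "\<And>h k. 0 < h \<and> h \<le> 1 \<and> real (Suc k) * h \<le> T \<Longrightarrow>
      step_noise h k (C * h ^ q) (X h k) \<and> step_noise h k (D * h ^ q) (Y h k)"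
    unfolding noise_order_def by meson
  have "step_noise h k ((2 * C + 2 * D) * h ^ q) (\<lambda>\<omega>. X h k \<omega> + Y h k \<omega>)"
    if "0 < h \<and> h \<le> 1 \<and> real (Suc k) * h \<le> T" for h k
    using step_noise_add[OF *[OF that, THEN conjunct1] *[OF that, THEN conjunct2]] by (simp add: algebra_simps)
  then show ?thesis unfolding noise_order_def by blast
qed

lemma noise_order_family:
  fixes L :: "real \<Rightarrow> nat \<Rightarrow> 'w \<Rightarrow> 'a::euclidean_space \<Rightarrow>\<^sub>L 'b::euclidean_space"
  assumes X: "noise_order T q X"
    and L: "\<And>h k i. 0 < h \<Longrightarrow> real (Suc k) * h \<le> T \<Longrightarrow> i \<in> Basis \<Longrightarrow> (\<lambda>\<omega>. L h k \<omega> i) \<in> borel_measurable (F (real k * h))"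
    and K: "\<And>h k \<omega>. 0 < h \<Longrightarrow> norm (L h k \<omega>) \<le> K * h ^ a"
  shows "noise_order T (q + 2 * a) (\<lambda>h k \<omega>. L h k \<omega> (X h k \<omega>))"
proof -
  from X obtain C where C: "\<And>h k. 0 < h \<and> h \<le> 1 \<and> real (Suc k) * h \<le> T \<Longrightarrow> step_noise h k (C * h ^ q) (X h k)"
    unfolding noise_order_def by blast
  have "step_noise h k (K\<^sup>2 * C * h ^ (q + 2 * a)) (\<lambda>\<omega>. L h k \<omega> (X h k \<omega>))"
    if h: "0 < h \<and> h \<le> 1 \<and> real (Suc k) * h \<le> T" for h k
  proof -
    have "step_noise h k ((K * h ^ a)\<^sup>2 * (C * h ^ q)) (\<lambda>\<omega>. L h k \<omega> (X h k \<omega>))"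
      by (rule step_noise_family[OF _ C[OF h]]) (use h L K in auto)
    moreover have "(K * h ^ a)\<^sup>2 * (C * h ^ q) = K\<^sup>2 * C * h ^ (q + 2 * a)"
      by (simp add: power_mult_distrib power_add power_mult power2_eq_square mult_2 mult_ac)
    ultimately show ?thesis by simp
  qed
  then show ?thesis unfolding noise_order_def by blast
qed

lemma noise_order_scaleR:
  assumes "noise_order T q X" "q' = q + 2 * a"
  shows "noise_order T q' (\<lambda>h k \<omega>. (c * h ^ a) *\<^sub>R X h k \<omega>)"
  using noise_order_family[OF assms(1), of "\<lambda>h k \<omega>. (c * h ^ a) *\<^sub>R id_blinfun" "\<bar>c\<bar>" a]
  unfolding assms(2) by (simp add: blinfun.scaleR_left norm_blinfun_id abs_mult)

lemma noise_order_blinfun: "noise_order T q X \<Longrightarrow> noise_order T q (\<lambda>h k \<omega>. blinfun_apply L (X h k \<omega>))"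
  using noise_order_family[of T q X "\<lambda>h k \<omega>. L" "norm L" 0] by simp

lemma noise_order_diff:
  assumes "noise_order T q X" "noise_order T q Y"
  shows "noise_order T q (\<lambda>h k \<omega>. X h k \<omega> - Y h k \<omega>)"
  using noise_order_add[OF assms(1) noise_order_scaleR[OF assms(2), where q'=q and a=0 and c="-1"]] by simp

lemma noise_order_Pair:
  fixes X :: "real \<Rightarrow> nat \<Rightarrow> 'w \<Rightarrow> 'b::euclidean_space" and Y :: "real \<Rightarrow> nat \<Rightarrow> 'w \<Rightarrow> 'c::euclidean_space"
  assumes "noise_order T q X" "noise_order T q Y"
  shows "noise_order T q (\<lambda>h k \<omega>. (X h k \<omega>, Y h k \<omega>))"
proof -
  have l: "bounded_linear (\<lambda>x::'b. (x, 0::'c))" "bounded_linear (\<lambda>y::'c. (0::'b, y))"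
    by (intro bounded_linear_Pair bounded_linear_ident bounded_linear_zero)+
  have "noise_order T q (\<lambda>h k \<omega>. (X h k \<omega>, 0) + (0, Y h k \<omega>))"
    using noise_order_add[OF noise_order_blinfun[OF assms(1), of "Blinfun (\<lambda>x. (x, 0))"]
        noise_order_blinfun[OF assms(2), of "Blinfun (\<lambda>y. (0, y))"]]
    by (simp add: bounded_linear_Blinfun_apply l)
  then show ?thesis by simp
qed

lemma noise_order_zero: "noise_order T q (\<lambda>h k \<omega>. 0)"
  unfolding noise_order_def step_noise_def centered_def by (intro exI[of _ 0] allI impI exI[of _ "\<lambda>_. 0"]) auto

definition step_W where "step_W h k \<omega> = W (real (Suc k) * h) \<omega> - W (real k * h) \<omega>"
definition step_I where
  "step_I h k \<omega> = integral {real k * h..real (Suc k) * h} (\<lambda>r. W r \<omega> - W (real k * h) \<omega>)"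
definition step_J where
  "step_J h k \<omega> = integral {real k * h..real (Suc k) * h}
     (\<lambda>s. integral {real k * h..s} (\<lambda>r. W r \<omega> - W (real k * h) \<omega>))"

lemma noise_order_W: "noise_order T 1 step_W"
  unfolding noise_order_def step_noise_def
proof (intro exI[of _ "real CARD('n)"] allI impI)
  fix h k assume h: "0 < h \<and> h \<le> 1 \<and> real (Suc k) * h \<le> T"
  have "real k * h \<le> real (Suc k) * h" using h by (intro mult_right_mono) auto
  moreover have "real (Suc k) * h - real k * h = h" by (simp add: algebra_simps)
  ultimately have "centered M (F (real k * h)) (F (real (Suc k) * h)) (real CARD('n) * h ^ 1) (step_W h k)"
    using centered_increment[of "real k * h" "real (Suc k) * h"] h unfolding step_W_def by (simp del: of_nat_Suc)
  then show "\<exists>\<xi>. centered M (F (real k * h)) (F (real (Suc k) * h)) (real CARD('n) * h ^ 1) \<xi> \<and> (AE \<omega> in M. \<xi> \<omega> = step_W h k \<omega>)"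
    by blast
qed

lemma noise_order_I: "noise_order T 3 step_I"
  unfolding noise_order_def step_noise_def
proof (intro exI[of _ "real CARD('n)"] allI impI)
  fix h k assume h: "0 < h \<and> h \<le> 1 \<and> real (Suc k) * h \<le> T"
  have le: "0 \<le> real k * h" "real k * h \<le> real (Suc k) * h" using h by (auto intro!: mult_right_mono simp del: of_nat_Suc)
  have eq: "real (Suc k) * h - real k * h = h" by (simp add: algebra_simps)
  obtain \<xi> where "centered M (F (real k * h)) (F (real (Suc k) * h)) (real CARD('n) * 1\<^sup>2 * (real (Suc k) * h - real k * h) ^ 3) \<xi>"
    "AE \<omega> in M. \<xi> \<omega> = integral {real k * h..real (Suc k) * h} (\<lambda>r. 1 *\<^sub>R (W r \<omega> - W (real k * h) \<omega>))"
    by (rule centered_weighted_integral[OF le, of "\<lambda>_. 1" 1]) auto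
  then show "\<exists>\<xi>. centered M (F (real k * h)) (F (real (Suc k) * h)) (real CARD('n) * h ^ 3) \<xi> \<and> (AE \<omega> in M. \<xi> \<omega> = step_I h k \<omega>)"
    unfolding eq step_I_def scaleR_one by auto
qed

text \<open>
  Integration by parts writes \<open>J\<close> as a weighted integral of single increments.
\<close>

lemma double_integral_eq:
  fixes \<phi> :: "real \<Rightarrow> 'b::euclidean_space"
  assumes ab: "a \<le> b" and \<phi>: "continuous_on {a..b} \<phi>"
  shows "integral {a..b} (\<lambda>s. integral {a..s} \<phi>) = integral {a..b} (\<lambda>r. (b - r) *\<^sub>R \<phi> r)"
proof -
  let ?A = "\<lambda>s. integral {a..s} \<phi>"
  have A: "(?A has_vector_derivative \<phi> s) (at s within {a..b})" if "s \<in> {a..b}" for s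
    using integral_has_vector_derivative[OF \<phi> that] .
  have cA: "continuous_on {a..b} ?A" by (rule continuous_on_vector_derivative[OF A])
  have "((\<lambda>s. (b - s) *\<^sub>R \<phi> s + (- 1) *\<^sub>R ?A s) has_integral ((b - b) *\<^sub>R ?A b - (b - a) *\<^sub>R ?A a)) {a..b}"
  proof (rule fundamental_theorem_of_calculus[OF ab])
    fix s assume s: "s \<in> {a..b}"
    have "((\<lambda>s. b - s) has_real_derivative - 1) (at s within {a..b})"
      by (auto intro!: derivative_eq_intros)
    from has_vector_derivative_scaleR[OF this A[OF s]]
    show "((\<lambda>s. (b - s) *\<^sub>R ?A s) has_vector_derivative (b - s) *\<^sub>R \<phi> s + (- 1) *\<^sub>R ?A s) (at s within {a..b})" .
  qed
  then have "integral {a..b} (\<lambda>s. (b - s) *\<^sub>R \<phi> s - ?A s) = 0" by (simp add: integral_unique)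
  moreover have "integral {a..b} (\<lambda>s. (b - s) *\<^sub>R \<phi> s - ?A s) = integral {a..b} (\<lambda>s. (b - s) *\<^sub>R \<phi> s) - integral {a..b} ?A"
    by (intro Henstock_Kurzweil_Integration.integral_diff integrable_continuous_real continuous_intros \<phi> cA)
  ultimately show ?thesis by simp
qed

lemma noise_order_J: "noise_order T 5 step_J"
  unfolding noise_order_def step_noise_def
proof (intro exI[of _ "real CARD('n)"] allI impI)
  fix h k assume h: "0 < h \<and> h \<le> 1 \<and> real (Suc k) * h \<le> T"
  let ?a = "real k * h" and ?b = "real (Suc k) * h"
  have le: "0 \<le> ?a" "?a \<le> ?b" using h by (auto intro!: mult_right_mono simp del: of_nat_Suc)
  have eq: "?b - ?a = h" by (simp add: algebra_simps)
  have bd: "\<bar>?b - r\<bar> \<le> h" if "r \<in> {?a..?b}" for r using that eq by auto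
  have cont: "continuous_on UNIV (\<lambda>r. ?b - r)" by (intro continuous_intros)
  obtain \<xi> where \<xi>: "centered M (F ?a) (F ?b) (real CARD('n) * h\<^sup>2 * (?b - ?a) ^ 3) \<xi>"
    "AE \<omega> in M. \<xi> \<omega> = integral {?a..?b} (\<lambda>r. (?b - r) *\<^sub>R (W r \<omega> - W ?a \<omega>))"
    by (rule centered_weighted_integral[OF le cont bd])
  have "AE \<omega> in M. \<xi> \<omega> = step_J h k \<omega>"
    using \<xi>(2) AE_continuous
  proof eventually_elim
    case (elim \<omega>)
    show ?case unfolding step_J_def elim(1)
      by (rule double_integral_eq[symmetric, OF le(2) continuous_increment[OF elim(2) le(1)]])
  qed
  moreover have "centered M (F ?a) (F ?b) (real CARD('n) * h ^ 5) \<xi>"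
    using \<xi>(1) unfolding eq by (simp add: power_add[symmetric] mult.assoc del: of_nat_Suc)
  ultimately show "\<exists>\<xi>. centered M (F ?a) (F ?b) (real CARD('n) * h ^ 5) \<xi> \<and> (AE \<omega> in M. \<xi> \<omega> = step_J h k \<omega>)"
    by blast
qed

definition step_U where "step_U h k \<omega> = (h / 2) *\<^sub>R step_W h k \<omega> - step_I h k \<omega>"

lemma noise_order_U: "noise_order T 3 step_U"
  using noise_order_diff[OF noise_order_scaleR[OF noise_order_W, where q'=3 and a=1 and c="1/2"] noise_order_I]
  unfolding step_U_def[abs_def] by simp

end

section \<open>The Langevin equation\<close>

lemma gronwall:
  fixes y :: "real \<Rightarrow> real"
  assumes cont: "continuous_on {0..T} y" and le: "\<And>t. t \<in> {0..T} \<Longrightarrow> y t \<le> a + K * integral {0..t} y"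
    and K: "0 \<le> K" and t: "t \<in> {0..T}"
  shows "y t \<le> a * exp (K * t)"
proof -
  define g where "g s = (a + K * integral {0..s} y) * exp (- (K * s))" for s
  have "\<exists>s\<in>{0..t}. g t - g 0 = (\<lambda>d. d * ((K * y s) * exp (- (K * s)) - K * exp (- (K * s)) * (a + K * integral {0..s} y))) (t - 0)"
  proof (rule mvt_very_simple)
    fix s assume s: "0 \<le> s" "s \<le> t"
    have "((\<lambda>s. integral {0..s} y) has_real_derivative y s) (at s within {0..T})"
      using integral_has_vector_derivative[OF cont, of s] s t
      by (simp add: has_real_derivative_iff_has_vector_derivative)
    from DERIV_subset[OF this, of "{0..t}"] t
    have 1: "((\<lambda>s. integral {0..s} y) has_real_derivative y s) (at s within {0..t})" by auto
    have 2: "((\<lambda>s. exp (- (K * s))) has_real_derivative - K * exp (- (K * s))) (at s within {0..t})"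
      by (auto intro!: derivative_eq_intros)
    have "(g has_real_derivative (K * y s) * exp (- (K * s)) - K * exp (- (K * s)) * (a + K * integral {0..s} y)) (at s within {0..t})"
      unfolding g_def by (auto intro!: derivative_eq_intros 1 2 simp: algebra_simps)
    then show "(g has_derivative (\<lambda>d. d * ((K * y s) * exp (- (K * s)) - K * exp (- (K * s)) * (a + K * integral {0..s} y)))) (at s within {0..t})"
      by (simp add: has_field_derivative_def mult_commute_abs)
  qed (use t in auto)
  then obtain s where s: "s \<in> {0..t}"
    "g t - g 0 = t * ((K * y s) * exp (- (K * s)) - K * exp (- (K * s)) * (a + K * integral {0..s} y))"
    by auto
  have "(K * y s) * exp (- (K * s)) - K * exp (- (K * s)) * (a + K * integral {0..s} y)
      = K * exp (- (K * s)) * (y s - (a + K * integral {0..s} y))" by (simp add: algebra_simps)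
  also have "\<dots> \<le> 0"
    using le[of s] s(1) t K by (intro mult_nonneg_nonpos mult_nonneg_nonneg) auto
  finally have "g t \<le> g 0" using s(2) t by (smt (verit) atLeastAtMost_iff mult_nonneg_nonpos)
  then have "(a + K * integral {0..t} y) * exp (- (K * t)) * exp (K * t) \<le> a * exp (K * t)"
    unfolding g_def by (intro mult_right_mono) auto
  then have "a + K * integral {0..t} y \<le> a * exp (K * t)" by (simp add: mult.assoc exp_minus_inverse exp_add[symmetric])
  with le[OF t] show ?thesis by linarith
qed

context langevin_coefficients
begin

text \<open>
  The factor obtained from Gronwall's inequality when initial value and noise are bounded by \<open>2 S\<close> with \<open>S \<ge> 1\<close>.
\<close>

definition growth_const :: "real \<Rightarrow> real" where
  "growth_const T = (2 + norm (f 0) * T + 2 * norm \<sigma>) * exp ((1 + L1 + norm G) * T)"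

lemma solution_bound:
  assumes X: "continuous_on {0..T} X" and V: "continuous_on {0..T} V"
    and X_eq: "\<And>t. t \<in> {0..T} \<Longrightarrow> X t = X 0 + integral {0..t} V"
    and V_eq: "\<And>t. t \<in> {0..T} \<Longrightarrow> V t = V 0 + integral {0..t} (\<lambda>s. f (X s) - G (V s)) + \<sigma> (w t)"
    and init: "norm (X 0) + norm (V 0) \<le> 2 * S" and w: "\<And>t. t \<in> {0..T} \<Longrightarrow> norm (w t) \<le> 2 * S"
    and S: "1 \<le> S" and t: "t \<in> {0..T}"
  shows "norm (X t) + norm (V t) \<le> growth_const T * S"
proof -
  let ?y = "\<lambda>t. norm (X t) + norm (V t)" and ?K = "1 + L1 + norm G"
  let ?a = "(2 + norm (f 0) * T + 2 * norm \<sigma>) * S"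
  have cy: "continuous_on {0..T} ?y" by (intro continuous_intros X V)
  have K0: "0 \<le> ?K" using L1_nonneg by simp
  have "?y t \<le> ?a * exp (?K * t)"
  proof (rule gronwall[OF cy _ K0 t])
    fix t assume t: "t \<in> {0..T}"
    have cV: "continuous_on {0..t} V" and cX: "continuous_on {0..t} X"
      using t X V by (auto elim: continuous_on_subset)
    have cf: "continuous_on {0..t} (\<lambda>s. f (X s) - G (V s))"
      by (intro continuous_intros cV continuous_on_compose2[OF continuous_on_f cX]) auto
    have "norm (integral {0..t} V) \<le> integral {0..t} (\<lambda>s. norm (V s))"
      by (intro integral_norm_bound_integral integrable_continuous_real continuous_intros cV) auto
    moreover have "norm (integral {0..t} (\<lambda>s. f (X s) - G (V s))) \<le> integral {0..t} (\<lambda>s. norm (f 0) + ((L1 + norm G) * ?y s + norm (X s)))"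
    proof (intro integral_norm_bound_integral integrable_continuous_real cf)
      show "continuous_on {0..t} (\<lambda>s. norm (f 0) + ((L1 + norm G) * ?y s + norm (X s)))"
        by (intro continuous_intros cX cV)
      fix s
      have "norm (f (X s) - G (V s)) \<le> (norm (f 0) + L1 * norm (X s)) + norm G * norm (V s)"
        by (intro order_trans[OF norm_triangle_ineq4] add_mono f_growth norm_blinfun)
      also have "\<dots> \<le> norm (f 0) + ((L1 + norm G) * ?y s + norm (X s))"
        using L1_nonneg by (simp add: algebra_simps)
      finally show "norm (f (X s) - G (V s)) \<le> norm (f 0) + ((L1 + norm G) * ?y s + norm (X s))" .
    qed
    moreover have "integral {0..t} (\<lambda>s. norm (V s)) + integral {0..t} (\<lambda>s. norm (f 0) + ((L1 + norm G) * ?y s + norm (X s)))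
        = integral {0..t} (\<lambda>s. norm (f 0) + ?K * ?y s)"
      by (subst Henstock_Kurzweil_Integration.integral_add[symmetric])
         (auto intro!: integrable_continuous_real continuous_intros cX cV simp: algebra_simps)
    moreover have "integral {0..t} (\<lambda>s. norm (f 0) + ?K * ?y s) = norm (f 0) * t + ?K * integral {0..t} ?y"
      using t by (subst Henstock_Kurzweil_Integration.integral_add)
         (auto intro!: integrable_continuous_real continuous_intros cX cV)
    moreover have "norm (X t) \<le> norm (X 0) + norm (integral {0..t} V)"
      by (subst X_eq[OF t]) (rule norm_triangle_ineq)
    moreover have "norm (V t) \<le> norm (V 0) + norm (integral {0..t} (\<lambda>s. f (X s) - G (V s))) + norm (\<sigma> (w t))"
      by (subst V_eq[OF t]) (intro order_trans[OF norm_triangle_ineq] add_mono norm_triangle_ineq order_refl)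
    moreover have "norm (\<sigma> (w t)) \<le> norm \<sigma> * (2 * S)"
      by (intro order_trans[OF norm_blinfun] mult_left_mono w t) auto
    moreover have "norm (f 0) * t \<le> norm (f 0) * T * S"
    proof -
      have "norm (f 0) * t \<le> norm (f 0) * T" using t by (intro mult_left_mono) auto
      also have "\<dots> \<le> norm (f 0) * T * S" using S t mult_left_mono[of 1 S "norm (f 0) * T"] by simp
      finally show ?thesis .
    qed
    moreover have "?a = 2 * S + norm (f 0) * T * S + norm \<sigma> * (2 * S)" by (simp add: algebra_simps)
    ultimately show "?y t \<le> ?a + ?K * integral {0..t} ?y" using init by linarith
  qed
  also have "\<dots> \<le> ?a * exp (?K * T)"
    using t K0 S by (intro mult_left_mono mult_nonneg_nonneg) (auto intro: mult_left_mono)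
  also have "\<dots> = growth_const T * S" unfolding growth_const_def by (simp add: mult_ac)
  finally show ?thesis .
qed

end

locale langevin_problem = brownian M F W + langevin_coefficients f f' G \<sigma> L1 L2
  for M :: "'w measure" and F and W :: "real \<Rightarrow> 'w \<Rightarrow> real ^ 'n"
    and f :: "real ^ 'n \<Rightarrow> real ^ 'n" and f' G \<sigma> L1 L2 +
  fixes T :: real and x v :: "real \<Rightarrow> 'w \<Rightarrow> real ^ 'n"
  assumes T: "0 < T"
    and x_measurable: "t \<in> {0..T} \<Longrightarrow> x t \<in> borel_measurable (F t)"
    and v_measurable: "t \<in> {0..T} \<Longrightarrow> v t \<in> borel_measurable (F t)"
    and solution: "AE \<omega> in M. continuous_on {0..T} (\<lambda>t. x t \<omega>) \<and> continuous_on {0..T} (\<lambda>t. v t \<omega>) \<and>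
        (\<forall>t\<in>{0..T}. x t \<omega> = x 0 \<omega> + integral {0..t} (\<lambda>s. v s \<omega>) \<and>
           v t \<omega> = v 0 \<omega> + integral {0..t} (\<lambda>s. f (x s \<omega>) - G (v s \<omega>)) + \<sigma> (W t \<omega> - W 0 \<omega>))"
    and initial: "integrable M (\<lambda>\<omega>. (norm (x 0 \<omega>, v 0 \<omega>))\<^sup>2)"
begin

definition good_path :: "('w \<Rightarrow> real) \<Rightarrow> 'w \<Rightarrow> bool" where
  "good_path S \<omega> \<longleftrightarrow> 1 \<le> S \<omega> \<and> continuous_on {0..} (\<lambda>t. W t \<omega>) \<and>
     continuous_on {0..T} (\<lambda>t. x t \<omega>) \<and> continuous_on {0..T} (\<lambda>t. v t \<omega>) \<and>
     (\<forall>t\<in>{0..T}. x t \<omega> = x 0 \<omega> + integral {0..t} (\<lambda>s. v s \<omega>) \<and>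
        v t \<omega> = v 0 \<omega> + integral {0..t} (\<lambda>s. f (x s \<omega>) - G (v s \<omega>)) + \<sigma> (W t \<omega> - W 0 \<omega>) \<and>
        norm (W t \<omega>) \<le> S \<omega> \<and> norm (x t \<omega>) \<le> growth_const T * S \<omega> \<and> norm (v t \<omega>) \<le> growth_const T * S \<omega>)"

lemma good_paths:
  obtains S where "integrable M (\<lambda>\<omega>. (S \<omega>)\<^sup>2)" "AE \<omega> in M. good_path S \<omega>"
proof -
  obtain S0 where S0: "S0 \<in> borel_measurable M" "integrable M (\<lambda>\<omega>. (S0 \<omega>)\<^sup>2)"
    "AE \<omega> in M. \<forall>t\<in>{0..T}. norm (W t \<omega>) \<le> S0 \<omega>"
    by (rule running_bound[OF T])
  define S where "S \<omega> = 1 + norm (x 0 \<omega>, v 0 \<omega>) + \<bar>S0 \<omega>\<bar>" for \<omega>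
  have [measurable]: "x 0 \<in> borel_measurable M" "v 0 \<in> borel_measurable M" "S0 \<in> borel_measurable M"
    using T S0(1) by (auto intro!: measurable_from_subalg[OF subalgebra_F] x_measurable v_measurable)
  have le: "(S \<omega>)\<^sup>2 \<le> 3 * (1 + (norm (x 0 \<omega>, v 0 \<omega>))\<^sup>2 + (S0 \<omega>)\<^sup>2)" for \<omega>
  proof -
    have "(a + b + c)\<^sup>2 \<le> 3 * (a\<^sup>2 + b\<^sup>2 + c\<^sup>2)" for a b c :: real
      using zero_le_power2[of "a - b"] zero_le_power2[of "b - c"] zero_le_power2[of "a - c"]
      by (simp add: power2_eq_square algebra_simps)
    from this[of 1 "norm (x 0 \<omega>, v 0 \<omega>)" "\<bar>S0 \<omega>\<bar>"] show ?thesis by (simp add: S_def)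
  qed
  have "integrable M (\<lambda>\<omega>. (S \<omega>)\<^sup>2)"
  proof (rule Bochner_Integration.integrable_bound)
    show "integrable M (\<lambda>\<omega>. 3 * (1 + (norm (x 0 \<omega>, v 0 \<omega>))\<^sup>2 + (S0 \<omega>)\<^sup>2))"
      using initial S0(2) by simp
    show "(\<lambda>\<omega>. (S \<omega>)\<^sup>2) \<in> borel_measurable M" unfolding S_def by measurable
    show "AE \<omega> in M. norm ((S \<omega>)\<^sup>2) \<le> norm (3 * (1 + (norm (x 0 \<omega>, v 0 \<omega>))\<^sup>2 + (S0 \<omega>)\<^sup>2))"
      using le by (intro AE_I2) (simp add: abs_of_nonneg)
  qed
  moreover have "AE \<omega> in M. good_path S \<omega>"
    using AE_continuous AE_W_0 S0(3) solution
  proof eventually_elim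
    case (elim \<omega>)
    have S1: "1 \<le> S \<omega>" by (simp add: S_def)
    have W: "norm (W t \<omega>) \<le> S \<omega>" if "t \<in> {0..T}" for t
    proof -
      have "norm (W t \<omega>) \<le> \<bar>S0 \<omega>\<bar>" using elim(3) that by force
      then show ?thesis unfolding S_def using norm_ge_zero[of "(x 0 \<omega>, v 0 \<omega>)"] by linarith
    qed
    have "norm (x 0 \<omega>) \<le> S \<omega>" "norm (v 0 \<omega>) \<le> S \<omega>"
      using norm_fst_le[of "x 0 \<omega>" "v 0 \<omega>"] norm_snd_le[of "v 0 \<omega>" "x 0 \<omega>"] by (auto simp: S_def)
    then have init: "norm (x 0 \<omega>) + norm (v 0 \<omega>) \<le> 2 * S \<omega>" by simp
    have bound: "norm (x t \<omega>) + norm (v t \<omega>) \<le> growth_const T * S \<omega>" if t: "t \<in> {0..T}" for t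
    proof (rule solution_bound[of T "\<lambda>t. x t \<omega>" "\<lambda>t. v t \<omega>" "\<lambda>t. W t \<omega> - W 0 \<omega>"])
      show "norm (W t \<omega> - W 0 \<omega>) \<le> 2 * S \<omega>" if "t \<in> {0..T}" for t
        using W[OF that] elim(2) S1 by simp
    qed (use elim(4) init S1 t in blast)+
    have "norm (x t \<omega>) \<le> growth_const T * S \<omega> \<and> norm (v t \<omega>) \<le> growth_const T * S \<omega>" if t: "t \<in> {0..T}" for t
      using bound[OF t] norm_ge_zero[of "x t \<omega>"] norm_ge_zero[of "v t \<omega>"] by linarith
    then show ?case unfolding good_path_def using elim(1,4) S1 W by blast
  qed
  ultimately show thesis by (rule that)
qed

text \<open>
  Below this step size the fields of \<open>A\<close> and \<open>B\<close> have Lipschitz constant at most \<open>1/2\<close>, as needed for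
  uniqueness of the flows, and the expansion of the linear flow applies.
\<close>

definition "h_max = 1 / (2 * (1 + L1 + norm G))"

lemma h_max: "0 < h_max" "\<And>h. 0 < h \<Longrightarrow> h < h_max \<Longrightarrow> h \<le> 1 / 2 \<and> h * (L1 + norm G) \<le> 1 / 2 \<and> h * norm G \<le> 1 \<and> h \<le> 1"
proof -
  have pos: "0 < 1 + L1 + norm G" using L1_nonneg by (simp add: add_pos_nonneg)
  then show "0 < h_max" unfolding h_max_def by simp
  fix h assume h: "0 < h" "h < h_max"
  then have le: "h * (1 + L1 + norm G) \<le> 1 / 2" using pos unfolding h_max_def by (simp add: field_simps)
  have nonneg: "0 \<le> h * L1" "0 \<le> h * norm G" using h L1_nonneg by auto
  show "h \<le> 1 / 2 \<and> h * (L1 + norm G) \<le> 1 / 2 \<and> h * norm G \<le> 1 \<and> h \<le> 1"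
    using le h(1) nonneg unfolding distrib_left by (intro conjI; linarith)
qed

definition "map_A \<tau> h k \<omega> = step_A h (step_U h k \<omega>) \<tau>"
definition "map_B \<tau> h k \<omega> = step_B h (step_W h k \<omega>) (step_U h k \<omega>) \<tau>"

definition "scheme_AB h k \<omega> = map_A 1 h k \<omega> \<circ> map_B 1 h k \<omega>"
definition "scheme_ABA h k \<omega> = map_A (1/2) h k \<omega> \<circ> map_B 1 h k \<omega> \<circ> map_A (1/2) h k \<omega>"
definition "scheme_BAB h k \<omega> = map_B (1/2) h k \<omega> \<circ> map_A 1 h k \<omega> \<circ> map_B (1/2) h k \<omega>"

definition "noise_AB h k \<omega> = (- ((h / 2) *\<^sub>R \<sigma> (step_W h k \<omega>)), 0 :: real ^ 'n)"

definition "noise_pos \<kappa> h k \<omega> = - G (\<sigma> (step_J h k \<omega>)) - (h / 2) *\<^sub>R G (\<sigma> (step_U h k \<omega>))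
  + (\<kappa> * h\<^sup>2) *\<^sub>R G (\<sigma> (step_W h k \<omega>))"

definition "noise_vel X h k \<omega> = f' (x (real k * h) \<omega>) (\<sigma> (X h k \<omega>))
  + G (G (\<sigma> (step_J h k \<omega> + (h / 2) *\<^sub>R step_U h k \<omega>))) - (h\<^sup>2 / 6) *\<^sub>R G (G (\<sigma> (step_W h k \<omega>)))"

definition "noise_ABA h k \<omega> = (noise_pos (1/4) h k \<omega>,
  noise_vel (\<lambda>h k \<omega>. step_J h k \<omega> + (h / 2) *\<^sub>R step_U h k \<omega>) h k \<omega>)"

definition "noise_BAB h k \<omega> = (noise_pos (1/8) h k \<omega>,
  noise_vel (\<lambda>h k \<omega>. step_J h k \<omega> - (h / 2) *\<^sub>R ((h / 2) *\<^sub>R step_W h k \<omega> - step_U h k \<omega>)) h k \<omega>)"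

abbreviation "z t \<omega> \<equiv> (x t \<omega>, v t \<omega>)"

text \<open>
  Local error of order \<open>p + 1\<close> up to the mean-zero part \<open>m\<close>.
\<close>

definition "small_defects p \<Phi> m S C \<longleftrightarrow>
  (\<forall>h k. 0 < h \<longrightarrow> h < h_max \<longrightarrow> real (Suc k) * h \<le> T \<longrightarrow>
    (AE \<omega> in M. norm (z (real (Suc k) * h) \<omega> - \<Phi> h k \<omega> (z (real k * h) \<omega>) - m h k \<omega>) \<le> C * (h ^ Suc p * (S \<omega>)\<^sup>2)))"

text \<open>
  The expansions of one step are applied to the family of all steps of all admissible sizes on all good
  paths at once, which makes the constants uniform.
\<close>

lemma local_defects:
  obtains S C1 C2 C3 where "integrable M (\<lambda>\<omega>. (S \<omega>)\<^sup>2)"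
    "small_defects 1 scheme_AB noise_AB S C1"
    "small_defects 2 scheme_ABA noise_ABA S C2"
    "small_defects 2 scheme_BAB noise_BAB S C3"
proof -
  obtain S where S: "integrable M (\<lambda>\<omega>. (S \<omega>)\<^sup>2)" "AE \<omega> in M. good_path S \<omega>"
    by (rule good_paths)
  define P where "P = {(h, k, \<omega>). 0 < h \<and> h < h_max \<and> real (Suc k) * h \<le> T \<and> good_path S \<omega>}"
  define H where "H = (\<lambda>p :: real \<times> nat \<times> 'w. fst p)"
  define t where "t = (\<lambda>p :: real \<times> nat \<times> 'w. real (fst (snd p)) * fst p)"
  define xs where "xs = (\<lambda>(p :: real \<times> nat \<times> 'w) s. x s (snd (snd p)))"
  define vs where "vs = (\<lambda>(p :: real \<times> nat \<times> 'w) s. v s (snd (snd p)))"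
  define ws where "ws = (\<lambda>(p :: real \<times> nat \<times> 'w) s. W s (snd (snd p)) - W (t p) (snd (snd p)))"
  define SS where "SS = (\<lambda>p :: real \<times> nat \<times> 'w. S (snd (snd p)))"
  define K where "K = max 2 (growth_const T)"
  have P: "0 < H p" "H p < h_max" "0 \<le> t p" "t p + H p \<le> T" "good_path S (snd (snd p))" if "p \<in> P" for p
    using that by (auto simp: P_def H_def t_def algebra_simps)
  have sub: "{t p..t p + H p} \<subseteq> {0..T}" "{t p..t p + H p} \<subseteq> {0..}" if "p \<in> P" for p using P[OF that] by auto
  interpret L: langevin_steps f f' G \<sigma> L1 L2 P H SS t xs vs ws K
  proof unfold_locales
    fix p assume p: "p \<in> P"
    obtain h k \<omega> where [simp]: "p = (h, k, \<omega>)" by (cases p) auto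
    note Pp = P[OF p]
    have "good_path S \<omega>" using Pp(5) by simp
    then have S1: "1 \<le> S \<omega>" and cW: "continuous_on {0..} (\<lambda>r. W r \<omega>)"
      and cx: "continuous_on {0..T} (\<lambda>r. x r \<omega>)" and cv: "continuous_on {0..T} (\<lambda>r. v r \<omega>)"
      and path: "\<forall>r\<in>{0..T}. x r \<omega> = x 0 \<omega> + integral {0..r} (\<lambda>s. v s \<omega>) \<and>
        v r \<omega> = v 0 \<omega> + integral {0..r} (\<lambda>s. f (x s \<omega>) - G (v s \<omega>)) + \<sigma> (W r \<omega> - W 0 \<omega>) \<and>
        norm (W r \<omega>) \<le> S \<omega> \<and> norm (x r \<omega>) \<le> growth_const T * S \<omega> \<and> norm (v r \<omega>) \<le> growth_const T * S \<omega>"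
      unfolding good_path_def by blast+
    show "0 < H p" by (rule Pp)
    show "H p \<le> 1" "H p * norm G \<le> 1" using h_max(2)[OF Pp(1,2)] by auto
    show "1 \<le> SS p" using S1 by (simp add: SS_def)
    show "continuous_on {t p..t p + H p} (xs p)" "continuous_on {t p..t p + H p} (vs p)"
      unfolding xs_def vs_def using continuous_on_subset[OF cx sub(1)[OF p]] continuous_on_subset[OF cv sub(1)[OF p]] by simp_all
    show "continuous_on {t p..t p + H p} (ws p)"
      unfolding ws_def using continuous_on_subset[OF cW sub(2)[OF p]]
      by (intro continuous_on_diff continuous_on_const) simp_all
    fix s assume s: "s \<in> {t p..t p + H p}"
    have s0: "s \<in> {0..T}" "t p \<in> {0..T}" "0 \<le> t p" "t p \<le> s" using s sub(1)[OF p] Pp by auto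
    note path_s = bspec[OF path s0(1)] and path_t = bspec[OF path s0(2)]
    have s_sub: "{0..s} \<subseteq> {0..T}" using s0(1) by auto
    note cont = continuous_on_subset[OF cx s_sub] continuous_on_subset[OF cv s_sub]
    show "xs p s = xs p (t p) + integral {t p..s} (vs p)"
    proof -
      note 1 = path_s[THEN conjunct1] and 2 = path_t[THEN conjunct1]
      have 3: "integral {0..t p} (\<lambda>r. v r \<omega>) + integral {t p..s} (\<lambda>r. v r \<omega>) = integral {0..s} (\<lambda>r. v r \<omega>)"
        by (rule Henstock_Kurzweil_Integration.integral_combine[OF s0(3,4) integrable_continuous_real[OF cont(2)]])
      have "x s \<omega> = x (t p) \<omega> + integral {t p..s} (\<lambda>r. v r \<omega>)"
        by (subst 1, subst 2, subst 3[symmetric]) (simp only: add.assoc)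
      then show ?thesis by (simp add: xs_def vs_def)
    qed
    show "vs p s = vs p (t p) + integral {t p..s} (\<lambda>r. f (xs p r) - G (vs p r)) + \<sigma> (ws p s)"
    proof -
      let ?b = "\<lambda>r. f (x r \<omega>) - G (v r \<omega>)"
      have cb: "continuous_on {0..s} ?b"
        by (intro continuous_intros cont continuous_on_compose2[OF continuous_on_f cont(1)]) auto
      note 1 = path_s[THEN conjunct2, THEN conjunct1] and 2 = path_t[THEN conjunct2, THEN conjunct1]
      have 3: "integral {0..t p} ?b + integral {t p..s} ?b = integral {0..s} ?b"
        by (rule Henstock_Kurzweil_Integration.integral_combine[OF s0(3,4) integrable_continuous_real[OF cb]])
      have 4: "\<sigma> (W s \<omega> - W 0 \<omega>) = \<sigma> (W (t p) \<omega> - W 0 \<omega>) + \<sigma> (W s \<omega> - W (t p) \<omega>)"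
        by (simp add: blinfun.diff_right)
      have "v s \<omega> = v (t p) \<omega> + integral {t p..s} ?b + \<sigma> (W s \<omega> - W (t p) \<omega>)"
        by (subst 1, subst 2, subst 3[symmetric], subst 4) (simp only: add.assoc add.commute add.left_commute)
      then show ?thesis by (simp add: xs_def vs_def ws_def)
    qed
    have "growth_const T * S \<omega> \<le> K * S \<omega>" "2 * S \<omega> \<le> K * S \<omega>"
      using S1 unfolding K_def by (intro mult_right_mono; simp)+
    moreover have "norm (W s \<omega> - W (t p) \<omega>) \<le> norm (W s \<omega>) + norm (W (t p) \<omega>)" by (rule norm_triangle_ineq4)
    ultimately have "norm (x s \<omega>) \<le> K * S \<omega>" "norm (v s \<omega>) \<le> K * S \<omega>" "norm (W s \<omega> - W (t p) \<omega>) \<le> K * S \<omega>"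
      using path_s[THEN conjunct2, THEN conjunct2] path_t[THEN conjunct2, THEN conjunct2] by linarith+
    then show "norm (xs p s) \<le> K * SS p" "norm (vs p s) \<le> K * SS p" "norm (ws p s) \<le> K * SS p"
      by (simp_all add: xs_def vs_def ws_def SS_def)
  qed
  have Suc_eq: "real (Suc k) * h = real k * h + h" for k h by (simp add: algebra_simps)
  have w: "L.w (h, k, \<omega>) = step_W h k \<omega>" and I: "L.I (h, k, \<omega>) = step_I h k \<omega>"
    and J: "L.J (h, k, \<omega>) = step_J h k \<omega>" and xv: "L.x (h, k, \<omega>) = x (real k * h) \<omega>" "L.v (h, k, \<omega>) = v (real k * h) \<omega>" for h k \<omega>
    unfolding L.w_def L.I_def L.J_def L.A_def L.x_def L.v_def step_W_def step_I_def step_J_def Suc_eq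
    by (simp_all add: ws_def xs_def vs_def t_def H_def)
  have u: "L.u (h, k, \<omega>) = step_U h k \<omega>" for h k \<omega>
    unfolding L.u_def step_U_def w I by (simp add: H_def)
  have maps: "L.AB (h, k, \<omega>) = scheme_AB h k \<omega> (z (real k * h) \<omega>)"
    "L.ABA (h, k, \<omega>) = scheme_ABA h k \<omega> (z (real k * h) \<omega>)"
    "L.BAB (h, k, \<omega>) = scheme_BAB h k \<omega> (z (real k * h) \<omega>)" for h k \<omega>
    unfolding L.AB_def L.ABA_def L.BAB_def scheme_AB_def scheme_ABA_def scheme_BAB_def map_A_def map_B_def u w xv
    by (simp_all add: H_def)
  have xs_next: "xs (h, k, \<omega>) (t (h, k, \<omega>) + H (h, k, \<omega>)) = x (real (Suc k) * h) \<omega>"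
    and vs_next: "vs (h, k, \<omega>) (t (h, k, \<omega>) + H (h, k, \<omega>)) = v (real (Suc k) * h) \<omega>" for h k \<omega>
    unfolding Suc_eq by (simp_all add: xs_def vs_def t_def H_def)
  have noises: "L.pos_noise \<kappa> (h, k, \<omega>) = noise_pos \<kappa> h k \<omega>"
    "L.vel_noise (\<lambda>(h, k, \<omega>). X h k \<omega>) (h, k, \<omega>) = noise_vel X h k \<omega>" for \<kappa> X h k \<omega>
    unfolding L.pos_noise_def L.vel_noise_def noise_pos_def noise_vel_def J u w xv by (simp_all add: H_def)
  have X_ABA: "(\<lambda>p. L.J p + (H p / 2) *\<^sub>R L.u p) = (\<lambda>(h, k, \<omega>). step_J h k \<omega> + (h / 2) *\<^sub>R step_U h k \<omega>)"
    and X_BAB: "(\<lambda>p. L.J p - (H p / 2) *\<^sub>R ((H p / 2) *\<^sub>R L.w p - L.u p))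
      = (\<lambda>(h, k, \<omega>). step_J h k \<omega> - (h / 2) *\<^sub>R ((h / 2) *\<^sub>R step_W h k \<omega> - step_U h k \<omega>))"
    by (simp_all only: fun_eq_iff split_paired_All prod.case J u w) (simp_all add: H_def)
  have small: "\<exists>C. small_defects p \<Phi> m S C"
    if X: "L.Ord q 2 X" and Y: "L.Ord q 2 Y" and q: "q = Suc p"
      and eq: "\<And>h k \<omega>. (X (h, k, \<omega>), Y (h, k, \<omega>)) = z (real (Suc k) * h) \<omega> - \<Phi> h k \<omega> (z (real k * h) \<omega>) - m h k \<omega>"
    for p q \<Phi> m and X Y :: "real \<times> nat \<times> 'w \<Rightarrow> real ^ 'n"
  proof -
    from L.OrdE[OF X] obtain C where C: "\<And>p. p \<in> P \<Longrightarrow> norm (X p) \<le> C * (H p ^ q * SS p ^ 2)" by blast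
    from L.OrdE[OF Y] obtain D where D: "\<And>p. p \<in> P \<Longrightarrow> norm (Y p) \<le> D * (H p ^ q * SS p ^ 2)" by blast
    have "small_defects p \<Phi> m S (C + D)"
      unfolding small_defects_def
    proof (intro allI impI)
      fix h :: real and k :: nat assume h: "0 < h" "h < h_max" "real (Suc k) * h \<le> T"
      show "AE \<omega> in M. norm (z (real (Suc k) * h) \<omega> - \<Phi> h k \<omega> (z (real k * h) \<omega>) - m h k \<omega>) \<le> (C + D) * (h ^ Suc p * (S \<omega>)\<^sup>2)"
        using S(2)
      proof eventually_elim
        case (elim \<omega>)
        let ?p = "(h, k, \<omega>)"
        have p: "?p \<in> P" using h elim by (simp add: P_def)
        have "norm (X ?p, Y ?p) \<le> (C + D) * (H ?p ^ q * SS ?p ^ 2)"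
          using C[OF p] D[OF p] norm_Pair_le[of "X ?p" "Y ?p"] unfolding distrib_right by linarith
        then show ?case unfolding eq q by (simp add: H_def SS_def)
      qed
    qed
    then show ?thesis by blast
  qed
  have "\<exists>C. small_defects 1 scheme_AB noise_AB S C"
    by (rule small[OF L.defect_AB]) (simp_all only: xs_next vs_next maps w, simp_all add: H_def noise_AB_def prod_eq_iff)
  moreover have "\<exists>C. small_defects 2 scheme_ABA noise_ABA S C"
    by (rule small[OF L.defect_ABA])
       (simp_all only: xs_next vs_next maps X_ABA noises, simp_all add: noise_ABA_def prod_eq_iff)
  moreover have "\<exists>C. small_defects 2 scheme_BAB noise_BAB S C"
    by (rule small[OF L.defect_BAB])
       (simp_all only: xs_next vs_next maps X_BAB noises, simp_all add: noise_BAB_def prod_eq_iff)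
  ultimately show thesis using that[OF S(1)] by blast
qed

lemma f'_measurable:
  assumes "t \<in> {0..T}" shows "(\<lambda>\<omega>. f' (x t \<omega>) i) \<in> borel_measurable (F t)"
proof -
  have "continuous_on UNIV (\<lambda>y. f' y i)"
  proof (rule lipschitz_on_continuous_on[OF lipschitz_onI[where L="\<bar>L2\<bar> * norm i"]])
    fix y z :: "real ^ 'n"
    have "norm (f' y i - f' z i) \<le> norm (f' y - f' z) * norm i"
      using norm_blinfun[of "f' y - f' z" i] by (simp add: blinfun.diff_left)
    also have "\<dots> \<le> (\<bar>L2\<bar> * norm (y - z)) * norm i"
      by (intro mult_right_mono order_trans[OF f'_lipschitz]) auto
    finally show "dist (f' y i) (f' z i) \<le> \<bar>L2\<bar> * norm i * dist y z"
      by (simp add: dist_norm mult_ac)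
  qed simp
  from measurable_compose[OF x_measurable[OF assms] borel_measurable_continuous_onI[OF this]] show ?thesis .
qed

end

context langevin_problem
begin

section \<open>Strong order of the splitting schemes\<close>

lemma noise_order_AB: "noise_order T 3 noise_AB"
proof -
  have eq: "noise_AB = (\<lambda>h k \<omega>. ((- (1 / 2) * h ^ 1) *\<^sub>R \<sigma> (step_W h k \<omega>), 0))"
    by (simp add: fun_eq_iff noise_AB_def)
  show ?thesis
    unfolding eq by (intro noise_order_Pair noise_order_zero noise_order_scaleR[OF noise_order_blinfun[OF noise_order_W]]) simp
qed

text \<open>
  The Jacobian is evaluated at the exact solution at the beginning of the step, hence known there.
\<close>

lemma noise_order_f':
  assumes X: "noise_order T q X"
  shows "noise_order T q (\<lambda>h k \<omega>. f' (x (real k * h) \<omega>) (X h k \<omega>))"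
proof -
  have "noise_order T (q + 2 * 0) (\<lambda>h k \<omega>. f' (x (real k * h) \<omega>) (X h k \<omega>))"
  proof (rule noise_order_family[OF X, where K=L1])
    fix h :: real and k :: nat and i :: "real ^ 'n"
    assume h: "0 < h" "real (Suc k) * h \<le> T"
    then have "real k * h \<in> {0..T}" by (auto simp: algebra_simps)
    then show "(\<lambda>\<omega>. f' (x (real k * h) \<omega>) i) \<in> borel_measurable (F (real k * h))" by (rule f'_measurable)
  qed (simp add: norm_f'_le)
  then show ?thesis by simp
qed

lemma noise_order_pos: "noise_order T 5 (noise_pos \<kappa>)"
proof -
  have eq: "noise_pos \<kappa> = (\<lambda>h k \<omega>. ((- 1) * h ^ 0) *\<^sub>R G (\<sigma> (step_J h k \<omega>))
      - (1 / 2 * h ^ 1) *\<^sub>R G (\<sigma> (step_U h k \<omega>)) + (\<kappa> * h ^ 2) *\<^sub>R G (\<sigma> (step_W h k \<omega>)))"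
    by (simp add: fun_eq_iff noise_pos_def)
  show ?thesis
    unfolding eq by (intro noise_order_add noise_order_diff
        noise_order_scaleR[OF noise_order_blinfun[OF noise_order_blinfun[OF noise_order_J]]]
        noise_order_scaleR[OF noise_order_blinfun[OF noise_order_blinfun[OF noise_order_U]]]
        noise_order_scaleR[OF noise_order_blinfun[OF noise_order_blinfun[OF noise_order_W]]]) simp_all
qed

lemma noise_order_JU: "noise_order T 5 (\<lambda>h k \<omega>. step_J h k \<omega> + (h / 2) *\<^sub>R step_U h k \<omega>)"
proof -
  have "noise_order T 5 (\<lambda>h k \<omega>. step_J h k \<omega> + (1 / 2 * h ^ 1) *\<^sub>R step_U h k \<omega>)"
    by (intro noise_order_add noise_order_J noise_order_scaleR[OF noise_order_U]) simp
  then show ?thesis by simp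
qed

lemma noise_order_vel:
  assumes X: "noise_order T 5 X"
  shows "noise_order T 5 (noise_vel X)"
proof -
  have eq: "noise_vel X = (\<lambda>h k \<omega>. f' (x (real k * h) \<omega>) (\<sigma> (X h k \<omega>))
     + G (G (\<sigma> (step_J h k \<omega> + (h / 2) *\<^sub>R step_U h k \<omega>))) - (1 / 6 * h ^ 2) *\<^sub>R G (G (\<sigma> (step_W h k \<omega>))))"
    by (simp add: fun_eq_iff noise_vel_def)
  show ?thesis
    unfolding eq by (intro noise_order_add noise_order_diff noise_order_f' noise_order_blinfun X noise_order_JU
        noise_order_scaleR[OF noise_order_blinfun[OF noise_order_blinfun[OF noise_order_blinfun[OF noise_order_W]]]]) simp
qed

lemma noise_order_ABA: "noise_order T 5 noise_ABA"
  unfolding noise_ABA_def[abs_def]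
  by (intro noise_order_Pair noise_order_pos noise_order_vel noise_order_JU)

lemma noise_order_BAB: "noise_order T 5 noise_BAB"
proof -
  have "noise_order T 5 (\<lambda>h k \<omega>. step_J h k \<omega> - (1 / 2 * h ^ 1) *\<^sub>R ((1 / 2 * h ^ 1) *\<^sub>R step_W h k \<omega> - step_U h k \<omega>))"
    by (intro noise_order_diff noise_order_J
        noise_order_scaleR[OF noise_order_diff[OF noise_order_scaleR[OF noise_order_W, of 3] noise_order_U]]) simp_all
  from noise_order_Pair[OF noise_order_pos noise_order_vel[OF this]]
  show ?thesis by (simp add: noise_BAB_def[abs_def])
qed

lemma scheme_strong_order:
  assumes near: "\<And>h k \<omega>. 0 < h \<Longrightarrow> h < h_max \<Longrightarrow> near_translation (C1 * h) (\<Phi> h k \<omega>)" and C1: "0 \<le> C1"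
    and S: "integrable M (\<lambda>\<omega>. (S \<omega>)\<^sup>2)"
    and defect: "small_defects p \<Phi> m S C2"
    and noise: "noise_order T (2 * p + 1) m"
  shows "strong_order M T (real p) z (\<lambda>h k \<omega>. iterate_steps (\<lambda>k. \<Phi> h k \<omega>) (z 0 \<omega>) k)"
proof -
  from noise obtain C3 where C3: "\<And>h k. 0 < h \<and> h \<le> 1 \<and> real (Suc k) * h \<le> T \<Longrightarrow>
      step_noise h k (C3 * h ^ (2 * p + 1)) (m h k)"
    unfolding noise_order_def by blast
  show ?thesis
    by (rule strong_order_if_defects_small[OF T h_max(1) S near C1 defect[unfolded small_defects_def, rule_format] C3])
       (use h_max(2) in auto)
qed

theorem splitting_strong_order:
  "strong_order M T 1 z (\<lambda>h k \<omega>. iterate_steps (\<lambda>k. scheme_AB h k \<omega>) (z 0 \<omega>) k)"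
  "strong_order M T 2 z (\<lambda>h k \<omega>. iterate_steps (\<lambda>k. scheme_ABA h k \<omega>) (z 0 \<omega>) k)"
  "strong_order M T 2 z (\<lambda>h k \<omega>. iterate_steps (\<lambda>k. scheme_BAB h k \<omega>) (z 0 \<omega>) k)"
proof -
  obtain S C1 C2 C3 where S: "integrable M (\<lambda>\<omega>. (S \<omega>)\<^sup>2)"
    and defects: "small_defects 1 scheme_AB noise_AB S C1"
      "small_defects 2 scheme_ABA noise_ABA S C2" "small_defects 2 scheme_BAB noise_BAB S C3"
    by (rule local_defects)
  define E where "E = exp 1 * (L1 + norm G)"
  have E: "0 \<le> E" unfolding E_def using L1_nonneg by simp
  have A: "near_translation (1 * h) (map_A \<tau> h k \<omega>)" and B: "near_translation (E * h) (map_B \<tau> h k \<omega>)"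
    if "0 < h" "h < h_max" "0 \<le> \<tau>" "\<tau> \<le> 1" for h \<tau> k \<omega>
    unfolding map_A_def map_B_def E_def
    using that h_max(2)[OF that(1,2)] by (intro near_translation_step_A near_translation_step_B; simp)+
  have h1: "0 \<le> h" "h \<le> 1" if "0 < h" "h < h_max" for h
    using that h_max(2)[OF that] by auto
  have AB: "near_translation ((1 + E + 1 * E) * h) (map_A \<tau> h k \<omega> \<circ> map_B \<tau>' h k \<omega>)"
    and BA: "near_translation ((E + 1 + E * 1) * h) (map_B \<tau> h k \<omega> \<circ> map_A \<tau>' h k \<omega>)"
    if "0 < h" "h < h_max" "0 \<le> \<tau>" "\<tau> \<le> 1" "0 \<le> \<tau>'" "\<tau>' \<le> 1" for h \<tau> \<tau>' k \<omega>
    using that E h1[OF that(1,2)] by (intro near_translation_comp A B; simp)+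
  have nAB: "near_translation ((1 + E + 1 * E) * h) (scheme_AB h k \<omega>)" if "0 < h" "h < h_max" for h k \<omega>
    unfolding scheme_AB_def by (rule AB[OF that]) simp_all
  have nABA: "near_translation (((1 + E + 1 * E) + 1 + (1 + E + 1 * E) * 1) * h) (scheme_ABA h k \<omega>)"
    if "0 < h" "h < h_max" for h k \<omega>
    unfolding scheme_ABA_def
    using E h1[OF that] by (intro near_translation_comp AB[OF that] A[OF that]) simp_all
  have nBAB: "near_translation (((E + 1 + E * 1) + E + (E + 1 + E * 1) * E) * h) (scheme_BAB h k \<omega>)"
    if "0 < h" "h < h_max" for h k \<omega>
    unfolding scheme_BAB_def
    using E h1[OF that] by (intro near_translation_comp BA[OF that] B[OF that]) simp_all
  show "strong_order M T 1 z (\<lambda>h k \<omega>. iterate_steps (\<lambda>k. scheme_AB h k \<omega>) (z 0 \<omega>) k)"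
    using scheme_strong_order[OF nAB _ S defects(1)] noise_order_AB E by simp
  show "strong_order M T 2 z (\<lambda>h k \<omega>. iterate_steps (\<lambda>k. scheme_ABA h k \<omega>) (z 0 \<omega>) k)"
    using scheme_strong_order[OF nABA _ S defects(2)] noise_order_ABA E by simp
  show "strong_order M T 2 z (\<lambda>h k \<omega>. iterate_steps (\<lambda>k. scheme_BAB h k \<omega>) (z 0 \<omega>) k)"
    using scheme_strong_order[OF nBAB _ S defects(3)] noise_order_BAB E by simp
qed

end

lemma iterate_steps_cong:
  "(\<And>j. j < k \<Longrightarrow> \<Phi> j = \<Psi> j) \<Longrightarrow> iterate_steps \<Phi> z k = iterate_steps \<Psi> z k"
  by (induction k) auto

text \<open>
  The exceptional null set may depend on step size and step, as in the identification of \<open>\<Delta>U\<close>.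
\<close>

lemma strong_order_iterate_cong:
  assumes "0 < \<Delta>"
    and eq: "\<And>h k. 0 < h \<Longrightarrow> h < \<Delta> \<Longrightarrow> AE \<omega> in M. \<Phi> h k \<omega> = \<Psi> h k \<omega>"
    and "strong_order M T p X (\<lambda>h k \<omega>. iterate_steps (\<lambda>k. \<Psi> h k \<omega>) (Z \<omega>) k)"
  shows "strong_order M T p X (\<lambda>h k \<omega>. iterate_steps (\<lambda>k. \<Phi> h k \<omega>) (Z \<omega>) k)"
proof -
  from assms(3) obtain C \<Delta>' where "0 < \<Delta>'" and C: "\<And>h N. 0 < h \<Longrightarrow> h < \<Delta>' \<Longrightarrow> real N * h = T \<Longrightarrow>
      (\<integral>\<^sup>+\<omega>. (SUP k\<in>{..N}. ennreal (norm (X (real k * h) \<omega> - iterate_steps (\<lambda>k. \<Psi> h k \<omega>) (Z \<omega>) k))) \<partial>M) \<le> ennreal (C * h powr p)"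
    unfolding strong_order_def by blast
  show ?thesis
    unfolding strong_order_def
  proof (rule exI[of _ C], rule exI[of _ "min \<Delta> \<Delta>'"], intro conjI allI impI)
    show "0 < min \<Delta> \<Delta>'" using \<open>0 < \<Delta>\<close> \<open>0 < \<Delta>'\<close> by simp
    fix h N assume h: "0 < h \<and> h < min \<Delta> \<Delta>' \<and> real N * h = T"
    have "AE \<omega> in M. \<forall>j\<in>{..<N}. \<Phi> h j \<omega> = \<Psi> h j \<omega>"
      using h by (intro AE_finite_allI eq) auto
    then have "AE \<omega> in M. (SUP k\<in>{..N}. ennreal (norm (X (real k * h) \<omega> - iterate_steps (\<lambda>k. \<Phi> h k \<omega>) (Z \<omega>) k)))
          = (SUP k\<in>{..N}. ennreal (norm (X (real k * h) \<omega> - iterate_steps (\<lambda>k. \<Psi> h k \<omega>) (Z \<omega>) k)))"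
    proof eventually_elim
      case (elim \<omega>)
      have "iterate_steps (\<lambda>k. \<Phi> h k \<omega>) (Z \<omega>) k = iterate_steps (\<lambda>k. \<Psi> h k \<omega>) (Z \<omega>) k" if "k \<in> {..N}" for k
        using elim that by (intro iterate_steps_cong) auto
      then show ?case by (intro SUP_cong) auto
    qed
    then have "(\<integral>\<^sup>+\<omega>. (SUP k\<in>{..N}. ennreal (norm (X (real k * h) \<omega> - iterate_steps (\<lambda>k. \<Phi> h k \<omega>) (Z \<omega>) k))) \<partial>M)
        = (\<integral>\<^sup>+\<omega>. (SUP k\<in>{..N}. ennreal (norm (X (real k * h) \<omega> - iterate_steps (\<lambda>k. \<Psi> h k \<omega>) (Z \<omega>) k))) \<partial>M)"
      by (rule nn_integral_cong_AE)
    also have "\<dots> \<le> ennreal (C * h powr p)" using C h by auto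
    finally show "(\<integral>\<^sup>+\<omega>. (SUP k\<in>{..N}. ennreal (norm (X (real k * h) \<omega> - iterate_steps (\<lambda>k. \<Phi> h k \<omega>) (Z \<omega>) k))) \<partial>M) \<le> ennreal (C * h powr p)" .
  qed
qed

theorem theorem4p4:
  fixes M :: "'w measure"
    and F :: "real \<Rightarrow> 'w measure"
    and W :: "real \<Rightarrow> 'w \<Rightarrow> real ^ 'n"
    and f :: "real ^ 'n \<Rightarrow> real ^ 'n"
    and f' :: "real ^ 'n \<Rightarrow> (real ^ 'n) \<Rightarrow>\<^sub>L (real ^ 'n)"
    and f'' :: "real ^ 'n \<Rightarrow> (real ^ 'n) \<Rightarrow>\<^sub>L ((real ^ 'n) \<Rightarrow>\<^sub>L (real ^ 'n))"
    and \<Gamma> \<sigma> :: "real ^ 'n ^ 'n"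
    and kB \<Theta> T :: real
    and x v :: "real \<Rightarrow> 'w \<Rightarrow> real ^ 'n"
  defines "A \<equiv> \<lambda>h k \<omega>. field_A \<sigma> h (delta_U M W h k \<omega>)"
    and "B \<equiv> \<lambda>h k \<omega>. field_B f \<Gamma> \<sigma> h (delta_W W h k \<omega>) (delta_U M W h k \<omega>)"
  assumes "brownian_motion M F W"
    and "\<And>y. (f has_derivative blinfun_apply (f' y)) (at y)"
    and "\<And>y. (f' has_derivative blinfun_apply (f'' y)) (at y)"
    and "bounded (range f')" and "bounded (range f'')"
    and "\<sigma> ** transpose \<sigma> = (2 * kB * \<Theta>) *\<^sub>R \<Gamma>"
    and "T > 0"
    and "langevin_solution M F W T f \<Gamma> \<sigma> x v"
    and "integrable M (\<lambda>\<omega>. (norm (x 0 \<omega>, v 0 \<omega>))\<^sup>2)"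
  shows "strong_order M T 1 (\<lambda>t \<omega>. (x t \<omega>, v t \<omega>))
           (\<lambda>h k \<omega>. iterate_steps
              (\<lambda>k. flow_map 1 (A h k \<omega>) \<circ> flow_map 1 (B h k \<omega>)) (x 0 \<omega>, v 0 \<omega>) k)
       \<and> strong_order M T 2 (\<lambda>t \<omega>. (x t \<omega>, v t \<omega>))
           (\<lambda>h k \<omega>. iterate_steps
              (\<lambda>k. flow_map (1/2) (A h k \<omega>) \<circ> flow_map 1 (B h k \<omega>) \<circ> flow_map (1/2) (A h k \<omega>))
              (x 0 \<omega>, v 0 \<omega>) k)
       \<and> strong_order M T 2 (\<lambda>t \<omega>. (x t \<omega>, v t \<omega>))
           (\<lambda>h k \<omega>. iterate_steps
              (\<lambda>k. flow_map (1/2) (B h k \<omega>) \<circ> flow_map 1 (A h k \<omega>) \<circ> flow_map (1/2) (B h k \<omega>))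
              (x 0 \<omega>, v 0 \<omega>) k)"
proof -
  obtain L1 where L1: "\<And>y. norm (f' y) \<le> L1" using assms(6) by (auto simp: bounded_iff)
  obtain L2 where L2: "\<And>y. norm (f'' y) \<le> L2" using assms(7) by (auto simp: bounded_iff)
  have lip: "norm (f' y - f' z) \<le> L2 * norm (y - z)" for y z
    by (rule differentiable_bound[where S=UNIV and f'="\<lambda>y. blinfun_apply (f'' y)"])
       (auto simp: assms(5) L2 norm_blinfun.rep_eq[symmetric])
  define G where "G = Blinfun (\<lambda>y. \<Gamma> *v y)"
  define s where "s = Blinfun (\<lambda>y. \<sigma> *v y)"
  have G: "blinfun_apply G y = \<Gamma> *v y" and s: "blinfun_apply s y = \<sigma> *v y" for y
    unfolding G_def s_def by (simp_all add: bounded_linear_Blinfun_apply matrix_vector_mul_bounded_linear)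
  interpret langevin_problem M F W f f' G s L1 L2 T x v
  proof
    show "brownian_motion M F W" by fact
    show "(f has_derivative blinfun_apply (f' y)) (at y)" for y by fact
    show "norm (f' y) \<le> L1" for y by (rule L1)
    show "norm (f' y - f' z) \<le> L2 * norm (y - z)" for y z by (rule lip)
    show "0 < T" by fact
    show "x t \<in> borel_measurable (F t)" "v t \<in> borel_measurable (F t)" if "t \<in> {0..T}" for t
      using assms(10) that by (auto simp: langevin_solution_def)
    show "AE \<omega> in M. continuous_on {0..T} (\<lambda>t. x t \<omega>) \<and> continuous_on {0..T} (\<lambda>t. v t \<omega>) \<and>
        (\<forall>t\<in>{0..T}. x t \<omega> = x 0 \<omega> + integral {0..t} (\<lambda>s. v s \<omega>) \<and>
           v t \<omega> = v 0 \<omega> + integral {0..t} (\<lambda>s. f (x s \<omega>) - G (v s \<omega>)) + s (W t \<omega> - W 0 \<omega>))"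
      using assms(10) unfolding langevin_solution_def G s by blast
    show "integrable M (\<lambda>\<omega>. (norm (x 0 \<omega>, v 0 \<omega>))\<^sup>2)" by fact
  qed
  have flows: "AE \<omega> in M. (\<forall>\<tau>\<in>{0..1}. flow_map \<tau> (A h k \<omega>) = map_A \<tau> h k \<omega> \<and> flow_map \<tau> (B h k \<omega>) = map_B \<tau> h k \<omega>)"
    if h: "0 < h" "h < h_max" for h k
    using delta_U_eq[OF h(1), of k]
  proof eventually_elim
    case (elim \<omega>)
    then have U: "delta_U M W h k \<omega> = step_U h k \<omega>" by (simp add: step_U_def step_W_def step_I_def)
    have W: "delta_W W h k \<omega> = step_W h k \<omega>" by (simp add: delta_W_def step_W_def)
    note small = h_max(2)[OF h]
    show ?case
    proof (intro ballI conjI ext)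
      fix \<tau> :: real and z assume \<tau>: "\<tau> \<in> {0..1}"
      show "flow_map \<tau> (A h k \<omega>) z = map_A \<tau> h k \<omega> z"
        unfolding map_A_def
        by (rule flow_map_step_A) (use \<tau> small h in \<open>auto simp: A_def field_A_def U s\<close>)
      show "flow_map \<tau> (B h k \<omega>) z = map_B \<tau> h k \<omega> z"
        unfolding map_B_def
        by (rule flow_map_step_B) (use \<tau> small h in \<open>auto simp: B_def field_B_def U W s G\<close>)
    qed
  qed
  show ?thesis
  proof (intro conjI)
    show "strong_order M T 1 z (\<lambda>h k \<omega>. iterate_steps (\<lambda>k. flow_map 1 (A h k \<omega>) \<circ> flow_map 1 (B h k \<omega>)) (z 0 \<omega>) k)"
    proof (rule strong_order_iterate_cong[OF h_max(1) _ splitting_strong_order(1)])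
      fix h k assume "0 < h" "h < h_max"
      from flows[OF this, of k] show "AE \<omega> in M. flow_map 1 (A h k \<omega>) \<circ> flow_map 1 (B h k \<omega>) = scheme_AB h k \<omega>"
        by eventually_elim (simp add: scheme_AB_def)
    qed
    show "strong_order M T 2 z (\<lambda>h k \<omega>. iterate_steps
        (\<lambda>k. flow_map (1/2) (A h k \<omega>) \<circ> flow_map 1 (B h k \<omega>) \<circ> flow_map (1/2) (A h k \<omega>)) (z 0 \<omega>) k)"
    proof (rule strong_order_iterate_cong[OF h_max(1) _ splitting_strong_order(2)])
      fix h k assume "0 < h" "h < h_max"
      from flows[OF this, of k] show "AE \<omega> in M. flow_map (1/2) (A h k \<omega>) \<circ> flow_map 1 (B h k \<omega>) \<circ> flow_map (1/2) (A h k \<omega>)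
          = scheme_ABA h k \<omega>"
        by eventually_elim (simp add: scheme_ABA_def)
    qed
    show "strong_order M T 2 z (\<lambda>h k \<omega>. iterate_steps
        (\<lambda>k. flow_map (1/2) (B h k \<omega>) \<circ> flow_map 1 (A h k \<omega>) \<circ> flow_map (1/2) (B h k \<omega>)) (z 0 \<omega>) k)"
    proof (rule strong_order_iterate_cong[OF h_max(1) _ splitting_strong_order(3)])
      fix h k assume "0 < h" "h < h_max"
      from flows[OF this, of k] show "AE \<omega> in M. flow_map (1/2) (B h k \<omega>) \<circ> flow_map 1 (A h k \<omega>) \<circ> flow_map (1/2) (B h k \<omega>)
          = scheme_BAB h k \<omega>"
        by eventually_elim (simp add: scheme_BAB_def)
    qed
  qed
qed

end
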